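(* Let $0<p<q\leq1$. For every infinite-dimensional $q$-Banach space $X$, the $p$-Banach spaces $\mathcal F_p(X)$ and $X\oplus_pZ_X$ are Lipschitz isomorphic (there is a bi-Lipschitz bijection between them), but they are not linearly isomorphic.
   Context: All vector spaces are real. For $0<s\le 1$, an $s$-Banach space is a complete quasi-normed space $X$ with $\|x+y\|^s\le\|x\|^s+\|y\|^s$; a $q$-Banach space is a $p$-Banach space if $p\le q$. A $p$-metric $d$ is a function such that $d^p$ is a metric. Pointed maps send base point to base point (the base point of a vector space being $0$). For a pointed $p$-metric space $(M,d,0)$, the Lipschitz-free $p$-space $\mathcal F_p(M)$ is the (unique up to linear isometry) $p$-Banach space equipped with an isometric pointed map $\delta_M\colon M\to\mathcal F_p(M)$ whose linear span is dense, such that every pointed Lipschitz map $f\colon M\to Y$ into a $p$-Banach space $Y$ has a unique bounded linear extension $\widehat f\colon\mathcal F_p(M)\to Y$ with $\widehat f\,\delta_M=f$, and $\|\widehat f\|=\operatorname{Lip}(f)$. The $q$-Banach space $X$ is equipped with the distance $\|x-y\|$ and base point $0$. The barycenter map $\beta_X\colon\mathcal F_p(X)\to X$ is the linearization of the identity, so $\beta_X\delta_X(x)=x$. $Z_X=\ker\beta_X\subseteq\mathcal F_p(X)$. $X\oplus_pZ_X$ is $X\oplus Z_X$ with quasi-norm $\|(x,z)\|=(\|x\|^p+\|z\|^p)^{1/p}$. Bi-Lipschitz is with respect to the quasi-norm distances; linearly isomorphic means there is a bounded linear bijection with bounded inverse. *)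

theory Defs
  imports "HOL-Analysis.Analysis" "HOL-Analysis.Finite_Function_Topology"
begin

section \<open>Quasi-Banach spaces on subspaces of a real vector space\<close>

text \<open>
  For \<open>p < 1\<close> the class \<open>real_normed_vector\<close> is not available, and kernels are needed as spaces in
  their own right.  A quasi-normed space is therefore a pair \<open>(V, N)\<close> of a linear subspace \<open>V\<close> of
  some real vector space and a function \<open>N\<close>, of which only the values on \<open>V\<close> matter.
\<close>

definition quasi_norm_on :: "'a::real_vector set \<Rightarrow> ('a \<Rightarrow> real) \<Rightarrow> bool" where
  "quasi_norm_on V N \<longleftrightarrow> subspace V \<and>
     (\<forall>x\<in>V. 0 \<le> N x) \<and> (\<forall>x\<in>V. N x = 0 \<longleftrightarrow> x = 0) \<and>
     (\<forall>x\<in>V. \<forall>a. N (a *\<^sub>R x) = \<bar>a\<bar> * N x) \<and>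
     (\<exists>C\<ge>1. \<forall>x\<in>V. \<forall>y\<in>V. N (x + y) \<le> C * (N x + N y))"

definition complete_on :: "'a::real_vector set \<Rightarrow> ('a \<Rightarrow> real) \<Rightarrow> bool" where
  "complete_on V N \<longleftrightarrow> (\<forall>\<sigma>::nat \<Rightarrow> 'a. range \<sigma> \<subseteq> V \<longrightarrow>
     (\<forall>e>0. \<exists>n0. \<forall>m\<ge>n0. \<forall>n\<ge>n0. N (\<sigma> m - \<sigma> n) < e) \<longrightarrow>
     (\<exists>x\<in>V. (\<lambda>n. N (\<sigma> n - x)) \<longlonglongrightarrow> 0))"

definition s_Banach :: "real \<Rightarrow> 'a::real_vector set \<Rightarrow> ('a \<Rightarrow> real) \<Rightarrow> bool" where
  "s_Banach s V N \<longleftrightarrow> 0 < s \<and> s \<le> 1 \<and> quasi_norm_on V N \<and> complete_on V N \<and>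
     (\<forall>x\<in>V. \<forall>y\<in>V. N (x + y) powr s \<le> N x powr s + N y powr s)"

definition infinite_dimensional :: "'a::real_vector set \<Rightarrow> bool" where
  "infinite_dimensional V \<longleftrightarrow> \<not> (\<exists>B. finite B \<and> V \<subseteq> span B)"

definition qdist :: "('a::real_vector \<Rightarrow> real) \<Rightarrow> 'a \<Rightarrow> 'a \<Rightarrow> real" where
  "qdist N = (\<lambda>x y. N (x - y))"

definition sum_norm :: "real \<Rightarrow> ('a \<Rightarrow> real) \<Rightarrow> ('b \<Rightarrow> real) \<Rightarrow> 'a \<times> 'b \<Rightarrow> real" where
  "sum_norm p NV NW = (\<lambda>(x, z). (NV x powr p + NW z powr p) powr (1 / p))"

definition bounded_linear_between ::
  "'a::real_vector set \<Rightarrow> ('a \<Rightarrow> real) \<Rightarrow> 'b::real_vector set \<Rightarrow> ('b \<Rightarrow> real) \<Rightarrow> ('a \<Rightarrow> 'b) \<Rightarrow> bool"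
where
  "bounded_linear_between V NV W NW T \<longleftrightarrow> T ` V \<subseteq> W \<and>
     (\<forall>x\<in>V. \<forall>y\<in>V. T (x + y) = T x + T y) \<and> (\<forall>x\<in>V. \<forall>a. T (a *\<^sub>R x) = a *\<^sub>R T x) \<and>
     (\<exists>C. \<forall>x\<in>V. NW (T x) \<le> C * NV x)"

definition operator_norm ::
  "'a set \<Rightarrow> ('a \<Rightarrow> real) \<Rightarrow> ('b \<Rightarrow> real) \<Rightarrow> ('a \<Rightarrow> 'b) \<Rightarrow> real" where
  "operator_norm V NV NW T = (SUP x\<in>{x\<in>V. NV x \<le> 1}. NW (T x))"

definition linearly_isomorphic ::
  "'a::real_vector set \<Rightarrow> ('a \<Rightarrow> real) \<Rightarrow> 'b::real_vector set \<Rightarrow> ('b \<Rightarrow> real) \<Rightarrow> bool" where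
  "linearly_isomorphic V NV W NW \<longleftrightarrow> (\<exists>T. bij_betw T V W \<and>
     bounded_linear_between V NV W NW T \<and> bounded_linear_between W NW V NV (the_inv_into V T))"

section \<open>p-metrics and Lipschitz maps\<close>

text \<open>The locale \<open>Metric_space\<close> constrains \<open>d\<close> off \<open>M\<close> as well, hence the truncation.\<close>

definition p_metric :: "real \<Rightarrow> 'm set \<Rightarrow> ('m \<Rightarrow> 'm \<Rightarrow> real) \<Rightarrow> bool" where
  "p_metric p M d \<longleftrightarrow> (\<forall>x\<in>M. \<forall>y\<in>M. 0 \<le> d x y) \<and>
     Metric_space M (\<lambda>x y. if x \<in> M \<and> y \<in> M then d x y powr p else 0)"

definition lipschitz_with ::
  "real \<Rightarrow> 'm set \<Rightarrow> ('m \<Rightarrow> 'm \<Rightarrow> real) \<Rightarrow> ('n \<Rightarrow> 'n \<Rightarrow> real) \<Rightarrow> ('m \<Rightarrow> 'n) \<Rightarrow> bool" where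
  "lipschitz_with L M d e f \<longleftrightarrow> 0 \<le> L \<and> (\<forall>x\<in>M. \<forall>y\<in>M. e (f x) (f y) \<le> L * d x y)"

definition Lip :: "'m set \<Rightarrow> ('m \<Rightarrow> 'm \<Rightarrow> real) \<Rightarrow> ('n \<Rightarrow> 'n \<Rightarrow> real) \<Rightarrow> ('m \<Rightarrow> 'n) \<Rightarrow> real" where
  "Lip M d e f = Inf {L. lipschitz_with L M d e f}"

definition lipschitz_isomorphic ::
  "'m set \<Rightarrow> ('m \<Rightarrow> 'm \<Rightarrow> real) \<Rightarrow> 'n set \<Rightarrow> ('n \<Rightarrow> 'n \<Rightarrow> real) \<Rightarrow> bool" where
  "lipschitz_isomorphic M d M' d' \<longleftrightarrow> (\<exists>f. bij_betw f M M' \<and>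
     (\<exists>L. lipschitz_with L M d d' f) \<and> (\<exists>L. lipschitz_with L M' d' d (the_inv_into M f)))"

section \<open>Lipschitz-free p-spaces\<close>

text \<open>Requiring \<open>T\<close> to be extensional makes ``the extension'' unique as a HOL function.\<close>

definition linearizes ::
  "'m set \<Rightarrow> 'f::real_vector set \<Rightarrow> ('f \<Rightarrow> real) \<Rightarrow> ('m \<Rightarrow> 'f) \<Rightarrow>
   'y::real_vector set \<Rightarrow> ('y \<Rightarrow> real) \<Rightarrow> ('m \<Rightarrow> 'y) \<Rightarrow> ('f \<Rightarrow> 'y) \<Rightarrow> bool" where
  "linearizes M F NF \<delta> Y NY f T \<longleftrightarrow> T \<in> extensional F \<and>
     bounded_linear_between F NF Y NY T \<and> (\<forall>x\<in>M. T (\<delta> x) = f x)"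

definition universal_towards ::
  "'m set \<Rightarrow> ('m \<Rightarrow> 'm \<Rightarrow> real) \<Rightarrow> 'm \<Rightarrow> 'f::real_vector set \<Rightarrow> ('f \<Rightarrow> real) \<Rightarrow> ('m \<Rightarrow> 'f) \<Rightarrow>
   'y::real_vector set \<Rightarrow> ('y \<Rightarrow> real) \<Rightarrow> bool" where
  "universal_towards M d z F NF \<delta> Y NY \<longleftrightarrow>
     (\<forall>f. f ` M \<subseteq> Y \<longrightarrow> f z = 0 \<longrightarrow> (\<exists>L. lipschitz_with L M d (qdist NY) f) \<longrightarrow>
       (\<exists>!T. linearizes M F NF \<delta> Y NY f T) \<and>
       operator_norm F NF NY (THE T. linearizes M F NF \<delta> Y NY f T) = Lip M d (qdist NY) f)"

text \<open>
  HOL cannot quantify over all types inside a definition, so the targets \<open>Y\<close> of the universal property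
  range over the subspaces of one type, the free vector space on \<open>nat \<Rightarrow> 'm \<Rightarrow> real\<close>.  Nothing is lost:
  the image of an extension lies in the closure of the span of \<open>f ` M\<close>, every element of which is the
  limit of a sequence of linear combinations of points \<open>f x\<close>, that is, is determined by some
  element of \<open>nat \<Rightarrow> 'm \<Rightarrow> real\<close>; hence that closure embeds linearly in this type.  Lemma
  \<open>lipschitz_free_universal\<close> derives the universal property for targets in an arbitrary type.
\<close>

type_synonym 'm test_space = "(nat \<Rightarrow> 'm \<Rightarrow> real, real) poly_mapping"

definition lipschitz_free ::
  "real \<Rightarrow> 'm set \<Rightarrow> ('m \<Rightarrow> 'm \<Rightarrow> real) \<Rightarrow> 'm \<Rightarrow>
   'f::real_vector set \<Rightarrow> ('f \<Rightarrow> real) \<Rightarrow> ('m \<Rightarrow> 'f) \<Rightarrow> bool" where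
  "lipschitz_free p M d z F NF \<delta> \<longleftrightarrow>
     p_metric p M d \<and> z \<in> M \<and> s_Banach p F NF \<and>
     \<delta> ` M \<subseteq> F \<and> \<delta> z = 0 \<and> (\<forall>x\<in>M. \<forall>y\<in>M. NF (\<delta> x - \<delta> y) = d x y) \<and>
     (\<forall>v\<in>F. \<forall>e>0. \<exists>w\<in>span (\<delta> ` M). NF (v - w) < e) \<and>
     (\<forall>(Y :: 'm test_space set) NY. s_Banach p Y NY \<longrightarrow> universal_towards M d z F NF \<delta> Y NY)"

definition barycenter ::
  "'x::real_vector set \<Rightarrow> ('x \<Rightarrow> real) \<Rightarrow> 'f::real_vector set \<Rightarrow> ('f \<Rightarrow> real) \<Rightarrow> ('x \<Rightarrow> 'f) \<Rightarrow> 'f \<Rightarrow> 'x"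
where
  "barycenter X N F NF \<delta> = (THE T. linearizes X F NF \<delta> X N (\<lambda>x. x) T)"

definition barycenter_kernel ::
  "'x::real_vector set \<Rightarrow> ('x \<Rightarrow> real) \<Rightarrow> 'f::real_vector set \<Rightarrow> ('f \<Rightarrow> real) \<Rightarrow> ('x \<Rightarrow> 'f) \<Rightarrow> 'f set"
where
  "barycenter_kernel X N F NF \<delta> = {v \<in> F. barycenter X N F NF \<delta> v = 0}"

section \<open>Well-definedness of the notions above\<close>


lemma s_BanachD:
  assumes "s_Banach s V N"
  shows "0 < s" "s \<le> 1" "subspace V" "x \<in> V \<Longrightarrow> 0 \<le> N x" "x \<in> V \<Longrightarrow> N x = 0 \<longleftrightarrow> x = 0"
    "x \<in> V \<Longrightarrow> N (a *\<^sub>R x) = \<bar>a\<bar> * N x"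
    "x \<in> V \<Longrightarrow> y \<in> V \<Longrightarrow> N (x + y) powr s \<le> N x powr s + N y powr s"
    "complete_on V N"
  using assms unfolding s_Banach_def quasi_norm_on_def by auto

lemma complete_onD:
  assumes "s_Banach s V N" "\<And>n. \<sigma> n \<in> V"
    "\<forall>e>0. \<exists>n0. \<forall>m\<ge>n0. \<forall>n\<ge>n0. N (\<sigma> m - \<sigma> n) < e"
  obtains x where "x \<in> V" "(\<lambda>n. N (\<sigma> n - x)) \<longlonglongrightarrow> 0"
proof -
  have "range \<sigma> \<subseteq> V" using assms(2) by auto
  with s_BanachD(8)[OF assms(1)] assms(3) that show thesis unfolding complete_on_def by blast
qed

lemma quasi_triangle:
  assumes "s_Banach s V N"
  obtains C where "C \<ge> 1" "\<And>x y. x \<in> V \<Longrightarrow> y \<in> V \<Longrightarrow> N (x + y) \<le> C * (N x + N y)"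
  using assms unfolding s_Banach_def quasi_norm_on_def by auto

lemma norm_minus_commute_on:
  assumes "s_Banach s V N" "x \<in> V" "y \<in> V"
  shows "N (x - y) = N (y - x)"
proof -
  have "x - y \<in> V" using assms s_BanachD(3)[OF assms(1)] by (simp add: subspace_diff)
  from s_BanachD(6)[OF assms(1) this, of "-1"] show ?thesis by simp
qed

lemma embed_by_injection:
  fixes V :: "'y::real_vector set" and c :: "'y \<Rightarrow> 'i"
  assumes V: "subspace V" and c: "inj_on c V"
  obtains J :: "'y \<Rightarrow> ('i, real) poly_mapping" where "linear J" "inj_on J V"
proof -
  obtain B where B: "B \<subseteq> V" "independent B" "V \<subseteq> span B"
    by (rule maximal_independent_subset)
  define h where "h = (\<lambda>b. Poly_Mapping.single (c b) (1::real))"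
  have injh: "inj_on h B"
  proof (rule inj_onI)
    fix x y assume xy: "x \<in> B" "y \<in> B" "h x = h y"
    then have "Poly_Mapping.lookup (h x) (c y) = Poly_Mapping.lookup (h y) (c y)" by simp
    then have "c x = c y" unfolding h_def by (simp add: lookup_single when_def split: if_splits)
    then show "x = y" using xy B(1) c by (auto dest: inj_onD)
  qed
  have "independent (h ` B)"
    proof
      assume "dependent (h ` B)"
      then obtain t u where t: "finite t" "t \<subseteq> h ` B" "(\<Sum>v\<in>t. u v *\<^sub>R v) = 0" "\<exists>v\<in>t. u v \<noteq> 0"
        unfolding dependent_explicit by blast
      then obtain v where v: "v \<in> t" "u v \<noteq> 0" by blast
      then obtain b where b: "b \<in> B" "v = h b" using t(2) by blast
      have lk: "Poly_Mapping.lookup w (c b) = (if w = v then 1 else 0)" if wt: "w \<in> t" for w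
      proof -
        obtain b' where b': "b' \<in> B" "w = h b'" using wt t(2) by blast
        have "w = v \<longleftrightarrow> b' = b" using b b' injh by (auto dest: inj_onD)
        moreover have "c b' = c b \<longleftrightarrow> b' = b" using b b' B(1) c by (auto dest: inj_onD)
        ultimately show ?thesis unfolding b'(2) h_def by (simp add: lookup_single when_def)
      qed
      have sc: "Poly_Mapping.lookup (r *\<^sub>R w) k = r * Poly_Mapping.lookup w k"
        for r and w :: "('i, real) poly_mapping" and k
        unfolding scaleR_poly_mapping_def
        by (subst Abs_poly_mapping_inverse) (auto intro: finite_subset[OF _ finite_lookup[of w]])
      have "0 = Poly_Mapping.lookup (\<Sum>v\<in>t. u v *\<^sub>R v) (c b)" using t(3) by simp
      also have "\<dots> = (\<Sum>w\<in>t. u w * Poly_Mapping.lookup w (c b))"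
        by (simp add: lookup_sum sc)
      also have "\<dots> = (\<Sum>w\<in>t. if w = v then u w else 0)"
        by (rule sum.cong) (auto simp: lk)
      also have "\<dots> = u v" using t(1) v by simp
      finally show False using v by simp
    qed
  note indep = this
  obtain J where J: "linear J" "\<forall>b\<in>B. J b = h b"
    using linear_independent_extend[OF B(2)] by blast
  have im: "J ` B = h ` B" and inj: "inj_on J B" using J(2) injh by (auto simp: inj_on_def)
  have "inj_on J (span B)"
    using linear_inj_on_span_iff_independent_image[OF J(1), of B] indep inj by (simp add: im)
  then have "inj_on J V" using B(3) by (rule inj_on_subset)
  with J(1) show thesis by (rule that)
qed

lemma span_image_lincomb:
  fixes f :: "'m \<Rightarrow> 'y::real_vector"
  assumes "w \<in> span (f ` M)"
  shows "\<exists>a. w = (\<Sum>x\<in>{x. a x \<noteq> 0}. a x *\<^sub>R f x)"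
proof -
  obtain t r where t: "finite t" "t \<subseteq> f ` M" "w = (\<Sum>v\<in>t. r v *\<^sub>R v)"
    using assms unfolding span_explicit by blast
  then obtain U where U: "U \<subseteq> M" "inj_on f U" "t = f ` U"
    by (auto simp: subset_image_inj)
  have fU: "finite U" using t(1) U finite_imageD by blast
  define a where "a = (\<lambda>x. if x \<in> U then r (f x) else 0)"
  have "w = (\<Sum>x\<in>U. a x *\<^sub>R f x)"
    using t(3) U by (simp add: sum.reindex a_def)
  also have "\<dots> = (\<Sum>x\<in>{x. a x \<noteq> 0}. a x *\<^sub>R f x)"
    using fU by (intro sum.mono_neutral_right) (auto simp: a_def split: if_splits)
  finally show ?thesis by blast
qed

definition qclosure :: "'y set \<Rightarrow> ('y \<Rightarrow> real) \<Rightarrow> 'y set \<Rightarrow> 'y::real_vector set" where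
  "qclosure Y N S = {y \<in> Y. \<forall>e>0. \<exists>w\<in>span S. N (y - w) < e}"

lemma s_Banach_closed_subspace:
  assumes Y: "s_Banach s Y N" and S: "subspace S" "S \<subseteq> Y"
    and cl: "\<And>\<sigma> x. range \<sigma> \<subseteq> S \<Longrightarrow> x \<in> Y \<Longrightarrow> (\<lambda>n. N (\<sigma> n - x)) \<longlonglongrightarrow> 0 \<Longrightarrow> x \<in> S"
  shows "s_Banach s S N"
  unfolding s_Banach_def
proof (intro conjI)
  show "quasi_norm_on S N" using Y S unfolding s_Banach_def quasi_norm_on_def by (meson subsetD)
  show "complete_on S N" unfolding complete_on_def
  proof (intro allI impI)
    fix \<sigma> :: "nat \<Rightarrow> 'a" assume a: "range \<sigma> \<subseteq> S"
      "\<forall>e>0. \<exists>n0. \<forall>m\<ge>n0. \<forall>n\<ge>n0. N (\<sigma> m - \<sigma> n) < e"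
    have "range \<sigma> \<subseteq> Y" using a(1) S(2) by blast
    then obtain x where x: "x \<in> Y" "(\<lambda>n. N (\<sigma> n - x)) \<longlonglongrightarrow> 0"
      using s_BanachD(8)[OF Y] a(2) unfolding complete_on_def by blast
    with cl[OF a(1) x] show "\<exists>x\<in>S. (\<lambda>n. N (\<sigma> n - x)) \<longlonglongrightarrow> 0" by blast
  qed
qed (use Y S in \<open>auto simp: s_Banach_def\<close>)

lemma qclosure_s_Banach:
  assumes Y: "s_Banach s Y N" and S: "S \<subseteq> Y"
  shows "s_Banach s (qclosure Y N S) N"
proof -
  note sub = s_BanachD(3)[OF Y]
  have spY: "span S \<subseteq> Y" using S sub by (simp add: span_minimal)
  obtain C where C: "C \<ge> 1" "\<And>x y. x \<in> Y \<Longrightarrow> y \<in> Y \<Longrightarrow> N (x + y) \<le> C * (N x + N y)"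
    using quasi_triangle[OF Y] by blast
  show ?thesis
  proof (rule s_Banach_closed_subspace[OF Y])
    show "qclosure Y N S \<subseteq> Y" unfolding qclosure_def by auto
    show "subspace (qclosure Y N S)" unfolding subspace_def
    proof (intro conjI ballI allI)
      have "N 0 = 0" using s_BanachD(5)[OF Y] sub by (simp add: subspace_0)
      then show "0 \<in> qclosure Y N S" unfolding qclosure_def using sub
        by (auto simp: subspace_0 intro!: bexI[of _ 0] span_zero)
    next
      fix x y assume xy: "x \<in> qclosure Y N S" "y \<in> qclosure Y N S"
      then have xyY: "x \<in> Y" "y \<in> Y" by (auto simp: qclosure_def)
      have "\<exists>w\<in>span S. N (x + y - w) < e" if e: "e > 0" for e
      proof -
        have "e / (2 * C) > 0" using e C by simp
        then obtain v w where vw: "v \<in> span S" "N (x - v) < e / (2*C)" "w \<in> span S" "N (y - w) < e / (2*C)"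
          using xy unfolding qclosure_def by blast
        have "N ((x - v) + (y - w)) \<le> C * (N (x - v) + N (y - w))"
          using vw xyY spY sub by (intro C) (auto intro!: subspace_diff)
        also have "\<dots> < C * (e / (2*C) + e / (2*C))"
          using vw C(1) by (intro mult_strict_left_mono add_strict_mono) auto
        also have "\<dots> = e" using C(1) by (simp add: field_simps)
        finally show ?thesis
          using vw by (intro bexI[of _ "v + w"]) (auto simp: algebra_simps span_add)
      qed
      then show "x + y \<in> qclosure Y N S"
        using xyY sub by (auto simp: qclosure_def subspace_add)
    next
      fix x and r :: real assume x: "x \<in> qclosure Y N S"
      then have xY: "x \<in> Y" by (auto simp: qclosure_def)
      have "\<exists>w\<in>span S. N (r *\<^sub>R x - w) < e" if e: "e > 0" for e
      proof -
        have "e / (\<bar>r\<bar> + 1) > 0" using e by simp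
        then obtain w where w: "w \<in> span S" "N (x - w) < e / (\<bar>r\<bar> + 1)"
          using x unfolding qclosure_def by blast
        have wY: "x - w \<in> Y" using w xY spY sub by (auto intro!: subspace_diff)
        have "N (r *\<^sub>R (x - w)) = \<bar>r\<bar> * N (x - w)" using s_BanachD(6)[OF Y wY] .
        also have "\<dots> \<le> \<bar>r\<bar> * (e / (\<bar>r\<bar> + 1))" using w by (intro mult_left_mono) auto
        also have "\<dots> < e" using e by (simp add: field_simps)
        finally show ?thesis
          using w by (intro bexI[of _ "r *\<^sub>R w"]) (auto simp: scaleR_diff_right span_scale)
      qed
      then show "r *\<^sub>R x \<in> qclosure Y N S"
        using xY sub by (auto simp: qclosure_def subspace_scale)
    qed
  next
    fix \<sigma> x assume \<sigma>: "range \<sigma> \<subseteq> qclosure Y N S" "x \<in> Y" "(\<lambda>n. N (\<sigma> n - x)) \<longlonglongrightarrow> 0"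
    have "\<exists>w\<in>span S. N (x - w) < e" if e: "e > 0" for e
    proof -
      have e2: "e / (2 * C) > 0" using e C by simp
      from order_tendstoD(2)[OF \<sigma>(3) this] obtain n where n: "N (\<sigma> n - x) < e / (2 * C)"
        by (auto simp: eventually_sequentially)
      have nY: "\<sigma> n \<in> qclosure Y N S" "\<sigma> n \<in> Y" using \<sigma>(1) by (auto simp: qclosure_def)
      then obtain w where w: "w \<in> span S" "N (\<sigma> n - w) < e / (2*C)"
        using e2 unfolding qclosure_def by blast
      have "N ((x - \<sigma> n) + (\<sigma> n - w)) \<le> C * (N (x - \<sigma> n) + N (\<sigma> n - w))"
        using w nY \<sigma>(2) spY sub by (intro C) (auto intro!: subspace_diff)
      also have "\<dots> < C * (e / (2*C) + e / (2*C))"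
        using w n C(1) norm_minus_commute_on[OF Y \<sigma>(2) nY(2)]
        by (intro mult_strict_left_mono add_strict_mono) auto
      also have "\<dots> = e" using C(1) by (simp add: field_simps)
      finally show ?thesis using w by (intro bexI[of _ w]) auto
    qed
    then show "x \<in> qclosure Y N S" using \<sigma>(2) by (auto simp: qclosure_def)
  qed
qed

lemma qclosure_code:
  fixes f :: "'m \<Rightarrow> 'y::real_vector"
  assumes Y: "s_Banach s Y N" and fM: "f ` M \<subseteq> Y"
  obtains c :: "'y \<Rightarrow> nat \<Rightarrow> 'm \<Rightarrow> real" where "inj_on c (qclosure Y N (f ` M))"
proof -
  note sub = s_BanachD(3)[OF Y]
  have spY: "span (f ` M) \<subseteq> Y" using fM sub by (simp add: span_minimal)
  obtain C where C: "C \<ge> 1" "\<And>x y. x \<in> Y \<Longrightarrow> y \<in> Y \<Longrightarrow> N (x + y) \<le> C * (N x + N y)"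
    using quasi_triangle[OF Y] by blast
  let ?l = "\<lambda>a. \<Sum>x\<in>{x. a x \<noteq> 0}. a x *\<^sub>R f x"
  have "\<exists>a. ?l a \<in> Y \<and> N (y - ?l a) < 1 / real (Suc n)" if y: "y \<in> qclosure Y N (f ` M)" for y n
  proof -
    have "1 / real (Suc n) > 0" by simp
    then obtain w where w: "w \<in> span (f ` M)" "N (y - w) < 1 / real (Suc n)"
      using y unfolding qclosure_def by blast
    with span_image_lincomb[OF w(1)] spY show ?thesis by (metis subsetD)
  qed
  note ex = this
  define c where "c = (\<lambda>y n. SOME a. ?l a \<in> Y \<and> N (y - ?l a) < 1 / real (Suc n))"
  have c: "?l (c y n) \<in> Y" "N (y - ?l (c y n)) < 1 / real (Suc n)"
    if y: "y \<in> qclosure Y N (f ` M)" for y n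
    using someI_ex[OF ex[OF y, of n]] unfolding c_def by blast+
  have "inj_on c (qclosure Y N (f ` M))"
  proof (rule inj_onI)
    fix x y assume xy: "x \<in> qclosure Y N (f ` M)" "y \<in> qclosure Y N (f ` M)" "c x = c y"
    have xyY: "x \<in> Y" "y \<in> Y" using xy by (auto simp: qclosure_def)
    have dY: "x - y \<in> Y" using xyY sub by (auto intro: subspace_diff)
    have bd: "N (x - y) \<le> 2 * C * inverse (real (Suc n))" for n
    proof -
      let ?w = "?l (c y n)"
      have w: "?w \<in> Y" "N (x - ?w) < 1 / real (Suc n)" "N (y - ?w) < 1 / real (Suc n)"
        using c[OF xy(2), of n] c(2)[OF xy(1), of n] xy(3) by auto
      have "N ((x - ?w) + (?w - y)) \<le> C * (N (x - ?w) + N (?w - y))"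
        using w xyY sub by (intro C) (auto intro!: subspace_diff)
      also have "\<dots> \<le> C * (1 / real (Suc n) + 1 / real (Suc n))"
        using w C(1) norm_minus_commute_on[OF Y xyY(2) w(1)]
        by (intro mult_left_mono add_mono) auto
      finally show ?thesis by (simp add: field_simps)
    qed
    have "(\<lambda>n. 2 * C * inverse (real (Suc n))) \<longlonglongrightarrow> 2 * C * 0"
      by (intro tendsto_mult_left LIMSEQ_inverse_real_of_nat)
    then have "N (x - y) \<le> 2 * C * 0" by (rule LIMSEQ_le_const) (use bd in auto)
    then have "N (x - y) = 0" using s_BanachD(4)[OF Y dY] by simp
    then show "x = y" using s_BanachD(5)[OF Y dY] by simp
  qed
  then show thesis by (rule that)
qed

lemma transport_s_Banach:
  assumes V: "s_Banach s V N" and J: "linear J" "inj_on J V"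
  shows "s_Banach s (J ` V) (\<lambda>u. N (the_inv_into V J u))"
proof -
  note sub = s_BanachD(3)[OF V]
  have inv: "the_inv_into V J (J x) = x" if "x \<in> V" for x using that J(2) by (simp add: the_inv_into_f_f)
  have add: "the_inv_into V J (J x + J y) = x + y" if "x \<in> V" "y \<in> V" for x y
    using inv[of "x + y"] that sub J(1) by (simp add: subspace_add linear_add)
  have diff: "the_inv_into V J (J x - J y) = x - y" if "x \<in> V" "y \<in> V" for x y
    using inv[of "x - y"] that sub J(1) by (simp add: subspace_diff linear_diff)
  have scl: "the_inv_into V J (r *\<^sub>R J x) = r *\<^sub>R x" if "x \<in> V" for x r
    using inv[of "r *\<^sub>R x"] that sub J(1) by (simp add: subspace_scale linear_scale)
  have J0: "J x = 0 \<longleftrightarrow> x = 0" if "x \<in> V" for x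
    using that J sub by (metis inj_onD linear_0 subspace_0)
  obtain C where C: "C \<ge> 1" "\<And>x y. x \<in> V \<Longrightarrow> y \<in> V \<Longrightarrow> N (x + y) \<le> C * (N x + N y)"
    using quasi_triangle[OF V] by blast
  have "complete_on (J ` V) (\<lambda>u. N (the_inv_into V J u))"
    unfolding complete_on_def
  proof (intro allI impI)
    fix \<sigma> :: "nat \<Rightarrow> 'b" assume a: "range \<sigma> \<subseteq> J ` V"
      "\<forall>e>0. \<exists>n0. \<forall>m\<ge>n0. \<forall>n\<ge>n0. N (the_inv_into V J (\<sigma> m - \<sigma> n)) < e"
    from a(1) have "\<forall>n. \<exists>v\<in>V. \<sigma> n = J v" by blast
    then obtain \<tau> where \<tau>: "\<And>n. \<tau> n \<in> V" "\<And>n. \<sigma> n = J (\<tau> n)" by metis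
    have "\<forall>e>0. \<exists>n0. \<forall>m\<ge>n0. \<forall>n\<ge>n0. N (\<tau> m - \<tau> n) < e"
      using a(2) by (simp add: \<tau> diff)
    from complete_onD[OF V \<tau>(1) this]
    obtain x where "x \<in> V" "(\<lambda>n. N (\<tau> n - x)) \<longlonglongrightarrow> 0" .
    then show "\<exists>x\<in>J ` V. (\<lambda>n. N (the_inv_into V J (\<sigma> n - x))) \<longlonglongrightarrow> 0"
      by (intro bexI[of _ "J x"]) (auto simp: \<tau> diff)
  qed
  moreover have "quasi_norm_on (J ` V) (\<lambda>u. N (the_inv_into V J u))"
    unfolding quasi_norm_on_def
  proof (intro conjI)
    show "subspace (J ` V)" using J(1) sub by (rule linear_subspace_image)
    show "\<exists>C\<ge>1. \<forall>x\<in>J ` V. \<forall>y\<in>J ` V. N (the_inv_into V J (x + y))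
       \<le> C * (N (the_inv_into V J x) + N (the_inv_into V J y))"
      using C by (auto simp: inv add)
  qed (use V in \<open>auto simp: inv scl J0 s_BanachD\<close>)
  ultimately show ?thesis
    using V unfolding s_Banach_def[of s "J ` V"] by (auto simp: inv add s_BanachD)
qed

lemma bounded_linear_between_agree:
  assumes Y: "s_Banach s Y NY" and F: "s_Banach s' F NF"
    and T: "bounded_linear_between F NF Y NY T" "bounded_linear_between F NF Y NY T'"
    and S: "S \<subseteq> F" "\<And>v. v \<in> S \<Longrightarrow> T v = T' v"
    and v: "v \<in> qclosure F NF S"
  shows "T v = T' v"
proof -
  note subF = s_BanachD(3)[OF F] and subY = s_BanachD(3)[OF Y]
  have spF: "span S \<subseteq> F" using S subF by (simp add: span_minimal)
  have vF: "v \<in> F" using v by (auto simp: qclosure_def)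
  obtain B where B: "\<And>x. x \<in> F \<Longrightarrow> NY (T x) \<le> B * NF x" using T(1) unfolding bounded_linear_between_def by blast
  obtain B' where B': "\<And>x. x \<in> F \<Longrightarrow> NY (T' x) \<le> B' * NF x" using T(2) unfolding bounded_linear_between_def by blast
  obtain C where C: "C \<ge> 1" "\<And>x y. x \<in> Y \<Longrightarrow> y \<in> Y \<Longrightarrow> NY (x + y) \<le> C * (NY x + NY y)"
    using quasi_triangle[OF Y] by blast
  have TY: "T x \<in> Y" "T' x \<in> Y" if "x \<in> F" for x using T that unfolding bounded_linear_between_def by auto
  have add: "T (x + y) = T x + T y" "T' (x + y) = T' x + T' y" if "x \<in> F" "y \<in> F" for x y
    using T that unfolding bounded_linear_between_def by auto
  have scl: "T (r *\<^sub>R x) = r *\<^sub>R T x" "T' (r *\<^sub>R x) = r *\<^sub>R T' x" if "x \<in> F" for x r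
    using T that unfolding bounded_linear_between_def by auto
  have z: "T 0 = 0" "T' 0 = 0" using scl[of 0 0] subF by (auto simp: subspace_0)
  have diff: "T (x - y) = T x - T y" "T' (x - y) = T' x - T' y" if "x \<in> F" "y \<in> F" for x y
    using add[of x "(-1) *\<^sub>R y"] scl[of y "-1"] that subspace_scale[OF subF, of y "-1"] by auto
  have sp: "w \<in> F \<and> T w = T' w" if "w \<in> span S" for w
    using that
  proof (induction rule: span_induct)
    show "subspace {w. w \<in> F \<and> T w = T' w}"
      using subF by (auto simp: subspace_def add scl z)
  qed (use S in auto)
  have dY: "T v - T' v \<in> Y" using TY vF subY by (simp add: subspace_diff)
  define K where "K = C * (\<bar>B\<bar> + \<bar>B'\<bar>) + 1"
  have K: "K > 0" unfolding K_def using C(1) by (simp add: add_nonneg_pos)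
  have "NY (T v - T' v) \<le> e" if e: "e > 0" for e
  proof -
    have "e / K > 0" using e K by simp
    then obtain w where w: "w \<in> span S" "NF (v - w) < e / K"
      using v unfolding qclosure_def by blast
    have wF: "w \<in> F" "T w = T' w" using sp[OF w(1)] by auto
    have dF: "v - w \<in> F" "w - v \<in> F" using vF wF subF by (auto intro: subspace_diff)
    have n: "NF (v - w) \<ge> 0" "NF (w - v) = NF (v - w)"
      using s_BanachD(4)[OF F dF(1)] norm_minus_commute_on[OF F vF wF(1)] by auto
    have "T v - T' v = T (v - w) + T' (w - v)" using vF wF by (simp add: diff)
    then have "NY (T v - T' v) \<le> C * (NY (T (v - w)) + NY (T' (w - v)))"
      using C(2) TY dF by metis
    also have "\<dots> \<le> C * (\<bar>B\<bar> * NF (v - w) + \<bar>B'\<bar> * NF (v - w))"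
    proof (intro mult_left_mono add_mono)
      show "NY (T (v - w)) \<le> \<bar>B\<bar> * NF (v - w)"
        using B[OF dF(1)] mult_right_mono[OF abs_ge_self[of B] n(1)] by linarith
      show "NY (T' (w - v)) \<le> \<bar>B'\<bar> * NF (v - w)"
        using B'[OF dF(2)] mult_right_mono[OF abs_ge_self[of B'] n(1)] n(2) by simp
    qed (use C in auto)
    also have "\<dots> \<le> K * NF (v - w)" using n(1) by (simp add: K_def algebra_simps)
    also have "\<dots> \<le> e" using w(2) K by (simp add: field_simps)
    finally show ?thesis .
  qed
  then have "NY (T v - T' v) \<le> 0" by (rule field_le_epsilon[of _ 0, simplified])
  then have "NY (T v - T' v) = 0" using s_BanachD(4)[OF Y dY] by simp
  then show ?thesis using s_BanachD(5)[OF Y dY] by simp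
qed

lemma lipschitz_free_universal:
  fixes Y :: "'y::real_vector set"
  assumes free: "lipschitz_free p M d z F NF \<delta>" and Y: "s_Banach p Y NY"
  shows "universal_towards M d z F NF \<delta> Y NY"
  unfolding universal_towards_def
proof (intro allI impI)
  fix f assume f: "f ` M \<subseteq> Y" "f z = 0" "\<exists>L. lipschitz_with L M d (qdist NY) f"
  have F: "s_Banach p F NF" and \<delta>F: "\<delta> ` M \<subseteq> F" using free by (auto simp: lipschitz_free_def)
  have dense: "v \<in> qclosure F NF (\<delta> ` M)" if "v \<in> F" for v
    using free that unfolding lipschitz_free_def qclosure_def by blast
  define Y0 where "Y0 = qclosure Y NY (f ` M)"
  have Y0: "s_Banach p Y0 NY" unfolding Y0_def using Y f(1) by (rule qclosure_s_Banach)
  note subY0 = s_BanachD(3)[OF Y0]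
  have Y0Y: "Y0 \<subseteq> Y" unfolding Y0_def qclosure_def by auto
  have fY0: "f ` M \<subseteq> Y0"
  proof -
    have "NY (f x - f x) = 0" for x
      using s_BanachD(5)[OF Y] s_BanachD(3)[OF Y] by (simp add: subspace_0)
    then show ?thesis unfolding Y0_def qclosure_def using f(1)
      by (auto intro!: bexI[of _ "f _"] span_base simp: image_subset_iff)
  qed
  obtain c :: "'y \<Rightarrow> nat \<Rightarrow> 'a \<Rightarrow> real" where "inj_on c Y0"
    unfolding Y0_def using qclosure_code[OF Y f(1)] .
  from embed_by_injection[OF subY0 this]
  obtain J :: "'y \<Rightarrow> 'a test_space" where J: "linear J" "inj_on J Y0" .
  define N' where "N' = (\<lambda>u. NY (the_inv_into Y0 J u))"
  have inv: "the_inv_into Y0 J (J x) = x" if "x \<in> Y0" for x using that J(2) by (simp add: the_inv_into_f_f)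
  have N'J: "N' (J x) = NY x" if "x \<in> Y0" for x unfolding N'_def by (simp add: inv that)
  have "s_Banach p (J ` Y0) N'" unfolding N'_def using Y0 J by (rule transport_s_Banach)
  then have univ: "universal_towards M d z F NF \<delta> (J ` Y0) N'"
    using free unfolding lipschitz_free_def by blast
  define g where "g = J \<circ> f"
  have dist: "qdist N' (g x) (g y) = qdist NY (f x) (f y)" if "x \<in> M" "y \<in> M" for x y
  proof -
    have "f x - f y \<in> Y0" using fY0 that subY0 by (auto intro: subspace_diff)
    from N'J[OF this] show ?thesis by (simp add: qdist_def g_def linear_diff[OF J(1)])
  qed
  have lip: "lipschitz_with L M d (qdist N') g = lipschitz_with L M d (qdist NY) f" for L
    unfolding lipschitz_with_def using dist by auto
  have g: "g ` M \<subseteq> J ` Y0" "g z = 0" "\<exists>L. lipschitz_with L M d (qdist N') g"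
    using fY0 f(2,3) J(1) by (auto simp: g_def linear_0 lip[unfolded g_def])
  have ex: "\<exists>!T. linearizes M F NF \<delta> (J ` Y0) N' g T"
    and on: "operator_norm F NF N' (THE T. linearizes M F NF \<delta> (J ` Y0) N' g T) = Lip M d (qdist N') g"
    using univ g unfolding universal_towards_def by blast+
  define T where "T = (THE T. linearizes M F NF \<delta> (J ` Y0) N' g T)"
  have T: "linearizes M F NF \<delta> (J ` Y0) N' g T" unfolding T_def by (rule theI'[OF ex])
  have TJ: "T v \<in> J ` Y0" if "v \<in> F" for v
    using T that unfolding linearizes_def bounded_linear_between_def by auto
  define U where "U = restrict (\<lambda>v. the_inv_into Y0 J (T v)) F"
  have U: "U v \<in> Y0" "J (U v) = T v" if "v \<in> F" for v
    using TJ[OF that] that by (auto simp: U_def inv)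
  have UN: "NY (U v) = N' (T v)" if "v \<in> F" for v
    using N'J[OF U(1)[OF that]] U(2)[OF that] by simp
  note subF = s_BanachD(3)[OF F]
  have U_lin: "linearizes M F NF \<delta> Y NY f U"
    unfolding linearizes_def bounded_linear_between_def
  proof (intro conjI ballI allI)
    show "U \<in> extensional F" by (simp add: U_def)
    show "U ` F \<subseteq> Y" using U(1) Y0Y by auto
    fix x y assume xy: "x \<in> F" "y \<in> F"
    then have "J (U (x + y)) = J (U x + U y)"
      using T subF unfolding linearizes_def bounded_linear_between_def
      by (simp add: U(2) linear_add[OF J(1)] subspace_add)
    then show "U (x + y) = U x + U y"
      using xy U(1) subY0 subF J(2) by (auto dest!: inj_onD simp: subspace_add)
  next
    fix x and a :: real assume x: "x \<in> F"
    then have "J (U (a *\<^sub>R x)) = J (a *\<^sub>R U x)"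
      using T subF unfolding linearizes_def bounded_linear_between_def
      by (simp add: U(2) linear_scale[OF J(1)] subspace_scale)
    then show "U (a *\<^sub>R x) = a *\<^sub>R U x"
      using x U(1) subY0 subF J(2) by (auto dest!: inj_onD simp: subspace_scale)
  next
    show "\<exists>C. \<forall>x\<in>F. NY (U x) \<le> C * NF x"
      using T UN unfolding linearizes_def bounded_linear_between_def by simp
  next
    fix x assume x: "x \<in> M"
    then have "\<delta> x \<in> F" "f x \<in> Y0" using \<delta>F fY0 by auto
    then show "U (\<delta> x) = f x"
      using T x unfolding linearizes_def by (simp add: U_def g_def inv)
  qed
  have uniq: "V = U" if V: "linearizes M F NF \<delta> Y NY f V" for V
  proof (rule extensionalityI)
    show "V \<in> extensional F" "U \<in> extensional F" using V U_lin by (auto simp: linearizes_def)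
    fix v assume v: "v \<in> F"
    show "V v = U v"
    proof (rule bounded_linear_between_agree[OF Y F _ _ \<delta>F _ dense[OF v]])
      show "bounded_linear_between F NF Y NY V" "bounded_linear_between F NF Y NY U"
        using V U_lin by (auto simp: linearizes_def)
    qed (use V U_lin in \<open>auto simp: linearizes_def\<close>)
  qed
  have ex1: "\<exists>!T. linearizes M F NF \<delta> Y NY f T" using U_lin uniq by blast
  have "(THE T. linearizes M F NF \<delta> Y NY f T) = U" using U_lin uniq by blast
  moreover have "operator_norm F NF NY U = operator_norm F NF N' T"
    unfolding operator_norm_def using UN by (intro SUP_cong) auto
  moreover have "Lip M d (qdist N') g = Lip M d (qdist NY) f" unfolding Lip_def lip ..
  ultimately show "(\<exists>!T. linearizes M F NF \<delta> Y NY f T) \<and>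
       operator_norm F NF NY (THE T. linearizes M F NF \<delta> Y NY f T) = Lip M d (qdist NY) f"
    using ex1 on unfolding T_def by simp
qed

lemma s_Banach_mono:
  assumes X: "s_Banach q X N" and p: "0 < p" "p \<le> q"
  shows "s_Banach p X N"
proof -
  have "N (x + y) powr p \<le> N x powr p + N y powr p" if xy: "x \<in> X" "y \<in> X" for x y
  proof -
    have n: "N x \<ge> 0" "N y \<ge> 0" "N (x+y) \<ge> 0"
      using s_BanachD(4)[OF X] xy s_BanachD(3)[OF X] by (auto simp: subspace_add)
    have sub: "(a + b) powr t \<le> a powr t + b powr t" if ab: "0 \<le> a" "0 \<le> b" and t: "0 < t" "t \<le> 1" for a b t :: real
    proof (cases "a + b = 0")
      case False
      then have s: "a + b > 0" using ab by simp
      have u: "u \<le> u powr t" if "0 \<le> u" "u \<le> 1" for u :: real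
        using powr_mono'[of t 1 u] that t by simp
      have "a / (a + b) + b / (a + b) = 1" using s by (simp add: add_divide_distrib[symmetric])
      moreover have "a / (a + b) \<le> (a / (a + b)) powr t" "b / (a + b) \<le> (b / (a + b)) powr t"
        using ab s by (auto intro!: u)
      ultimately have "1 \<le> (a / (a + b)) powr t + (b / (a + b)) powr t" by linarith
      also have "\<dots> = (a powr t + b powr t) / (a + b) powr t"
        using ab s by (simp add: powr_divide add_divide_distrib)
      finally show ?thesis using s by (simp add: field_simps)
    qed (use ab in simp)
    have pq: "0 < p / q" "p / q \<le> 1" "q * (p / q) = p" using p by auto
    have "N (x + y) powr p = (N (x + y) powr q) powr (p / q)" using pq by (simp add: powr_powr)
    also have "\<dots> \<le> (N x powr q + N y powr q) powr (p / q)"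
      using s_BanachD(7)[OF X xy] pq by (intro powr_mono2) auto
    also have "\<dots> \<le> (N x powr q) powr (p / q) + (N y powr q) powr (p / q)"
      using pq by (intro sub) auto
    also have "\<dots> = N x powr p + N y powr p" using pq by (simp add: powr_powr)
    finally show ?thesis .
  qed
  then show ?thesis using X p unfolding s_Banach_def by auto
qed

lemma barycenter_linearizes:
  assumes X: "s_Banach q X N" and p: "0 < p" "p \<le> q"
    and free: "lipschitz_free p X (qdist N) 0 F NF \<delta>"
  shows "linearizes X F NF \<delta> X N (\<lambda>x. x) (barycenter X N F NF \<delta>)"
proof -
  have "universal_towards X (qdist N) 0 F NF \<delta> X N"
    using free s_Banach_mono[OF X p] by (rule lipschitz_free_universal)
  moreover have "lipschitz_with 1 X (qdist N) (qdist N) (\<lambda>x. x)" by (simp add: lipschitz_with_def)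
  ultimately have "\<exists>!T. linearizes X F NF \<delta> X N (\<lambda>x. x) T"
    unfolding universal_towards_def by (metis image_ident order_refl)
  then show ?thesis unfolding barycenter_def by (rule theI')
qed

lemma barycenter_kernel_s_Banach:
  assumes X: "s_Banach q X N" and p: "0 < p" "p \<le> q"
    and free: "lipschitz_free p X (qdist N) 0 F NF \<delta>"
  shows "s_Banach p (barycenter_kernel X N F NF \<delta>) NF"
proof -
  have F: "s_Banach p F NF" using free by (simp add: lipschitz_free_def)
  note subF = s_BanachD(3)[OF F] and subX = s_BanachD(3)[OF X]
  define b where "b = barycenter X N F NF \<delta>"
  have b: "bounded_linear_between F NF X N b"
    using barycenter_linearizes[OF X p free] by (simp add: b_def linearizes_def)
  have K: "barycenter_kernel X N F NF \<delta> = {v \<in> F. b v = 0}"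
    by (simp add: barycenter_kernel_def b_def)
  have bX: "b v \<in> X" if "v \<in> F" for v using b that unfolding bounded_linear_between_def by auto
  have add: "b (v + w) = b v + b w" if "v \<in> F" "w \<in> F" for v w
    using b that unfolding bounded_linear_between_def by auto
  have scl: "b (r *\<^sub>R v) = r *\<^sub>R b v" if "v \<in> F" for r v
    using b that unfolding bounded_linear_between_def by auto
  have b0: "b 0 = 0" using scl[of 0 0] subF by (simp add: subspace_0)
  obtain C where C: "\<And>v. v \<in> F \<Longrightarrow> N (b v) \<le> C * NF v" using b unfolding bounded_linear_between_def by blast
  show ?thesis unfolding K
  proof (rule s_Banach_closed_subspace[OF F])
    show "subspace {v \<in> F. b v = 0}"
      using subF by (auto simp: subspace_def b0 add scl)
    fix \<sigma> x assume \<sigma>: "range \<sigma> \<subseteq> {v \<in> F. b v = 0}" "x \<in> F" "(\<lambda>n. NF (\<sigma> n - x)) \<longlonglongrightarrow> 0"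
    have "N (b x) \<le> C * NF (\<sigma> n - x)" for n
    proof -
      have n: "\<sigma> n \<in> F" "b (\<sigma> n) = 0" using \<sigma>(1) by auto
      have d: "x - \<sigma> n \<in> F" using n \<sigma>(2) subF by (simp add: subspace_diff)
      have "b x = b (x - \<sigma> n)" using add[OF d n(1)] n(2) by simp
      then show ?thesis using C[OF d] norm_minus_commute_on[OF F \<sigma>(2) n(1)] by simp
    qed
    moreover have "(\<lambda>n. C * NF (\<sigma> n - x)) \<longlonglongrightarrow> C * 0" by (intro tendsto_mult_left \<sigma>)
    ultimately have "N (b x) \<le> C * 0" by (intro LIMSEQ_le_const) auto
    then have "N (b x) = 0" using s_BanachD(4)[OF X bX[OF \<sigma>(2)]] by simp
    then show "x \<in> {v \<in> F. b v = 0}" using s_BanachD(5)[OF X bX[OF \<sigma>(2)]] \<sigma>(2) by simp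
  qed auto
qed

lemma sum_norm_s_Banach:
  assumes V: "s_Banach p V NV" and W: "s_Banach p W NW"
  shows "s_Banach p (V \<times> W) (sum_norm p NV NW)"
proof -
  note subV = s_BanachD(3)[OF V] and subW = s_BanachD(3)[OF W]
  have p: "0 < p" "p \<le> 1" using V by (auto simp: s_Banach_def)
  let ?N = "sum_norm p NV NW"
  have pw: "?N u powr p = NV (fst u) powr p + NW (snd u) powr p" for u
    using p by (simp add: sum_norm_def powr_powr split: prod.split)
  have N0: "0 \<le> ?N u" for u by (simp add: sum_norm_def split: prod.split)
  have sub: "subspace (V \<times> W)" using subV subW by (rule subspace_Times)
  have tri: "?N (u + v) powr p \<le> ?N u powr p + ?N v powr p" if "u \<in> V \<times> W" "v \<in> V \<times> W" for u v
  proof -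
    have "fst u \<in> V" "fst v \<in> V" "snd u \<in> W" "snd v \<in> W" using that by auto
    from s_BanachD(7)[OF V this(1,2)] s_BanachD(7)[OF W this(3,4)] show ?thesis by (simp add: pw)
  qed
  have quasi: "?N (u + v) \<le> 2 powr (1/p) * (?N u + ?N v)" if "u \<in> V \<times> W" "v \<in> V \<times> W" for u v
  proof -
    have "?N u powr p + ?N v powr p \<le> (?N u + ?N v) powr p + (?N u + ?N v) powr p"
      using p N0[of u] N0[of v] by (intro add_mono powr_mono2) auto
    with tri[OF that] have "?N (u + v) powr p \<le> 2 * (?N u + ?N v) powr p" by simp
    then have "(?N (u + v) powr p) powr (1/p) \<le> (2 * (?N u + ?N v) powr p) powr (1/p)"
      using p by (intro powr_mono2) auto
    then show ?thesis using p N0[of u] N0[of v] N0[of "u + v"] by (simp add: powr_powr powr_mult)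
  qed
  have "quasi_norm_on (V \<times> W) ?N" unfolding quasi_norm_on_def
  proof (intro conjI ballI allI)
    show "\<exists>C\<ge>1. \<forall>x\<in>V \<times> W. \<forall>y\<in>V \<times> W. ?N (x + y) \<le> C * (?N x + ?N y)"
      using quasi p by (intro exI[of _ "2 powr (1/p)"]) (auto simp: ge_one_powr_ge_zero)
    fix u assume u: "u \<in> V \<times> W"
    obtain x y where xy: "u = (x, y)" "x \<in> V" "y \<in> W" using u by auto
    have n: "0 \<le> NV x" "0 \<le> NW y" using xy s_BanachD(4)[OF V] s_BanachD(4)[OF W] by auto
    show "(?N u = 0) = (u = 0)"
      using n s_BanachD(5)[OF V xy(2)] s_BanachD(5)[OF W xy(3)]
      by (simp add: sum_norm_def xy(1) add_nonneg_eq_0_iff zero_prod_def)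
    fix a :: real
    have "?N (a *\<^sub>R u) = (\<bar>a\<bar> powr p * (NV x powr p + NW y powr p)) powr (1/p)"
      using n s_BanachD(6)[OF V xy(2)] s_BanachD(6)[OF W xy(3)]
      by (simp add: sum_norm_def xy(1) powr_mult distrib_left)
    also have "\<dots> = \<bar>a\<bar> * ?N u" using p by (simp add: sum_norm_def xy(1) powr_mult powr_powr)
    finally show "?N (a *\<^sub>R u) = \<bar>a\<bar> * ?N u" .
  qed (use sub N0 in auto)
  moreover have "complete_on (V \<times> W) ?N" unfolding complete_on_def
  proof (intro allI impI)
    fix \<sigma> :: "nat \<Rightarrow> 'a \<times> 'b" assume \<sigma>: "range \<sigma> \<subseteq> V \<times> W"
      "\<forall>e>0. \<exists>n0. \<forall>m\<ge>n0. \<forall>n\<ge>n0. ?N (\<sigma> m - \<sigma> n) < e"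
    have in1: "fst (\<sigma> n) \<in> V" and in2: "snd (\<sigma> n) \<in> W" for n using \<sigma>(1) by (auto simp: mem_Times_iff image_subset_iff)
    have le1: "NV (fst (\<sigma> m - \<sigma> n)) \<le> ?N (\<sigma> m - \<sigma> n)"
     and le2: "NW (snd (\<sigma> m - \<sigma> n)) \<le> ?N (\<sigma> m - \<sigma> n)" for m n
    proof -
      let ?u = "\<sigma> m - \<sigma> n"
      have n: "0 \<le> NV (fst ?u)" "0 \<le> NW (snd ?u)"
        using in1 in2 subV subW s_BanachD(4)[OF V] s_BanachD(4)[OF W] by (auto simp: subspace_diff)
      have "(NV (fst ?u) powr p) powr (1/p) \<le> (?N ?u powr p) powr (1/p)"
        "(NW (snd ?u) powr p) powr (1/p) \<le> (?N ?u powr p) powr (1/p)"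
        using p unfolding pw by (auto intro!: powr_mono2)
      then show "NV (fst ?u) \<le> ?N ?u" "NW (snd ?u) \<le> ?N ?u"
        using p n N0[of ?u] by (auto simp: powr_powr)
    qed
    have "\<forall>e>0. \<exists>n0. \<forall>m\<ge>n0. \<forall>n\<ge>n0. NV (fst (\<sigma> m) - fst (\<sigma> n)) < e"
      using \<sigma>(2) le1 unfolding fst_diff by (meson le_less_trans)
    from complete_onD[OF V in1 this]
    obtain x where x: "x \<in> V" "(\<lambda>n. NV (fst (\<sigma> n) - x)) \<longlonglongrightarrow> 0" .
    have "\<forall>e>0. \<exists>n0. \<forall>m\<ge>n0. \<forall>n\<ge>n0. NW (snd (\<sigma> m) - snd (\<sigma> n)) < e"
      using \<sigma>(2) le2 unfolding snd_diff by (meson le_less_trans)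
    from complete_onD[OF W in2 this]
    obtain y where y: "y \<in> W" "(\<lambda>n. NW (snd (\<sigma> n) - y)) \<longlonglongrightarrow> 0" .
    have n: "0 \<le> NV (fst (\<sigma> n) - x)" "0 \<le> NW (snd (\<sigma> n) - y)" for n
      using in1 in2 x y subV subW s_BanachD(4)[OF V] s_BanachD(4)[OF W] by (auto simp: subspace_diff)
    have "(\<lambda>n. NV (fst (\<sigma> n) - x) powr p + NW (snd (\<sigma> n) - y) powr p) \<longlonglongrightarrow> 0 + 0"
      using p n x y by (intro tendsto_add tendsto_zero_powrI[where b=p]) auto
    then have "(\<lambda>n. (NV (fst (\<sigma> n) - x) powr p + NW (snd (\<sigma> n) - y) powr p) powr (1/p)) \<longlonglongrightarrow> 0"
      using p by (intro tendsto_zero_powrI[where b="1/p"]) auto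
    then have "(\<lambda>n. ?N (\<sigma> n - (x, y))) \<longlonglongrightarrow> 0"
      by (simp add: sum_norm_def case_prod_beta)
    then show "\<exists>u\<in>V \<times> W. (\<lambda>n. ?N (\<sigma> n - u)) \<longlonglongrightarrow> 0" using x y by blast
  qed
  ultimately show ?thesis using p tri unfolding s_Banach_def by auto
qed

end

theory Submission
  imports Defs "HOL-Library.Function_Algebras"
begin

text \<open>
  The map \<open>v \<mapsto> (\<beta> v, v - \<delta> (\<beta> v))\<close> is a bi-Lipschitz bijection with inverse \<open>(x, z) \<mapsto> z + \<delta> x\<close>.  A linear
  isomorphism would give bounded linear maps \<open>i : X \<rightarrow> F\<close> and \<open>P : F \<rightarrow> X\<close> with \<open>P i = id\<close>, and \<open>P\<close> extends the
  Lipschitz map \<open>f = P \<delta>\<close> of \<open>X\<close> into itself.  Take a bounded sequence \<open>x n\<close> that keeps away from every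
  finite-dimensional subspace, and fix an exponent \<open>s\<close> strictly between \<open>p\<close> and \<open>q\<close>.  Each \<open>i (x n)\<close> is a
  combination of molecules; the small coefficients are negligible in the exponent \<open>s > p\<close>, which leaves
  boundedly many molecules.  Since the \<open>q\<close>-th power of the norm is a metric and \<open>s < q\<close>, cutting \<open>f\<close> off where
  the distance to a finite set passes a random threshold is a Lipschitz operation with values in an \<open>L\<^sub>s\<close>-space.
  Along a subsequence, each of the remaining points either converges or stays separated from everything
  else, and in both cases such cuts yield arbitrarily many pieces of \<open>f\<close> with disjoint supports, each of them
  large on one \<open>i (x n)\<close>.  Hence some signed sum of \<open>N\<close> of the vectors \<open>i (x n)\<close> has norm at least of order
  \<open>N powr (1 / s)\<close>, whereas the \<open>q\<close>-triangle inequality in \<open>X\<close> allows only \<open>N powr (1 / q)\<close>.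
\<close>

section \<open>Gauges and their completion\<close>

text \<open>Cutting off \<open>f\<close> near a finite set \<open>A\<close> costs little only where
  \<open>f\<close> is bounded by the distance to \<open>A\<close>, and \<open>f\<close> need not
  vanish on \<open>A\<close>. So images are measured modulo the span of the image of
  \<open>A\<close>: there the gauge of \<open>f x\<close> is at most \<open>L\<close> times the
  distance to \<open>A\<close>, while the vectors \<open>x n\<close> keep their size because they
  stay away from finite-dimensional subspaces. The exponent s is written \<open>q * \<alpha>\<close>
  with p / q < \<alpha> < 1. The lower bound makes light molecules negligible and lets the universal
  property, which speaks of exponent \<open>p\<close>, control gauges of exponent
  \<open>q * \<alpha>\<close>. The upper bound is used three times: it makes the cost of a random
  cut independent of the scale, it prevents a large change from being spread over many tiny
  increments, and it makes N outgrow N powr \<alpha> at the end. The universal property enters only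
  in a dual form: a gauge of exponent \<open>p\<close> on formal sums that is dominated by the
  distance on differences of two points is dominated by the norm of \<open>F\<close>. The completion
  of such a gauge is the target space that proves this.\<close>

instantiation "fun" :: (type, real_vector) real_vector
begin

definition scaleR_fun :: "real \<Rightarrow> ('a \<Rightarrow> 'b) \<Rightarrow> 'a \<Rightarrow> 'b" where
  "scaleR_fun r c = (\<lambda>n. r *\<^sub>R c n)"

instance
  by standard (auto simp: scaleR_fun_def plus_fun_def fun_eq_iff algebra_simps)

end

text \<open>
  The \<open>q\<close>-th power of a quasi-seminorm, so that the \<open>q\<close>-triangle inequality becomes an ordinary one.
\<close>

locale gauge =
  fixes \<nu> :: "'v::real_vector \<Rightarrow> real" and q :: real
  assumes q_pos: "0 < q"
    and nonneg [simp]: "0 \<le> \<nu> x"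
    and triangle: "\<nu> (x + y) \<le> \<nu> x + \<nu> y"
    and scale: "\<nu> (c *\<^sub>R x) = \<bar>c\<bar> powr q * \<nu> x"
begin

lemma zero [simp]: "\<nu> 0 = 0"
  using scale[of 0 0] q_pos by simp

lemma minus [simp]: "\<nu> (- x) = \<nu> x"
  using scale[of "-1" x] by simp

lemma commute: "\<nu> (x - y) = \<nu> (y - x)"
  using minus[of "x - y"] by simp

lemma triangle_diff: "\<nu> (x - y) \<le> \<nu> x + \<nu> y"
  using triangle[of x "- y"] by simp

lemma triangle3: "\<nu> (x - z) \<le> \<nu> (x - y) + \<nu> (y - z)"
  using triangle[of "x - y" "y - z"] by simp

lemma triangle_rev: "\<nu> x - \<nu> y \<le> \<nu> (x - y)"
  using triangle[of "x - y" y] by simp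

lemma triangle_abs: "\<bar>\<nu> x - \<nu> y\<bar> \<le> \<nu> (x - y)"
  using triangle_rev[of x y] triangle_rev[of y x] commute[of x y] by linarith

lemma sum_le: "\<nu> (\<Sum>i\<in>I. x i) \<le> (\<Sum>i\<in>I. \<nu> (x i))"
proof (induction I rule: infinite_finite_induct)
  case (insert i I)
  then show ?case using triangle[of "x i" "\<Sum>i\<in>I. x i"] by simp
qed auto

end

text \<open>After scaling to sum 1 both summands lie in the unit interval, where a power with
  exponent at most 1 is at least the identity.\<close>

lemma powr_subadditive:
  fixes a b t :: real
  assumes "0 \<le> a" "0 \<le> b" "0 < t" "t \<le> 1"
  shows "(a + b) powr t \<le> a powr t + b powr t"
proof (cases "a + b = 0")
  case False
  then have s: "a + b > 0" using assms by simp
  have u: "u \<le> u powr t" if "0 \<le> u" "u \<le> 1" for u :: real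
    using powr_mono'[of t 1 u] that assms by simp
  have "a / (a + b) + b / (a + b) = 1" using s by (simp add: add_divide_distrib[symmetric])
  moreover have "a / (a + b) \<le> (a / (a + b)) powr t" "b / (a + b) \<le> (b / (a + b)) powr t"
    using assms s by (auto intro!: u)
  ultimately have "1 \<le> (a / (a + b)) powr t + (b / (a + b)) powr t" by linarith
  also have "\<dots> = (a powr t + b powr t) / (a + b) powr t"
    using assms s by (simp add: powr_divide add_divide_distrib)
  finally show ?thesis using s by (simp add: field_simps)
qed (use assms in simp)

text \<open>The reverse inequality is the given one for \<open>1 / c\<close>. Gauges defined as
  infima thus need only the easy direction.\<close>

lemma gaugeI_le:
  assumes "0 < q" "\<And>x. 0 \<le> \<nu> x" "\<And>x y. \<nu> (x + y) \<le> \<nu> x + \<nu> y"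
    and le: "\<And>c x. \<nu> (c *\<^sub>R x) \<le> \<bar>c\<bar> powr q * \<nu> x"
  shows "gauge \<nu> q"
proof
  fix x and c :: real
  show "\<nu> (c *\<^sub>R x) = \<bar>c\<bar> powr q * \<nu> x"
  proof (cases "c = 0")
    case True
    then show ?thesis using le[of 0 x] assms(1,2) by (simp add: order_antisym)
  next
    case False
    have "\<bar>c\<bar> powr q * \<nu> x = \<bar>c\<bar> powr q * \<nu> ((1/c) *\<^sub>R (c *\<^sub>R x))" using False by simp
    also have "\<dots> \<le> \<bar>c\<bar> powr q * (\<bar>1/c\<bar> powr q * \<nu> (c *\<^sub>R x))"
      by (intro mult_left_mono le) auto
    also have "\<dots> = \<nu> (c *\<^sub>R x)"
      using False by (simp add: powr_mult[symmetric] mult.assoc[symmetric] abs_mult[symmetric])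
    finally show ?thesis using le[of c x] by simp
  qed
qed fact+

lemma gauge_powr:
  assumes "gauge \<nu> q" "0 < t" "t \<le> 1"
  shows "gauge (\<lambda>x. \<nu> x powr t) (q * t)"
proof -
  interpret gauge \<nu> q by fact
  show ?thesis
  proof
    fix x y and c :: real
    have "\<nu> (x + y) powr t \<le> (\<nu> x + \<nu> y) powr t"
      using assms by (intro powr_mono2) (auto intro: triangle)
    also have "\<dots> \<le> \<nu> x powr t + \<nu> y powr t" using assms by (intro powr_subadditive) auto
    finally show "\<nu> (x + y) powr t \<le> \<nu> x powr t + \<nu> y powr t" .
    show "\<nu> (c *\<^sub>R x) powr t = \<bar>c\<bar> powr (q * t) * \<nu> x powr t"
      by (simp add: scale powr_mult powr_powr)
  qed (use assms q_pos in auto)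
qed

lemma gauge_sum:
  assumes "0 < q" "\<And>i. i \<in> I \<Longrightarrow> gauge (\<nu> i) q"
  shows "gauge (\<lambda>x. \<Sum>i\<in>I. \<nu> i x) q"
proof
  fix x y and c :: real
  show "(\<Sum>i\<in>I. \<nu> i (x + y)) \<le> (\<Sum>i\<in>I. \<nu> i x) + (\<Sum>i\<in>I. \<nu> i y)"
    unfolding sum.distrib[symmetric] using assms by (intro sum_mono gauge.triangle)
  show "(\<Sum>i\<in>I. \<nu> i (c *\<^sub>R x)) = \<bar>c\<bar> powr q * (\<Sum>i\<in>I. \<nu> i x)"
    unfolding sum_distrib_left using assms by (intro sum.cong refl gauge.scale)
  show "0 \<le> (\<Sum>i\<in>I. \<nu> i x)" using assms by (intro sum_nonneg gauge.nonneg) 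
qed fact

lemma quasi_norm_of_gauge_on:
  assumes sub: "subspace V" and p: "0 < p"
    and nn: "\<And>x. x \<in> V \<Longrightarrow> 0 \<le> R x"
    and tri: "\<And>x y. x \<in> V \<Longrightarrow> y \<in> V \<Longrightarrow> R (x + y) \<le> R x + R y"
    and scl: "\<And>x c. x \<in> V \<Longrightarrow> R (c *\<^sub>R x) = \<bar>c\<bar> powr p * R x"
    and z: "\<And>x. x \<in> V \<Longrightarrow> R x = 0 \<Longrightarrow> x = 0"
  shows "quasi_norm_on V (\<lambda>x. R x powr (1 / p))"
  unfolding quasi_norm_on_def
proof (intro conjI ballI allI)
  show "subspace V" by fact
  fix x assume x: "x \<in> V"
  show "0 \<le> R x powr (1/p)" by simp
  have "R 0 = 0" using scl[of 0 0] sub p by (simp add: subspace_0)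
  then show "(R x powr (1/p) = 0) = (x = 0)" using z[OF x] by auto
  show "R (a *\<^sub>R x) powr (1 / p) = \<bar>a\<bar> * R x powr (1 / p)" for a
    using p nn[OF x] by (simp add: scl[OF x] powr_mult powr_powr)
next
  show "\<exists>C\<ge>1. \<forall>x\<in>V. \<forall>y\<in>V. R (x + y) powr (1/p) \<le> C * (R x powr (1/p) + R y powr (1/p))"
  proof (intro exI[of _ "2 powr (1/p)"] conjI ballI)
    show "1 \<le> 2 powr (1 / p)" using p by (intro ge_one_powr_ge_zero) auto
    fix x y assume xy: "x \<in> V" "y \<in> V"
    have "R (x + y) powr (1/p) \<le> (2 * max (R x) (R y)) powr (1/p)"
      using tri[OF xy] nn[of "x + y"] xy sub p by (intro powr_mono2) (auto simp: subspace_add)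
    also have "\<dots> = 2 powr (1/p) * max (R x) (R y) powr (1/p)"
      using nn xy by (simp add: powr_mult)
    also have "\<dots> \<le> 2 powr (1/p) * (R x powr (1/p) + R y powr (1/p))"
      by (intro mult_left_mono) (auto simp: max_def)
    finally show "R (x + y) powr (1/p) \<le> 2 powr (1/p) * (R x powr (1/p) + R y powr (1/p))" .
  qed
qed

text \<open>
  The completion lives on Cauchy sequences; instead of a quotient by the null sequences, a linear
  complement of the null sequences is used.
\<close>

lemma (in gauge) completion:
  assumes "q \<le> 1"
  obtains C :: "(nat \<Rightarrow> 'v) set" and N' J where
    "s_Banach q C N'" "linear J" "range J \<subseteq> C" "\<And>a. N' (J a) = \<nu> a powr (1 / q)"
proof -
  define Cau where "Cau = {c :: nat \<Rightarrow> 'v. \<forall>e>0. \<exists>n0. \<forall>m\<ge>n0. \<forall>n\<ge>n0. \<nu> (c m - c n) < e}"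
  define Z where "Z = {c :: nat \<Rightarrow> 'v. (\<lambda>n. \<nu> (c n)) \<longlonglongrightarrow> 0}"
  have CauD: "\<exists>n0. \<forall>m\<ge>n0. \<forall>n\<ge>n0. \<nu> (c m - c n) < e" if "c \<in> Cau" "e > 0" for c e
    using that by (auto simp: Cau_def)
  have subCau: "subspace Cau" unfolding subspace_def
  proof (intro conjI ballI allI)
    show "0 \<in> Cau" by (auto simp: Cau_def zero_fun_def)
    fix c d assume cd: "c \<in> Cau" "d \<in> Cau"
    show "c + d \<in> Cau" unfolding Cau_def
    proof (intro CollectI allI impI)
      fix e :: real assume e: "e > 0"
      obtain n1 where n1: "\<forall>m\<ge>n1. \<forall>n\<ge>n1. \<nu> (c m - c n) < e/2" using CauD[OF cd(1), of "e/2"] e by auto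
      obtain n2 where n2: "\<forall>m\<ge>n2. \<forall>n\<ge>n2. \<nu> (d m - d n) < e/2" using CauD[OF cd(2), of "e/2"] e by auto
      have "\<nu> ((c + d) m - (c + d) n) < e" if "m \<ge> max n1 n2" "n \<ge> max n1 n2" for m n
      proof -
        have "\<nu> ((c + d) m - (c + d) n) \<le> \<nu> (c m - c n) + \<nu> (d m - d n)"
          using triangle[of "c m - c n" "d m - d n"] by (simp add: plus_fun_def algebra_simps)
        also have "\<dots> < e/2 + e/2" using n1 n2 that by (intro add_strict_mono) auto
        finally show ?thesis by simp
      qed
      then show "\<exists>n0. \<forall>m\<ge>n0. \<forall>n\<ge>n0. \<nu> ((c + d) m - (c + d) n) < e" by blast
    qed
  next
    fix c and r :: real assume c: "c \<in> Cau"
    show "r *\<^sub>R c \<in> Cau" unfolding Cau_def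
    proof (intro CollectI allI impI)
      fix e :: real assume e: "e > 0"
      have pos: "\<bar>r\<bar> powr q + 1 > 0" by (simp add: add_nonneg_pos)
      then obtain n1 where n1: "\<forall>m\<ge>n1. \<forall>n\<ge>n1. \<nu> (c m - c n) < e / (\<bar>r\<bar> powr q + 1)"
        using CauD[OF c, of "e / (\<bar>r\<bar> powr q + 1)"] e by auto
      have "\<nu> ((r *\<^sub>R c) m - (r *\<^sub>R c) n) < e" if "m \<ge> n1" "n \<ge> n1" for m n
      proof -
        have "\<nu> ((r *\<^sub>R c) m - (r *\<^sub>R c) n) = \<bar>r\<bar> powr q * \<nu> (c m - c n)"
          by (simp add: scaleR_fun_def scaleR_diff_right[symmetric] scale)
        also have "\<dots> \<le> \<bar>r\<bar> powr q * (e / (\<bar>r\<bar> powr q + 1))"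
          using n1 that by (intro mult_left_mono) (auto intro: less_imp_le)
        also have "\<dots> < e" using e pos by (simp add: field_simps)
        finally show ?thesis .
      qed
      then show "\<exists>n0. \<forall>m\<ge>n0. \<forall>n\<ge>n0. \<nu> ((r *\<^sub>R c) m - (r *\<^sub>R c) n) < e" by blast
    qed
  qed
  have subZ: "subspace Z" unfolding subspace_def
  proof (intro conjI ballI allI)
    show "0 \<in> Z" by (auto simp: Z_def zero_fun_def)
    fix c d assume cd: "c \<in> Z" "d \<in> Z"
    have "(\<lambda>n. \<nu> (c n) + \<nu> (d n)) \<longlonglongrightarrow> 0"
      using cd tendsto_add[of "\<lambda>n. \<nu> (c n)" 0 sequentially "\<lambda>n. \<nu> (d n)" 0] by (simp add: Z_def)
    then have "(\<lambda>n. \<nu> (c n + d n)) \<longlonglongrightarrow> 0"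
      by (rule tendsto_sandwich[OF _ _ tendsto_const, rotated 2]) (simp_all add: triangle)
    then show "c + d \<in> Z" by (simp add: Z_def plus_fun_def)
  next
    fix c and r :: real assume "c \<in> Z"
    then show "r *\<^sub>R c \<in> Z"
      using tendsto_mult_left[of "\<lambda>n. \<nu> (c n)" 0 sequentially "\<bar>r\<bar> powr q"]
      by (simp add: Z_def scaleR_fun_def scale)
  qed
  have ZC: "Z \<subseteq> Cau"
  proof
    fix c assume c: "c \<in> Z"
    show "c \<in> Cau" unfolding Cau_def
    proof (intro CollectI allI impI)
      fix e :: real assume "e > 0"
      then have e: "e / 2 > 0" by simp
      have "(\<lambda>n. \<nu> (c n)) \<longlonglongrightarrow> 0" using c by (simp add: Z_def)
      from order_tendstoD(2)[OF this e] obtain n0 where n0: "\<And>n. n \<ge> n0 \<Longrightarrow> \<nu> (c n) < e/2"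
        unfolding eventually_sequentially by blast
      show "\<exists>n0. \<forall>m\<ge>n0. \<forall>n\<ge>n0. \<nu> (c m - c n) < e"
      proof (intro exI[of _ n0] allI impI)
        fix m n assume "n0 \<le> m" "n0 \<le> n"
        then show "\<nu> (c m - c n) < e" using n0[of m] n0[of n] triangle_diff[of "c m" "c n"] by linarith
      qed
    qed
  qed
  define l where "l = (\<lambda>c :: nat \<Rightarrow> 'v. lim (\<lambda>n. \<nu> (c n)))"
  have l: "(\<lambda>n. \<nu> (c n)) \<longlonglongrightarrow> l c" if "c \<in> Cau" for c
  proof -
    have "Cauchy (\<lambda>n. \<nu> (c n))" unfolding Cauchy_def dist_real_def
      using CauD[OF that] triangle_abs by (meson le_less_trans)
    then show ?thesis unfolding l_def by (simp add: Cauchy_convergent convergent_LIMSEQ_iff[symmetric])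
  qed
  have l_nonneg: "0 \<le> l c" if "c \<in> Cau" for c
    by (rule LIMSEQ_le_const[OF l[OF that]]) auto
  have l_add: "l (c + d) \<le> l c + l d" if "c \<in> Cau" "d \<in> Cau" for c d
    by (rule LIMSEQ_le[OF l[OF subspace_add[OF subCau that]] tendsto_add[OF l[OF that(1)] l[OF that(2)]]])
       (auto simp: plus_fun_def triangle)
  have l_scale: "l (r *\<^sub>R c) = \<bar>r\<bar> powr q * l c" if "c \<in> Cau" for c r
    using LIMSEQ_unique[OF l[OF subspace_scale[OF subCau that, of r]]]
      tendsto_mult_left[OF l[OF that], of "\<bar>r\<bar> powr q"] by (simp add: scaleR_fun_def scale)
  have l_Z: "l c = 0 \<longleftrightarrow> c \<in> Z" if "c \<in> Cau" for c
    using l[OF that] by (auto simp: Z_def intro: LIMSEQ_unique)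
  \<comment> \<open>A left inverse of the identity on \<open>Z\<close>, that is, a linear projection
    onto the null sequences. The representative of \<open>c\<close> in the complement is
    \<open>c - g c\<close>.\<close>
  obtain g :: "(nat \<Rightarrow> 'v) \<Rightarrow> nat \<Rightarrow> 'v" where g: "range g \<subseteq> Z" "linear g" "\<And>c. c \<in> Z \<Longrightarrow> g c = c"
    using linear_exists_left_inverse_on[of id Z] subZ by (auto simp: linear_id)
  have gZ: "g c \<in> Z" for c using g(1) by auto
  define C where "C = {c \<in> Cau. g c = 0}"
  define N' where "N' = (\<lambda>c. l c powr (1 / q))"
  define J where "J = (\<lambda>a :: 'v. (\<lambda>_::nat. a) - g (\<lambda>_. a))"
  have subC: "subspace C" using subCau linear_subspace_kernel[OF g(2)]
    by (auto simp: C_def subspace_def)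
  have CC: "C \<subseteq> Cau" by (auto simp: C_def)
  have l_shift: "l (c - z) = l c" if "c \<in> Cau" "z \<in> Z" for c z
  proof -
    have mz: "- z \<in> Z" using that subZ by (simp add: subspace_neg)
    have "z \<in> Cau" "- z \<in> Cau" using that mz ZC by auto
    then have z: "l z = 0" "l (-z) = 0" "z \<in> Cau" "- z \<in> Cau"
      using that mz by (simp_all add: l_Z)
    have "l (c + - z) \<le> l c" using l_add[OF that(1) z(4)] z by simp
    moreover have "l ((c - z) + z) \<le> l (c - z)"
      using l_add[of "c - z" z] z that subCau by (simp add: subspace_diff)
    ultimately show ?thesis by simp
  qed
  have dC: "c - g c \<in> C" "c - g c \<in> Cau" if "c \<in> Cau" for c
  proof -
    show *: "c - g c \<in> Cau" using that gZ ZC subCau by (auto intro!: subspace_diff)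
    show "c - g c \<in> C" using * by (simp add: C_def linear_diff[OF g(2)] g(3)[OF gZ])
  qed
  have constCau: "(\<lambda>_. a) \<in> Cau" for a by (auto simp: Cau_def)
  have "s_Banach q C N'" unfolding s_Banach_def
  proof (intro conjI ballI)
    show "quasi_norm_on C N'" unfolding N'_def
    proof (rule quasi_norm_of_gauge_on[OF subC q_pos])
      fix c assume "c \<in> C" "l c = 0"
      then show "c = 0" using l_Z[of c] CC g(3)[of c] by (auto simp: C_def)
    qed (use CC in \<open>auto intro!: l_nonneg l_add l_scale\<close>)
    show "N' (x + y) powr q \<le> N' x powr q + N' y powr q" if "x \<in> C" "y \<in> C" for x y
    proof -
      have xy: "x \<in> Cau" "y \<in> Cau" using that CC by auto
      then have "x + y \<in> Cau" by (rule subspace_add[OF subCau])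
      then show ?thesis using xy l_add[of x y] l_nonneg q_pos by (simp add: N'_def powr_powr)
    qed
    show "complete_on C N'" unfolding complete_on_def
    proof (intro allI impI)
      fix \<sigma> :: "nat \<Rightarrow> nat \<Rightarrow> 'v"
      assume \<sigma>: "range \<sigma> \<subseteq> C" "\<forall>e>0. \<exists>n0. \<forall>m\<ge>n0. \<forall>n\<ge>n0. N' (\<sigma> m - \<sigma> n) < e"
      have sC: "\<sigma> k \<in> C" "\<sigma> k \<in> Cau" for k using \<sigma>(1) CC by auto
      have ls: "\<exists>n0. \<forall>m\<ge>n0. \<forall>n\<ge>n0. l (\<sigma> m - \<sigma> n) < e" if e: "e > 0" for e
      proof -
        have "e powr (1/q) > 0" using e by simp
        with \<sigma>(2) obtain n0 where n0: "\<forall>m\<ge>n0. \<forall>n\<ge>n0. N' (\<sigma> m - \<sigma> n) < e powr (1/q)" by blast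
        have "l (\<sigma> m - \<sigma> n) < e" if "m \<ge> n0" "n \<ge> n0" for m n
        proof (rule ccontr)
          assume "\<not> l (\<sigma> m - \<sigma> n) < e"
          then have "e powr (1/q) \<le> N' (\<sigma> m - \<sigma> n)" unfolding N'_def using e q_pos
            by (intro powr_mono2) auto
          then show False using n0 that by force
        qed
        then show ?thesis by blast
      qed
      \<comment> \<open>Diagonal argument: \<open>n k\<close> is so late that all further entries of
        \<open>\<sigma> k\<close> differ from the chosen entry \<open>y k\<close> by less than 1 /
        (k + 1).\<close>
      have "\<exists>n. \<forall>m\<ge>n. \<forall>m'\<ge>n. \<nu> (\<sigma> k m - \<sigma> k m') < inverse (real (Suc k))" for k
        using CauD[OF sC(2)[of k], of "inverse (real (Suc k))"] by simp
      then obtain n where n: "\<And>k m m'. m \<ge> n k \<Longrightarrow> m' \<ge> n k \<Longrightarrow> \<nu> (\<sigma> k m - \<sigma> k m') < inverse (real (Suc k))"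
        by metis
      define y where "y = (\<lambda>k. \<sigma> k (n k))"
      have yb: "\<nu> (y k - y j) \<le> inverse (real (Suc k)) + l (\<sigma> k - \<sigma> j) + inverse (real (Suc j))" for k j
      proof -
        have "(\<lambda>m. inverse (real (Suc k)) + \<nu> ((\<sigma> k - \<sigma> j) m) + inverse (real (Suc j)))
            \<longlonglongrightarrow> inverse (real (Suc k)) + l (\<sigma> k - \<sigma> j) + inverse (real (Suc j))"
          by (intro tendsto_intros l subspace_diff[OF subCau] sC)
        moreover have "\<nu> (y k - y j) \<le> inverse (real (Suc k)) + \<nu> ((\<sigma> k - \<sigma> j) m) + inverse (real (Suc j))"
          if "m \<ge> max (n k) (n j)" for m
        proof -
          have "\<nu> (y k - y j) \<le> \<nu> (y k - \<sigma> k m) + (\<nu> (\<sigma> k m - \<sigma> j m) + \<nu> (\<sigma> j m - y j))"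
            using triangle3[of "y k" "y j" "\<sigma> k m"] triangle3[of "\<sigma> k m" "y j" "\<sigma> j m"] by linarith
          then show ?thesis using n[of k "n k" m] n[of j m "n j"] that by (simp add: y_def)
        qed
        ultimately show ?thesis by (metis (no_types, lifting) LIMSEQ_le_const)
      qed
      have small: "\<exists>n0. \<forall>m\<ge>n0. inverse (real (Suc m)) < e" if "e > 0" for e
        using order_tendstoD(2)[OF LIMSEQ_inverse_real_of_nat that] by (simp add: eventually_sequentially)
      have yC: "y \<in> Cau" unfolding Cau_def
      proof (intro CollectI allI impI)
        fix e :: real assume "e > 0"
        then have e: "e/3 > 0" by simp
        obtain n1 where n1: "\<forall>m\<ge>n1. inverse (real (Suc m)) < e/3" using small[OF e] by blast
        obtain n2 where n2: "\<forall>m\<ge>n2. \<forall>n\<ge>n2. l (\<sigma> m - \<sigma> n) < e/3" using ls[OF e] by blast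
        show "\<exists>n0. \<forall>m\<ge>n0. \<forall>n\<ge>n0. \<nu> (y m - y n) < e"
        proof (intro exI[of _ "max n1 n2"] allI impI)
          fix k j assume "max n1 n2 \<le> k" "max n1 n2 \<le> j"
          then have "inverse (real (Suc k)) < e/3" "l (\<sigma> k - \<sigma> j) < e/3" "inverse (real (Suc j)) < e/3"
            using n1 n2 by auto
          then show "\<nu> (y k - y j) < e" using yb[of k j] by linarith
        qed
      qed
      \<comment> \<open>The diagonal sequence \<open>y\<close> need not lie in \<open>C\<close>;
        subtracting the null sequence \<open>g y\<close> moves it there without changing any limit
        gauge.\<close>
      have ly: "l (\<sigma> k - (y - g y)) \<le> inverse (real (Suc k)) + e"
        if kk: "\<And>m. m \<ge> n0 \<Longrightarrow> \<nu> (y k - y m) \<le> e" for k e n0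
      proof -
        have "\<sigma> k - (y - g y) = (\<sigma> k - y) - (- g y)" by simp
        then have "l (\<sigma> k - (y - g y)) = l (\<sigma> k - y)"
          using l_shift[of "\<sigma> k - y" "- g y"] subspace_diff[OF subCau sC(2) yC, of k] subspace_neg[OF subZ gZ]
          by metis
        moreover have "l (\<sigma> k - y) \<le> inverse (real (Suc k)) + e"
        proof (rule LIMSEQ_le_const2[OF l[OF subspace_diff[OF subCau sC(2) yC]]], intro exI[of _ "max n0 (n k)"] allI impI)
          fix m assume m: "max n0 (n k) \<le> m"
          show "\<nu> ((\<sigma> k - y) m) \<le> inverse (real (Suc k)) + e"
            using triangle3[of "\<sigma> k m" "y m" "y k"] n[of k m "n k"] kk[of m] m by (simp add: y_def)
        qed
        ultimately show ?thesis by simp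
      qed
      have "(\<lambda>k. l (\<sigma> k - (y - g y))) \<longlonglongrightarrow> 0"
      proof (rule LIMSEQ_I)
        fix e :: real assume "e > 0"
        then have e: "e/3 > 0" by simp
        obtain n1 where n1: "\<forall>m\<ge>n1. inverse (real (Suc m)) < e/3" using small[OF e] by blast
        obtain n2 where n2: "\<forall>m\<ge>n2. \<forall>n\<ge>n2. \<nu> (y m - y n) < e/3" using CauD[OF yC e] by blast
        show "\<exists>no. \<forall>n\<ge>no. norm (l (\<sigma> n - (y - g y)) - 0) < e"
        proof (intro exI[of _ "max n1 n2"] allI impI)
          fix k assume k: "max n1 n2 \<le> k"
          have "l (\<sigma> k - (y - g y)) \<le> inverse (real (Suc k)) + e/3"
            by (rule ly[of n2]) (use n2 k in \<open>auto intro: less_imp_le\<close>)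
          moreover have "0 \<le> l (\<sigma> k - (y - g y))"
            by (intro l_nonneg subspace_diff[OF subCau] sC dC(2) yC)
          moreover have "inverse (real (Suc k)) < e/3" using n1 k by auto
          ultimately show "norm (l (\<sigma> k - (y - g y)) - 0) < e" using e by simp
        qed
      qed
      then have "(\<lambda>k. N' (\<sigma> k - (y - g y))) \<longlonglongrightarrow> 0" unfolding N'_def
        using q_pos
        by (intro tendsto_zero_powrI[where b="1/q"])
          (auto intro!: l_nonneg subspace_diff[OF subCau] sC dC(2) yC always_eventually)
      then show "\<exists>x\<in>C. (\<lambda>k. N' (\<sigma> k - x)) \<longlonglongrightarrow> 0" using dC(1)[OF yC] by blast
    qed
  qed (use q_pos assms in auto)
  moreover have "linear J"
  proof (rule linearI)
    fix a b :: 'v and r :: real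
    have "(\<lambda>_::nat. a + b) = (\<lambda>_. a) + (\<lambda>_. b)" by (simp add: plus_fun_def)
    then show "J (a + b) = J a + J b" by (simp add: J_def linear_add[OF g(2)])
    have "(\<lambda>_::nat. r *\<^sub>R a) = r *\<^sub>R (\<lambda>_. a)" by (simp add: scaleR_fun_def)
    then show "J (r *\<^sub>R a) = r *\<^sub>R J a" by (simp add: J_def linear_scale[OF g(2)] scaleR_diff_right)
  qed
  moreover have "range J \<subseteq> C" using dC(1)[OF constCau] by (auto simp: J_def)
  moreover have "N' (J a) = \<nu> a powr (1 / q)" for a
  proof -
    have "l (J a) = l (\<lambda>_. a)" unfolding J_def by (rule l_shift[OF constCau gZ])
    also have "\<dots> = \<nu> a" by (simp add: l_def)
    finally show ?thesis by (simp add: N'_def)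
  qed
  ultimately show thesis by (rule that)
qed

section \<open>Formal sums\<close>

lemma lookup_scaleR: "Poly_Mapping.lookup (r *\<^sub>R w) k = r *\<^sub>R Poly_Mapping.lookup w k"
  unfolding scaleR_poly_mapping_def
  by (subst Abs_poly_mapping_inverse) (auto intro: finite_subset[OF _ finite_lookup[of w]])

abbreviation pt :: "'x \<Rightarrow> 'x \<Rightarrow>\<^sub>0 real" where
  "pt x \<equiv> Poly_Mapping.single x 1"

definition lin_ext :: "('x \<Rightarrow> 'v::real_vector) \<Rightarrow> ('x \<Rightarrow>\<^sub>0 real) \<Rightarrow> 'v" where
  "lin_ext \<phi> a = (\<Sum>x\<in>Poly_Mapping.keys a. Poly_Mapping.lookup a x *\<^sub>R \<phi> x)"

lemma lin_ext_superset:
  assumes "finite S" "Poly_Mapping.keys a \<subseteq> S"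
  shows "lin_ext \<phi> a = (\<Sum>x\<in>S. Poly_Mapping.lookup a x *\<^sub>R \<phi> x)"
  unfolding lin_ext_def using assms by (intro sum.mono_neutral_left) (auto simp: in_keys_iff)

lemma linear_lin_ext: "linear (lin_ext \<phi>)"
proof (rule linearI)
  fix a b :: "'a \<Rightarrow>\<^sub>0 real" and r :: real
  let ?S = "Poly_Mapping.keys a \<union> Poly_Mapping.keys b"
  have "lin_ext \<phi> (a + b) = (\<Sum>x\<in>?S. Poly_Mapping.lookup (a + b) x *\<^sub>R \<phi> x)"
    by (intro lin_ext_superset) (simp_all add: Poly_Mapping.keys_add)
  moreover have "lin_ext \<phi> a = (\<Sum>x\<in>?S. Poly_Mapping.lookup a x *\<^sub>R \<phi> x)"
    "lin_ext \<phi> b = (\<Sum>x\<in>?S. Poly_Mapping.lookup b x *\<^sub>R \<phi> x)"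
    by (auto intro!: lin_ext_superset)
  ultimately show "lin_ext \<phi> (a + b) = lin_ext \<phi> a + lin_ext \<phi> b"
    by (simp add: lookup_add scaleR_add_left sum.distrib)
  have "lin_ext \<phi> (r *\<^sub>R a) = (\<Sum>x\<in>Poly_Mapping.keys a. Poly_Mapping.lookup (r *\<^sub>R a) x *\<^sub>R \<phi> x)"
    by (intro lin_ext_superset) (auto simp: in_keys_iff lookup_scaleR)
  then show "lin_ext \<phi> (r *\<^sub>R a) = r *\<^sub>R lin_ext \<phi> a"
    by (simp add: lin_ext_def lookup_scaleR scaleR_sum_right)
qed

lemma lin_ext_pt [simp]: "lin_ext \<phi> (pt x) = \<phi> x"
  by (simp add: lin_ext_def)

lemmas lin_ext_simps = linear_add[OF linear_lin_ext] linear_diff[OF linear_lin_ext]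
  linear_scale[OF linear_lin_ext] linear_sum[OF linear_lin_ext] linear_0[OF linear_lin_ext]

lemma scaleR_pt: "c *\<^sub>R pt x = Poly_Mapping.single x c"
  by (rule poly_mapping_eqI) (simp add: lookup_scaleR lookup_single when_def)

lemma lin_ext_id: "lin_ext pt a = a"
  by (rule poly_mapping_eqI)
    (auto simp: lin_ext_def scaleR_pt lookup_sum lookup_single when_def in_keys_iff)

lemma poly_mapping_expand: "a = (\<Sum>x\<in>Poly_Mapping.keys a. Poly_Mapping.lookup a x *\<^sub>R pt x)"
  using lin_ext_id[of a] by (simp add: lin_ext_def)

lemma lin_ext_comp: "linear T \<Longrightarrow> T (lin_ext \<phi> a) = lin_ext (\<lambda>x. T (\<phi> x)) a"
  by (simp add: lin_ext_def linear_sum linear_scale)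

lemma lin_ext_cong: "(\<And>x. x \<in> Poly_Mapping.keys a \<Longrightarrow> \<phi> x = \<psi> x) \<Longrightarrow> lin_ext \<phi> a = lin_ext \<psi> a"
  by (simp add: lin_ext_def)

lemma lin_ext_diff: "lin_ext (\<lambda>x. \<phi> x - \<psi> x) a = lin_ext \<phi> a - lin_ext \<psi> a"
  by (simp add: lin_ext_def scaleR_diff_right sum_subtractf)

lemma lin_ext_in_subspace:
  assumes "subspace V" "\<And>x. x \<in> Poly_Mapping.keys a \<Longrightarrow> \<phi> x \<in> V"
  shows "lin_ext \<phi> a \<in> V"
  unfolding lin_ext_def using assms by (intro subspace_sum subspace_scale) auto

section \<open>Bounded linear maps and the dual form of the universal property\<close>

lemma bounded_linear_betweenD:
  assumes "bounded_linear_between V NV W NW T"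
  shows "x \<in> V \<Longrightarrow> T x \<in> W" "x \<in> V \<Longrightarrow> y \<in> V \<Longrightarrow> T (x + y) = T x + T y"
    "x \<in> V \<Longrightarrow> T (c *\<^sub>R x) = c *\<^sub>R T x" "\<exists>C. \<forall>x\<in>V. NW (T x) \<le> C * NV x"
  using assms unfolding bounded_linear_between_def by auto

lemma bounded_linear_between_zero:
  assumes "bounded_linear_between V NV W NW T" "subspace V"
  shows "T 0 = 0"
  using bounded_linear_betweenD(3)[OF assms(1) subspace_0[OF assms(2)], of 0] by simp

lemma bounded_linear_between_diff:
  assumes T: "bounded_linear_between V NV W NW T" and V: "subspace V" "x \<in> V" "y \<in> V"
  shows "T (x - y) = T x - T y"
  using bounded_linear_betweenD(2)[OF T V(2) subspace_scale[OF V(1,3), of "-1"]]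
    bounded_linear_betweenD(3)[OF T V(3), of "-1"] by simp

lemma bounded_linear_between_lin_ext:
  assumes T: "bounded_linear_between V NV W NW T" and V: "subspace V"
    and \<phi>: "\<And>x. x \<in> Poly_Mapping.keys a \<Longrightarrow> \<phi> x \<in> V"
  shows "T (lin_ext \<phi> a) = lin_ext (\<lambda>x. T (\<phi> x)) a"
proof -
  have "(\<Sum>x\<in>A. c x *\<^sub>R \<phi> x) \<in> V \<and> T (\<Sum>x\<in>A. c x *\<^sub>R \<phi> x) = (\<Sum>x\<in>A. c x *\<^sub>R T (\<phi> x))"
    if "finite A" "\<And>x. x \<in> A \<Longrightarrow> \<phi> x \<in> V" for A and c :: "_ \<Rightarrow> real"
    using that
  proof (induction A rule: finite_induct)
    case empty
    show ?case using bounded_linear_between_zero[OF T V] V by (simp add: subspace_0)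
  next
    case (insert x A)
    then have "\<phi> x \<in> V" "c x *\<^sub>R \<phi> x \<in> V" using V by (auto intro: subspace_scale)
    then show ?case using insert V by (simp add: bounded_linear_betweenD(2,3)[OF T] subspace_add)
  qed
  then show ?thesis unfolding lin_ext_def using \<phi> by simp
qed

lemma operator_norm_bound:
  assumes F: "s_Banach p F NF" and Y: "s_Banach p' Y NY"
    and T: "bounded_linear_between F NF Y NY T" and v: "v \<in> F"
  shows "NY (T v) \<le> operator_norm F NF NY T * NF v"
proof -
  note subF = s_BanachD(3)[OF F] and subY = s_BanachD(3)[OF Y]
  obtain C where C: "\<And>x. x \<in> F \<Longrightarrow> NY (T x) \<le> C * NF x" using bounded_linear_betweenD(4)[OF T] by blast
  show ?thesis
  proof (cases "v = 0")
    case True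
    then have "T v = 0" using bounded_linear_between_zero[OF T subF] by simp
    then have "NY (T v) = 0" using s_BanachD(5)[OF Y, of 0] subY by (simp add: subspace_0)
    moreover have "NF v = 0" using s_BanachD(5)[OF F v] True by simp
    ultimately show ?thesis by simp
  next
    case False
    then have n: "NF v > 0" using s_BanachD(4,5)[OF F v] by force
    let ?u = "(1 / NF v) *\<^sub>R v"
    have u: "?u \<in> F" using v subF by (simp add: subspace_scale)
    have "NF ?u = 1" using n s_BanachD(6)[OF F v] by simp
    then have "NY (T ?u) \<le> operator_norm F NF NY T" unfolding operator_norm_def
    proof (intro cSUP_upper)
      \<comment> \<open>The supremum dominates its members only if the set is bounded above. The
        bound \<open>C\<close> may be negative, hence its absolute value.\<close>
      show "bdd_above ((\<lambda>x. NY (T x)) ` {x \<in> F. NF x \<le> 1})"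
      proof (rule bdd_aboveI2[where M = "\<bar>C\<bar>"])
        fix x assume "x \<in> {x \<in> F. NF x \<le> 1}"
        then have x: "x \<in> F" "NF x \<le> 1" "0 \<le> NF x" using s_BanachD(4)[OF F] by auto
        have "C * NF x \<le> \<bar>C\<bar> * 1" using x by (intro mult_mono) auto
        then show "NY (T x) \<le> \<bar>C\<bar>" using C[OF x(1)] by simp
      qed
    qed (use u in auto)
    then show ?thesis using n s_BanachD(6)[OF Y bounded_linear_betweenD(1)[OF T v]]
      by (simp add: bounded_linear_betweenD(3)[OF T v] field_simps)
  qed
qed

text \<open>The completion of the formal sums under \<open>R\<close> is a \<open>p\<close>-Banach
  space, and sending a point to its symbol is a Lipschitz map into it, pointed because
  \<open>R (pt 0) = 0\<close>. Its extension takes \<open>lin_ext \<delta> a\<close> to the class of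
  \<open>a\<close>, so its operator norm bounds \<open>R a\<close>.\<close>

lemma lipschitz_free_gauge_bound:
  fixes \<delta> :: "'x::real_vector \<Rightarrow> 'f::real_vector" and R :: "('x \<Rightarrow>\<^sub>0 real) \<Rightarrow> real"
  assumes free: "lipschitz_free p X (qdist N) 0 F NF \<delta>" and R: "gauge R p"
    and B: "0 \<le> B" "\<And>x y. x \<in> X \<Longrightarrow> y \<in> X \<Longrightarrow> R (pt x - pt y) \<le> B * N (x - y) powr p"
    and R0: "R (pt 0) = 0" and a: "Poly_Mapping.keys a \<subseteq> X"
    and Nn: "\<And>x y. x \<in> X \<Longrightarrow> y \<in> X \<Longrightarrow> 0 \<le> N (x - y)"
  shows "R a \<le> B * NF (lin_ext \<delta> a) powr p"
proof -
  have F: "s_Banach p F NF" and \<delta>F: "\<delta> ` X \<subseteq> F" using free by (auto simp: lipschitz_free_def)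
  note subF = s_BanachD(3)[OF F]
  have p: "0 < p" "p \<le> 1" using F by (auto simp: s_Banach_def)
  interpret gauge R p by fact
  obtain C :: "(nat \<Rightarrow> 'x \<Rightarrow>\<^sub>0 real) set" and N' J where
    C: "s_Banach p C N'" and J: "linear J" "range J \<subseteq> C" "\<And>a. N' (J a) = R a powr (1 / p)"
    using completion[OF p(2)] by metis
  define g where "g = (\<lambda>x. J (pt x))"
  have gC: "g ` X \<subseteq> C" using J(2) by (auto simp: g_def)
  have g0: "g 0 = 0" using J(2,3) s_BanachD(5)[OF C, of "g 0"] R0 by (auto simp: g_def)
  define L where "L = B powr (1 / p)"
  have gL: "lipschitz_with L X (qdist N) (qdist N') g" unfolding lipschitz_with_def qdist_def
  proof (intro conjI ballI)
    fix x y assume xy: "x \<in> X" "y \<in> X"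
    have "N' (g x - g y) = R (pt x - pt y) powr (1 / p)"
      unfolding g_def J(3)[symmetric] linear_diff[OF J(1)] ..
    also have "\<dots> \<le> (B * N (x - y) powr p) powr (1 / p)"
      using p B(2)[OF xy] by (intro powr_mono2) auto
    also have "\<dots> = L * N (x - y)"
      using p B Nn[OF xy] by (simp add: L_def powr_mult powr_powr)
    finally show "N' (g x - g y) \<le> L * N (x - y)" .
  qed (simp add: L_def)
  have univ: "universal_towards X (qdist N) 0 F NF \<delta> C N'"
    using free C by (rule lipschitz_free_universal)
  then have ex: "\<exists>!T. linearizes X F NF \<delta> C N' g T"
    and on: "operator_norm F NF N' (THE T. linearizes X F NF \<delta> C N' g T) = Lip X (qdist N) (qdist N') g"
    using gC g0 gL unfolding universal_towards_def by blast+
  define T where "T = (THE T. linearizes X F NF \<delta> C N' g T)"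
  have T: "linearizes X F NF \<delta> C N' g T" unfolding T_def by (rule theI'[OF ex])
  then have Tb: "bounded_linear_between F NF C N' T" and T\<delta>: "\<And>x. x \<in> X \<Longrightarrow> T (\<delta> x) = g x"
    by (auto simp: linearizes_def)
  have "Lip X (qdist N) (qdist N') g \<le> L" unfolding Lip_def
    by (rule cInf_lower) (use gL in \<open>auto simp: lipschitz_with_def intro: bdd_belowI[of _ 0]\<close>)
  then have opL: "operator_norm F NF N' T \<le> L" using on by (simp add: T_def)
  have \<delta>F': "\<delta> x \<in> F" if "x \<in> Poly_Mapping.keys a" for x using that a \<delta>F by auto
  have aF: "lin_ext \<delta> a \<in> F" by (rule lin_ext_in_subspace[OF subF \<delta>F'])
  have "T (lin_ext \<delta> a) = lin_ext (\<lambda>x. T (\<delta> x)) a"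
    by (rule bounded_linear_between_lin_ext[OF Tb subF \<delta>F'])
  also have "\<dots> = lin_ext (\<lambda>x. J (pt x)) a" using a by (intro lin_ext_cong) (auto simp: T\<delta> g_def)
  also have "\<dots> = J a" using lin_ext_comp[OF J(1), of pt a] by (simp add: lin_ext_id)
  finally have Ta: "T (lin_ext \<delta> a) = J a" .
  have nF: "0 \<le> NF (lin_ext \<delta> a)" using s_BanachD(4)[OF F aF] .
  have "R a powr (1 / p) \<le> operator_norm F NF N' T * NF (lin_ext \<delta> a)"
    using operator_norm_bound[OF F C Tb aF] by (simp add: Ta J(3))
  also have "\<dots> \<le> L * NF (lin_ext \<delta> a)" using opL nF by (intro mult_right_mono)
  finally have "(R a powr (1 / p)) powr p \<le> (L * NF (lin_ext \<delta> a)) powr p"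
    using p by (intro powr_mono2) auto
  then show ?thesis using p B nF by (simp add: powr_powr powr_mult L_def)
qed

section \<open>Finite-dimensional subspaces\<close>

lemma tendsto_zero_squeeze:
  fixes a b :: "nat \<Rightarrow> real"
  assumes "b \<longlonglongrightarrow> 0" "\<And>n. 0 \<le> a n" "\<And>n. a n \<le> b n"
  shows "a \<longlonglongrightarrow> 0"
  using assms by (intro tendsto_sandwich[OF _ _ tendsto_const assms(1)]) (auto intro: always_eventually)

context gauge
begin

text \<open>The gauge of the quotient by \<open>E\<close>, kept on the original space; it vanishes
  on \<open>E\<close>, so the locale must allow gauges that vanish off 0.\<close>

definition mod_gauge :: "'v set \<Rightarrow> 'v \<Rightarrow> real" where
  "mod_gauge E x = (INF e\<in>E. \<nu> (x - e))"

lemma mod_gauge_le: "e \<in> E \<Longrightarrow> mod_gauge E x \<le> \<nu> (x - e)"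
  unfolding mod_gauge_def by (rule cINF_lower) (auto intro: bdd_belowI2[where m = 0])

lemma mod_gauge_le_self: "subspace E \<Longrightarrow> mod_gauge E x \<le> \<nu> x"
  using mod_gauge_le[of 0 E x] by (simp add: subspace_0)

lemma mod_gauge_nonneg: "subspace E \<Longrightarrow> 0 \<le> mod_gauge E x"
  unfolding mod_gauge_def by (rule cINF_greatest) (auto dest: subspace_0)

lemma mod_gauge_approx:
  assumes "subspace E" "mod_gauge E x < c"
  obtains e where "e \<in> E" "\<nu> (x - e) < c"
proof -
  have "E \<noteq> {}" using subspace_0[OF assms(1)] by blast
  moreover have "bdd_below ((\<lambda>e. \<nu> (x - e)) ` E)" by (auto intro: bdd_belowI2[where m = 0])
  ultimately show thesis
    using assms(2) that cINF_less_iff[of E "\<lambda>e. \<nu> (x - e)" c] unfolding mod_gauge_def by blast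
qed

lemma mod_gauge_antimono: "subspace E \<Longrightarrow> E \<subseteq> E' \<Longrightarrow> mod_gauge E' x \<le> mod_gauge E x"
  unfolding mod_gauge_def
  by (rule cINF_superset_mono) (auto dest: subspace_0 intro: bdd_belowI2[where m = 0])

lemma gauge_mod_gauge:
  assumes E: "subspace E"
  shows "gauge (mod_gauge E) q"
proof (rule gaugeI_le)
  fix x y :: 'v and c :: real
  show "0 < q" by (rule q_pos)
  show "0 \<le> mod_gauge E x" by (rule mod_gauge_nonneg[OF E])
  show "mod_gauge E (x + y) \<le> mod_gauge E x + mod_gauge E y"
  proof (rule field_le_epsilon)
    fix \<epsilon> :: real assume e: "\<epsilon> > 0"
    obtain u where u: "u \<in> E" "\<nu> (x - u) < mod_gauge E x + \<epsilon>/2"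
      using mod_gauge_approx[OF E, of x "mod_gauge E x + \<epsilon>/2"] e by auto
    obtain w where w: "w \<in> E" "\<nu> (y - w) < mod_gauge E y + \<epsilon>/2"
      using mod_gauge_approx[OF E, of y "mod_gauge E y + \<epsilon>/2"] e by auto
    have "mod_gauge E (x + y) \<le> \<nu> ((x + y) - (u + w))"
      using u w E by (intro mod_gauge_le subspace_add)
    also have "\<dots> \<le> \<nu> (x - u) + \<nu> (y - w)"
      using triangle[of "x - u" "y - w"] by (simp add: algebra_simps)
    finally show "mod_gauge E (x + y) \<le> mod_gauge E x + mod_gauge E y + \<epsilon>" using u w by linarith
  qed
  show "mod_gauge E (c *\<^sub>R x) \<le> \<bar>c\<bar> powr q * mod_gauge E x"
  proof (rule field_le_epsilon)
    fix \<epsilon> :: real assume e: "\<epsilon> > 0"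
    define k where "k = \<bar>c\<bar> powr q + 1"
    have k: "k > 0" by (simp add: k_def add_nonneg_pos)
    obtain u where u: "u \<in> E" "\<nu> (x - u) < mod_gauge E x + \<epsilon> / k"
      using mod_gauge_approx[OF E, of x "mod_gauge E x + \<epsilon> / k"] e k by auto
    have "mod_gauge E (c *\<^sub>R x) \<le> \<nu> (c *\<^sub>R x - c *\<^sub>R u)"
      using u E by (intro mod_gauge_le subspace_scale)
    also have "\<dots> = \<bar>c\<bar> powr q * \<nu> (x - u)"
      by (simp add: scaleR_diff_right[symmetric] scale)
    also have "\<dots> \<le> \<bar>c\<bar> powr q * (mod_gauge E x + \<epsilon> / k)"
      using u by (intro mult_left_mono) auto
    also have "\<dots> \<le> \<bar>c\<bar> powr q * mod_gauge E x + \<epsilon>"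
      using e k by (simp add: distrib_left k_def field_simps)
    finally show "mod_gauge E (c *\<^sub>R x) \<le> \<bar>c\<bar> powr q * mod_gauge E x + \<epsilon>" .
  qed
qed

lemma mod_gauge_zero: "subspace E \<Longrightarrow> e \<in> E \<Longrightarrow> mod_gauge E e = 0"
  using mod_gauge_le[of e E e] mod_gauge_nonneg[of E e] by simp

lemma mod_gauge_cong:
  assumes E: "subspace E" and e: "x - y \<in> E"
  shows "mod_gauge E x = mod_gauge E y"
proof -
  interpret m: gauge "mod_gauge E" q by (rule gauge_mod_gauge[OF E])
  show ?thesis using m.triangle_abs[of x y] mod_gauge_zero[OF E e] by simp
qed

text \<open>Sequential compactness of bounded sets. The limit \<open>y\<close> is determined only up
  to vectors of gauge 0.\<close>

definition bounded_compact :: "'v set \<Rightarrow> bool" where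
  "bounded_compact E \<longleftrightarrow> (\<forall>e M. (\<forall>n::nat. e n \<in> E \<and> \<nu> (e n) \<le> M) \<longrightarrow>
     (\<exists>(r :: nat \<Rightarrow> nat) y. strict_mono r \<and> y \<in> E \<and> (\<lambda>n. \<nu> (e (r n) - y)) \<longlonglongrightarrow> 0))"

lemma bounded_compactD:
  assumes "bounded_compact E" "\<And>n. e n \<in> E" "\<And>n. \<nu> (e n) \<le> M"
  obtains r :: "nat \<Rightarrow> nat" and y where "strict_mono r" "y \<in> E" "(\<lambda>n. \<nu> (e (r n) - y)) \<longlonglongrightarrow> 0"
  using assms unfolding bounded_compact_def by blast

text \<open>Vectors of \<open>E\<close> that approach \<open>x\<close> are bounded, so a subsequence
  has a limit, which is at gauge distance 0 from \<open>x\<close>.\<close>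

lemma bounded_compact_attained:
  assumes E: "subspace E" "bounded_compact E" and x: "mod_gauge E x = 0"
  obtains y where "y \<in> E" "\<nu> (x - y) = 0"
proof -
  have "\<exists>e\<in>E. \<nu> (x - e) < inverse (real (Suc n))" for n
    using mod_gauge_approx[OF E(1), of x "inverse (real (Suc n))"] x by (metis inverse_positive_iff_positive of_nat_0_less_iff zero_less_Suc)
  then obtain e where e: "\<And>n. e n \<in> E" "\<And>n. \<nu> (x - e n) < inverse (real (Suc n))" by metis
  have "\<nu> (e n) \<le> \<nu> x + 1" for n
  proof -
    have "inverse (real (Suc n)) \<le> 1" by (simp add: field_simps)
    then show ?thesis using triangle_rev[of "e n" x] commute[of x "e n"] e(2)[of n] by linarith
  qed
  from bounded_compactD[OF E(2) e(1) this] obtain r y where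
    r: "strict_mono r" "y \<in> E" "(\<lambda>n. \<nu> (e (r n) - y)) \<longlonglongrightarrow> 0" .
  have "(\<lambda>n. inverse (real (Suc (r n))) + \<nu> (e (r n) - y)) \<longlonglongrightarrow> 0 + 0"
    using LIMSEQ_subseq_LIMSEQ[OF LIMSEQ_inverse_real_of_nat r(1)] r(3)
    by (intro tendsto_add) (auto simp: o_def)
  moreover have "\<nu> (x - y) \<le> inverse (real (Suc (r n))) + \<nu> (e (r n) - y)" for n
    using triangle3[of x y "e (r n)"] e(2)[of "r n"] by linarith
  ultimately have "\<nu> (x - y) \<le> 0 + 0" by (intro LIMSEQ_le_const) auto
  then show thesis using that[OF r(2)] nonneg[of "x - y"] by simp
qed

text \<open>If \<open>b\<close> has quotient gauge 0 over \<open>span B\<close>, it is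
  interchangeable with a vector of \<open>span B\<close>. Otherwise the quotient gauge bounds the
  coefficients of \<open>b\<close>; a subsequence of them converges, and the remainders are bounded
  in \<open>span B\<close>.\<close>

lemma bounded_compact_span: "finite B \<Longrightarrow> bounded_compact (span B)"
proof (induction B rule: finite_induct)
  case empty
  show ?case unfolding bounded_compact_def
    by (auto intro!: exI[of _ id] simp: strict_mono_id)
next
  case (insert b B)
  show ?case unfolding bounded_compact_def
  proof (intro allI impI)
    fix e :: "nat \<Rightarrow> 'v" and M assume eM: "\<forall>n. e n \<in> span (insert b B) \<and> \<nu> (e n) \<le> M"
    then have "\<forall>n. \<exists>k. e n - k *\<^sub>R b \<in> span B" by (simp add: span_breakdown_eq)
    then obtain t where t: "\<And>n. e n - t n *\<^sub>R b \<in> span B" by metis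
    have BB: "span B \<subseteq> span (insert b B)" by (rule span_mono) auto
    show "\<exists>r y. strict_mono r \<and> y \<in> span (insert b B) \<and> (\<lambda>n. \<nu> (e (r n) - y)) \<longlonglongrightarrow> 0"
    proof (cases "mod_gauge (span B) b = 0")
      case True
      obtain y where y: "y \<in> span B" "\<nu> (b - y) = 0"
        using bounded_compact_attained[OF subspace_span insert.IH True] .
      define e' where "e' = (\<lambda>n. e n - t n *\<^sub>R (b - y))"
      have ee: "\<nu> (e n - e' n) = 0" for n by (simp add: e'_def scale y)
      have e1: "e' n \<in> span B" for n
        using span_add[OF t[of n] span_scale[OF y(1), of "t n"]] by (simp add: e'_def algebra_simps)
      have e2: "\<nu> (e' n) \<le> M" for n
        using triangle_rev[of "e' n" "e n"] ee[of n] commute[of "e n" "e' n"] eM[rule_format, of n] by linarith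
      obtain r z where r: "strict_mono r" "z \<in> span B" "(\<lambda>n. \<nu> (e' (r n) - z)) \<longlonglongrightarrow> 0"
        using bounded_compactD[OF insert.IH e1 e2] .
      have "\<nu> (e (r n) - z) \<le> \<nu> (e' (r n) - z)" for n
        using triangle3[of "e (r n)" z "e' (r n)"] ee[of "r n"] by simp
      then have "(\<lambda>n. \<nu> (e (r n) - z)) \<longlonglongrightarrow> 0"
        by (intro tendsto_zero_squeeze[OF r(3) nonneg])
      then show ?thesis using r BB by blast
    next
      case False
      define \<beta> where "\<beta> = mod_gauge (span B) b"
      have \<beta>: "\<beta> > 0" using False mod_gauge_nonneg[OF subspace_span, of B b] by (simp add: \<beta>_def)
      interpret m: gauge "mod_gauge (span B)" q by (rule gauge_mod_gauge) simp
      have tb: "\<bar>t n\<bar> \<le> (M / \<beta>) powr (1 / q)" for n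
      proof -
        have "\<bar>t n\<bar> powr q * \<beta> = mod_gauge (span B) (t n *\<^sub>R b)" by (simp add: m.scale \<beta>_def)
        also have "\<dots> = mod_gauge (span B) (e n)"
          using t[of n] span_neg[OF t[of n]] by (intro mod_gauge_cong) auto
        also have "\<dots> \<le> M" using mod_gauge_le_self[OF subspace_span, of B "e n"] eM by (meson order_trans)
        finally have "\<bar>t n\<bar> powr q \<le> M / \<beta>" using \<beta> by (simp add: field_simps)
        then have "(\<bar>t n\<bar> powr q) powr (1 / q) \<le> (M / \<beta>) powr (1 / q)"
          using q_pos by (intro powr_mono2) auto
        then show ?thesis using q_pos by (simp add: powr_powr)
      qed
      define T where "T = (M / \<beta>) powr (1 / q)"
      have "\<forall>n. t n \<in> {-T..T}" using tb by (auto simp: T_def abs_le_iff minus_le_iff)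
      then obtain t0 r1 where r1: "strict_mono r1" "(t \<circ> r1) \<longlonglongrightarrow> t0"
        using compact_imp_seq_compact[OF compact_Icc[of "-T" T]] unfolding seq_compact_def by blast
      define e' where "e' = (\<lambda>n. e (r1 n) - t (r1 n) *\<^sub>R b)"
      have e1: "e' n \<in> span B" for n by (simp add: e'_def t)
      have e2: "\<nu> (e' n) \<le> M + T powr q * \<nu> b" for n
      proof -
        have "\<nu> (e' n) \<le> \<nu> (e (r1 n)) + \<bar>t (r1 n)\<bar> powr q * \<nu> b"
          using triangle_diff[of "e (r1 n)" "t (r1 n) *\<^sub>R b"] by (simp add: e'_def scale)
        also have "\<dots> \<le> M + T powr q * \<nu> b"
          using eM tb[of "r1 n"] q_pos
          by (intro add_mono mult_right_mono powr_mono2) (auto simp: T_def)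
        finally show ?thesis .
      qed
      obtain r2 z where r2: "strict_mono r2" "z \<in> span B" "(\<lambda>n. \<nu> (e' (r2 n) - z)) \<longlonglongrightarrow> 0"
        using bounded_compactD[OF insert.IH e1 e2] .
      have tt: "(\<lambda>n. \<bar>t (r1 (r2 n)) - t0\<bar> powr q * \<nu> b) \<longlonglongrightarrow> 0 * \<nu> b"
      proof (intro tendsto_mult_right tendsto_zero_powrI[where b = q])
        have "(\<lambda>n. t (r1 (r2 n)) - t0) \<longlonglongrightarrow> t0 - t0"
          using LIMSEQ_subseq_LIMSEQ[OF r1(2) r2(1)] by (intro tendsto_diff) (auto simp: o_def)
        then show "(\<lambda>n. \<bar>t (r1 (r2 n)) - t0\<bar>) \<longlonglongrightarrow> 0" by (simp add: tendsto_rabs_zero)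
      qed (auto simp: q_pos)
      have b1: "(\<lambda>n. \<nu> (e' (r2 n) - z) + \<bar>t (r1 (r2 n)) - t0\<bar> powr q * \<nu> b) \<longlonglongrightarrow> 0"
        using tendsto_add[OF r2(3) tt] by simp
      have b2: "\<nu> (e ((r1 \<circ> r2) n) - (z + t0 *\<^sub>R b)) \<le> \<nu> (e' (r2 n) - z) + \<bar>t (r1 (r2 n)) - t0\<bar> powr q * \<nu> b" for n
        using triangle[of "e' (r2 n) - z" "(t (r1 (r2 n)) - t0) *\<^sub>R b"] unfolding scale
        by (simp add: e'_def algebra_simps)
      have "(\<lambda>n. \<nu> (e ((r1 \<circ> r2) n) - (z + t0 *\<^sub>R b))) \<longlonglongrightarrow> 0"
        by (rule tendsto_zero_squeeze[OF b1 nonneg b2])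
      moreover have "z + t0 *\<^sub>R b \<in> span (insert b B)"
        using r2(2) BB by (intro span_add span_scale) (auto intro: span_base)
      moreover have "strict_mono (r1 \<circ> r2)" using r1(1) r2(1) by (rule strict_mono_o)
      ultimately show ?thesis by blast
    qed
  qed
qed

text \<open>Riesz's lemma: subtract a vector of the span that attains the quotient gauge up to a
  factor 2, then normalize. The quotient gauge is not 0, as otherwise compactness would yield a
  vector of the span at distance 0.\<close>

lemma riesz:
  assumes B: "finite B" and x: "\<And>e. e \<in> span B \<Longrightarrow> \<nu> (x - e) \<noteq> 0"
  obtains z where "\<nu> z = 1" "mod_gauge (span B) z \<ge> 1/2"
proof -
  interpret m: gauge "mod_gauge (span B)" q by (rule gauge_mod_gauge) simp
  define \<beta> where "\<beta> = mod_gauge (span B) x"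
  have "\<beta> \<noteq> 0" unfolding \<beta>_def
    using bounded_compact_attained[OF subspace_span bounded_compact_span[OF B]] x by metis
  then have \<beta>: "\<beta> > 0" using m.nonneg[of x] unfolding \<beta>_def by linarith
  obtain e where e: "e \<in> span B" "\<nu> (x - e) < 2 * \<beta>"
    using mod_gauge_approx[OF subspace_span, of B x "2 * \<beta>"] \<beta> by (auto simp: \<beta>_def)
  have n: "\<nu> (x - e) > 0" using x[OF e(1)] nonneg[of "x - e"] by linarith
  define c where "c = (1 / \<nu> (x - e)) powr (1 / q)"
  have c: "\<bar>c\<bar> powr q = 1 / \<nu> (x - e)" using n q_pos by (simp add: c_def powr_powr)
  show thesis
  proof
    show "\<nu> (c *\<^sub>R (x - e)) = 1" using n by (simp add: scale c)
    have "mod_gauge (span B) (x - e) = \<beta>" unfolding \<beta>_def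
      using e span_neg[OF e(1)] by (intro mod_gauge_cong) auto
    then show "mod_gauge (span B) (c *\<^sub>R (x - e)) \<ge> 1/2"
      unfolding m.scale c using n e by (simp add: field_simps)
  qed
qed

text \<open>Riesz's lemma, iterated, gives terms at mutual distance at least 1/2. If infinitely many
  were within 1/16 of one finite-dimensional span, compactness would produce two of them at distance
  less than 4/16.\<close>

lemma far_sequence:
  assumes inf: "\<And>B. finite B \<Longrightarrow> \<exists>x. \<forall>e\<in>span B. \<nu> (x - e) \<noteq> 0"
  obtains x :: "nat \<Rightarrow> 'v" where "\<And>n. \<nu> (x n) \<le> 1"
    "\<And>B. finite B \<Longrightarrow> eventually (\<lambda>n. mod_gauge (span B) (x n) \<ge> 1/16) sequentially"
proof -
  have "\<exists>x. \<forall>n::nat. \<nu> (x n) = 1 \<and> mod_gauge (span (x ` {..<n})) (x n) \<ge> 1/2"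
  proof (rule dependent_wellorder_choice)
    fix n and x :: "nat \<Rightarrow> 'v"
    have fin: "finite (x ` {..<n})" by simp
    from inf[OF fin] obtain y where "\<And>e. e \<in> span (x ` {..<n}) \<Longrightarrow> \<nu> (y - e) \<noteq> 0" by blast
    from riesz[OF fin this]
    show "\<exists>z. \<nu> z = 1 \<and> mod_gauge (span (x ` {..<n})) z \<ge> 1/2" by metis
  next
    fix r :: 'v and f g :: "nat \<Rightarrow> 'v" and n :: nat
    assume "\<And>y. y < n \<Longrightarrow> f y = g y"
    then have "f ` {..<n} = g ` {..<n}" by auto
    then show "(\<nu> r = 1 \<and> mod_gauge (span (f ` {..<n})) r \<ge> 1/2) = (\<nu> r = 1 \<and> mod_gauge (span (g ` {..<n})) r \<ge> 1/2)"
      by simp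
  qed
  then obtain x :: "nat \<Rightarrow> 'v" where x: "\<And>n. \<nu> (x n) = 1" "\<And>n. mod_gauge (span (x ` {..<n})) (x n) \<ge> 1/2"
    by blast
  have sep: "\<nu> (x n - x m) \<ge> 1/2" if "m < n" for m n
    using mod_gauge_le[of "x m" "span (x ` {..<n})" "x n"] x(2)[of n] that
    by (force intro: span_base)
  have "eventually (\<lambda>n. mod_gauge (span B) (x n) \<ge> 1/16) sequentially" if B: "finite B" for B
  proof (rule ccontr)
    assume "\<not> ?thesis"
    then have "\<exists>\<^sub>F n in sequentially. mod_gauge (span B) (x n) < 1/16"
      by (simp add: frequently_def not_less)
    then have "infinite {n. mod_gauge (span B) (x n) < 1/16}"
      by (simp add: frequently_cofinite[symmetric] cofinite_eq_sequentially)
    then obtain r0 :: "nat \<Rightarrow> nat" where r0: "strict_mono r0" "\<And>n. mod_gauge (span B) (x (r0 n)) < 1/16"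
      using infinite_enumerate by blast
    have "\<exists>e\<in>span B. \<nu> (x (r0 n) - e) < 1/16" for n
      using mod_gauge_approx[OF subspace_span r0(2)] by metis
    then obtain e where e: "\<And>n. e n \<in> span B" "\<And>n. \<nu> (x (r0 n) - e n) < 1/16" by metis
    have e2: "\<nu> (e n) \<le> 2" for n
      using triangle_rev[of "e n" "x (r0 n)"] commute[of "e n" "x (r0 n)"] e(2)[of n] x(1)[of "r0 n"] by linarith
    obtain r1 y where r1: "strict_mono r1" "(\<lambda>n. \<nu> (e (r1 n) - y)) \<longlonglongrightarrow> 0"
      using bounded_compactD[OF bounded_compact_span[OF B] e(1) e2] .
    have "1/16 > (0::real)" by simp
    from order_tendstoD(2)[OF r1(2) this] obtain n where n: "\<And>m. m \<ge> n \<Longrightarrow> \<nu> (e (r1 m) - y) < 1/16"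
      unfolding eventually_sequentially by blast
    define a b where "a = r1 n" and "b = r1 (Suc n)"
    have ab: "r0 a < r0 b" using r0(1) r1(1) by (simp add: a_def b_def strict_mono_def)
    have "\<nu> (x (r0 b) - x (r0 a)) \<le> \<nu> (x (r0 b) - e b) + (\<nu> (e b - y) + (\<nu> (y - e a) + \<nu> (e a - x (r0 a))))"
      using triangle3[of "x (r0 b)" "x (r0 a)" "e b"] triangle3[of "e b" "x (r0 a)" y]
        triangle3[of y "x (r0 a)" "e a"] by linarith
    then show False
      using sep[OF ab] e(2)[of a] e(2)[of b] n[of n] n[of "Suc n"] commute[of y "e a"] commute[of "e a" "x (r0 a)"]
      by (simp add: a_def b_def)
  qed
  then show thesis using that[of x] x(1) by simp
qed

end

section \<open>Representations by molecules\<close>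

declare Poly_Mapping.single_one [simp del] \<comment> \<open>it would turn \<open>pt 0\<close> into \<open>1\<close>\<close>

type_synonym 'x molecule = "real \<times> 'x \<times> 'x"

definition chain :: "'x molecule list \<Rightarrow> 'x \<Rightarrow>\<^sub>0 real" where
  "chain xs = (\<Sum>(c, x, y)\<leftarrow>xs. c *\<^sub>R (pt x - pt y))"

lemma chain_Nil [simp]: "chain [] = 0"
  and chain_Cons: "chain ((c, x, y) # xs) = c *\<^sub>R (pt x - pt y) + chain xs"
  and chain_append: "chain (xs @ ys) = chain xs + chain ys"
  by (simp_all add: chain_def)

lemma chain_scale: "chain (map (\<lambda>(c, xy). (r * c, xy)) xs) = r *\<^sub>R chain xs"
  by (induction xs) (auto simp: chain_Cons scaleR_add_right)

lemma chain_partition: "chain (filter P xs) + chain (filter (\<lambda>z. \<not> P z) xs) = chain xs"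
  by (induction xs) (auto simp: chain_Cons)

lemma keys_chain: "Poly_Mapping.keys (chain xs) \<subseteq> (\<Union>(c, x, y)\<in>set xs. {x, y})"
proof (induction xs)
  case (Cons z xs)
  obtain c x y where z: "z = (c, x, y)" by (cases z)
  have "Poly_Mapping.keys (c *\<^sub>R (pt x - pt y)) \<subseteq> {x, y}"
    by (auto simp: in_keys_iff lookup_scaleR lookup_minus lookup_single when_def split: if_splits)
  then show ?case using Cons Poly_Mapping.keys_add[of "c *\<^sub>R (pt x - pt y)" "chain xs"]
    by (auto simp: z chain_Cons)
qed simp

context gauge
begin

text \<open>The \<open>q\<close>-th power of |c| times the distance from \<open>x\<close> to
  \<open>y\<close>; hence \<open>cost t\<close> adds up powers of exponent \<open>q * t\<close> of
  the sizes of the molecules.\<close>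

definition weight :: "'v molecule \<Rightarrow> real" where
  "weight = (\<lambda>(c, x, y). \<bar>c\<bar> powr q * \<nu> (x - y))"

definition cost :: "real \<Rightarrow> 'v molecule list \<Rightarrow> real" where
  "cost t xs = (\<Sum>z\<leftarrow>xs. weight z powr t)"

lemma weight_nonneg [simp]: "0 \<le> weight z"
  by (cases z) (simp add: weight_def)

lemma cost_nonneg [simp]: "0 \<le> cost t xs"
  unfolding cost_def by (intro sum_list_nonneg) auto

lemma cost_Nil [simp]: "cost t [] = 0"
  and cost_append: "cost t (xs @ ys) = cost t xs + cost t ys"
  and cost_Cons: "cost t (z # xs) = weight z powr t + cost t xs"
  by (simp_all add: cost_def)

lemma cost_scale: "cost t (map (\<lambda>(c, xy). (r * c, xy)) xs) = \<bar>r\<bar> powr (q * t) * cost t xs"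
  by (induction xs) (auto simp: cost_Cons weight_def abs_mult powr_mult powr_powr algebra_simps)

text \<open>The base point is divided out because \<open>\<delta> 0 = 0\<close>.\<close>

definition rep_gauge :: "real \<Rightarrow> ('v \<Rightarrow>\<^sub>0 real) \<Rightarrow> real" where
  "rep_gauge t a = Inf {cost t xs | xs r. a = chain xs + r *\<^sub>R pt 0}"

lemma rep_gauge_le: "a = chain xs + r *\<^sub>R pt 0 \<Longrightarrow> rep_gauge t a \<le> cost t xs"
  unfolding rep_gauge_def by (rule cInf_lower) (auto intro: bdd_belowI[of _ 0])

text \<open>Every point is joined to the base point, and the total mass is left over as a multiple
  of \<open>pt 0\<close>.\<close>

lemma rep_exists: "\<exists>xs r. (a :: 'v \<Rightarrow>\<^sub>0 real) = chain xs + r *\<^sub>R pt 0"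
proof -
  obtain ks where ks: "set ks = Poly_Mapping.keys a" "distinct ks"
    using finite_distinct_list[of "Poly_Mapping.keys a"] by auto
  define xs where "xs = map (\<lambda>x. (Poly_Mapping.lookup a x, x, 0 :: 'v)) ks"
  define r where "r = (\<Sum>x\<in>Poly_Mapping.keys a. Poly_Mapping.lookup a x)"
  have "chain xs = (\<Sum>x\<in>Poly_Mapping.keys a. Poly_Mapping.lookup a x *\<^sub>R (pt x - pt 0))"
    using ks by (simp add: chain_def xs_def o_def sum_list_distinct_conv_sum_set)
  also have "\<dots> = a - r *\<^sub>R pt 0"
    by (simp add: scaleR_diff_right sum_subtractf poly_mapping_expand[symmetric] r_def scaleR_sum_left)
  finally show ?thesis by (metis add.commute diff_add_cancel)
qed

lemma rep_gauge_approx: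
  assumes "\<epsilon> > 0"
  obtains xs r where "a = chain xs + r *\<^sub>R pt 0" "cost t xs < rep_gauge t a + \<epsilon>"
proof -
  have "{cost t xs | xs r. a = chain xs + r *\<^sub>R pt 0} \<noteq> {}" using rep_exists[of a] by blast
  moreover have "rep_gauge t a < rep_gauge t a + \<epsilon>" using assms by simp
  ultimately obtain c where "c \<in> {cost t xs | xs r. a = chain xs + r *\<^sub>R pt 0}" "c < rep_gauge t a + \<epsilon>"
    unfolding rep_gauge_def using cInf_lessD by meson
  then show thesis using that by blast
qed

lemma gauge_rep_gauge:
  assumes t: "0 < t"
  shows "gauge (rep_gauge t) (q * t)"
proof (rule gaugeI_le)
  fix a b :: "'v \<Rightarrow>\<^sub>0 real" and c :: real
  show "0 < q * t" using q_pos t by simp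
  have nn: "0 \<le> rep_gauge t a" for a
    unfolding rep_gauge_def using rep_exists[of a] by (intro cInf_greatest) auto
  show "0 \<le> rep_gauge t a" by (rule nn)
  show "rep_gauge t (a + b) \<le> rep_gauge t a + rep_gauge t b"
  proof (rule field_le_epsilon)
    fix \<epsilon> :: real assume e: "\<epsilon> > 0"
    then have e2: "\<epsilon>/2 > 0" by simp
    obtain xs r where x: "a = chain xs + r *\<^sub>R pt 0" "cost t xs < rep_gauge t a + \<epsilon>/2"
      using rep_gauge_approx[OF e2] .
    obtain ys u where y: "b = chain ys + u *\<^sub>R pt 0" "cost t ys < rep_gauge t b + \<epsilon>/2"
      using rep_gauge_approx[OF e2] .
    have "rep_gauge t (a + b) \<le> cost t (xs @ ys)"
      by (rule rep_gauge_le[of _ _ "r + u"]) (simp add: x y chain_append scaleR_add_left)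
    then show "rep_gauge t (a + b) \<le> rep_gauge t a + rep_gauge t b + \<epsilon>" using x y by (simp add: cost_append)
  qed
  show "rep_gauge t (c *\<^sub>R a) \<le> \<bar>c\<bar> powr (q * t) * rep_gauge t a"
  proof (rule field_le_epsilon)
    fix \<epsilon> :: real assume e: "\<epsilon> > 0"
    define k where "k = \<bar>c\<bar> powr (q * t) + 1"
    have k: "k > 0" by (simp add: k_def add_nonneg_pos)
    then have "\<epsilon> / k > 0" using e by simp
    from rep_gauge_approx[OF this] obtain xs r where
      x: "a = chain xs + r *\<^sub>R pt 0" "cost t xs < rep_gauge t a + \<epsilon> / k" .
    have "rep_gauge t (c *\<^sub>R a) \<le> cost t (map (\<lambda>(d, xy). (c * d, xy)) xs)"
      by (rule rep_gauge_le[of _ _ "c * r"]) (simp add: x chain_scale scaleR_add_right)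
    also have "\<dots> = \<bar>c\<bar> powr (q * t) * cost t xs" by (rule cost_scale)
    also have "\<dots> \<le> \<bar>c\<bar> powr (q * t) * (rep_gauge t a + \<epsilon> / k)"
      using x by (intro mult_left_mono) auto
    also have "\<dots> \<le> \<bar>c\<bar> powr (q * t) * rep_gauge t a + \<epsilon>"
      using e k by (simp add: distrib_left k_def field_simps)
    finally show "rep_gauge t (c *\<^sub>R a) \<le> \<bar>c\<bar> powr (q * t) * rep_gauge t a + \<epsilon>" .
  qed
qed

end

text \<open>
  A \<open>p\<close>-Banach space \<open>F\<close> with a map \<open>D\<close> of dense span and the universal property of the free space in
  the form of a bound for gauges on formal sums; \<open>\<nu>\<close> is the \<open>q\<close>-th power of the norm of \<open>X\<close>.
\<close>

locale free_gauge = gauge \<nu> q for \<nu> :: "'x::real_vector \<Rightarrow> real" and q :: real +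
  fixes p :: real and F :: "'f::real_vector set" and NF :: "'f \<Rightarrow> real" and D :: "'x \<Rightarrow> 'f"
  assumes p: "0 < p" "p < q"
    and F: "s_Banach p F NF"
    and D: "D x \<in> F" "D 0 = 0"
    and dense: "v \<in> F \<Longrightarrow> 0 < e \<Longrightarrow> \<exists>a. NF (v - lin_ext D a) < e"
    and gauge_bound: "gauge R p \<Longrightarrow> 0 \<le> B \<Longrightarrow> (\<And>x y. R (pt x - pt y) \<le> B * \<nu> (x - y) powr (p / q)) \<Longrightarrow>
      R (pt 0) = 0 \<Longrightarrow> R a \<le> B * NF (lin_ext D a) powr p"
begin

lemma subF: "subspace F" by (rule s_BanachD(3)[OF F])

lemma lin_ext_D: "lin_ext D a \<in> F"
  by (rule lin_ext_in_subspace[OF subF D(1)])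

lemma NF_triangle: "u \<in> F \<Longrightarrow> v \<in> F \<Longrightarrow> NF (u + v) powr p \<le> NF u powr p + NF v powr p"
  by (rule s_BanachD(7)[OF F])

lemma NF_sum: "finite I \<Longrightarrow> (\<And>i. i \<in> I \<Longrightarrow> v i \<in> F) \<Longrightarrow> NF (\<Sum>i\<in>I. v i) powr p \<le> (\<Sum>i\<in>I. NF (v i) powr p)"
proof (induction I rule: finite_induct)
  case empty
  have "NF 0 = 0" using s_BanachD(5)[OF F, of 0] subF by (simp add: subspace_0)
  then show ?case by simp
next
  case (insert i I)
  then have "(\<Sum>i\<in>I. v i) \<in> F" using subF by (simp add: subspace_sum)
  then show ?case using insert NF_triangle[of "v i" "\<Sum>i\<in>I. v i"] by simp
qed

text \<open>The gauge of cheapest representations satisfies the hypotheses of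
  \<open>gauge_bound\<close> with constant 1. Half of the excess cost comes from approximating
  \<open>v\<close> by a formal sum, half from a nearly optimal representation of that sum.\<close>

lemma representation:
  assumes v: "v \<in> F" and e: "\<epsilon> > 0"
  obtains xs where "cost (p / q) xs \<le> NF v powr p + \<epsilon>" "NF (v - lin_ext D (chain xs)) powr p \<le> \<epsilon>"
proof -
  have "(\<epsilon>/2) powr (1/p) > 0" using e by simp
  from dense[OF v this] obtain a where a: "NF (v - lin_ext D a) < (\<epsilon>/2) powr (1/p)" by blast
  have d: "v - lin_ext D a \<in> F" "lin_ext D a - v \<in> F" using v lin_ext_D subF by (auto intro: subspace_diff)
  have "NF (v - lin_ext D a) powr p \<le> ((\<epsilon>/2) powr (1/p)) powr p"
    using a p s_BanachD(4)[OF F d(1)] by (intro powr_mono2) auto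
  then have a1: "NF (v - lin_ext D a) powr p \<le> \<epsilon>/2" using e p by (simp add: powr_powr)
  have "NF (v + (lin_ext D a - v)) powr p \<le> NF v powr p + NF (lin_ext D a - v) powr p"
    by (rule NF_triangle[OF v d(2)])
  then have a2: "NF (lin_ext D a) powr p \<le> NF v powr p + \<epsilon>/2"
    using a1 norm_minus_commute_on[OF F v lin_ext_D, of a] by simp
  have pq: "0 < p / q" "q * (p / q) = p" using p q_pos by auto
  have "rep_gauge (p / q) a \<le> 1 * NF (lin_ext D a) powr p"
  proof (rule gauge_bound)
    show "gauge (rep_gauge (p / q)) p" using gauge_rep_gauge[OF pq(1)] pq(2) by simp
    show "rep_gauge (p / q) (pt x - pt y) \<le> 1 * \<nu> (x - y) powr (p / q)" for x y
      using rep_gauge_le[of "pt x - pt y" "[(1, x, y)]" 0 "p / q"] by (simp add: chain_Cons cost_Cons weight_def)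
    have "rep_gauge (p / q) (pt 0) \<le> 0"
      using rep_gauge_le[of "pt 0" "[]" 1 "p / q"] by simp
    then show "rep_gauge (p / q) (pt 0) = 0"
      using gauge.nonneg[OF gauge_rep_gauge[OF pq(1)], of "pt 0"] by simp
  qed simp
  moreover have "\<epsilon>/2 > 0" using e by simp
  from rep_gauge_approx[OF this] obtain xs r where
    xs: "a = chain xs + r *\<^sub>R pt 0" "cost (p / q) xs < rep_gauge (p / q) a + \<epsilon>/2" .
  moreover have "lin_ext D (chain xs) = lin_ext D a" by (simp add: xs(1) lin_ext_simps D)
  ultimately show thesis using a1 a2 e by (intro that[of xs]) auto
qed

end

section \<open>Averages of step functions\<close>

text \<open>Dependence on \<open>u\<close> only through which of finitely many thresholds it has
  reached. The codomain is arbitrary, so vector-valued intermediate results need no measurability;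
  only the final real values are integrated.\<close>

definition step :: "(real \<Rightarrow> 'b) \<Rightarrow> bool" where
  "step \<phi> \<longleftrightarrow> (\<exists>T. finite T \<and> (\<forall>u u'. {t\<in>T. t \<le> u} = {t\<in>T. t \<le> u'} \<longrightarrow> \<phi> u = \<phi> u'))"

definition step2 :: "(real \<Rightarrow> real \<Rightarrow> 'b) \<Rightarrow> bool" where
  "step2 \<psi> \<longleftrightarrow> (\<exists>T. finite T \<and> (\<forall>u u' v v'. {t\<in>T. t \<le> u} = {t\<in>T. t \<le> u'} \<longrightarrow>
     {t\<in>T. t \<le> v} = {t\<in>T. t \<le> v'} \<longrightarrow> \<psi> u v = \<psi> u' v'))"

abbreviation unit_measure :: "real measure" where
  "unit_measure \<equiv> lebesgue_on {0..1}"

definition mean :: "(real \<Rightarrow> real) \<Rightarrow> real" where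
  "mean \<phi> = integral\<^sup>L unit_measure \<phi>"

definition mean2 :: "(real \<Rightarrow> real \<Rightarrow> real) \<Rightarrow> real" where
  "mean2 \<psi> = mean (\<lambda>u. mean (\<psi> u))"

lemma step_factor:
  assumes "finite T" "\<And>u u'. {t\<in>T. t \<le> u} = {t\<in>T. t \<le> u'} \<Longrightarrow> \<phi> u = \<phi> u'"
  shows "\<exists>\<Phi>. \<phi> = (\<lambda>u. \<Phi> {t\<in>T. t \<le> u})"
proof
  show "\<phi> = (\<lambda>u. (\<lambda>S. \<phi> (SOME u'. {t\<in>T. t \<le> u'} = S)) {t\<in>T. t \<le> u})"
  proof
    fix u
    have "{t\<in>T. t \<le> (SOME u'. {t\<in>T. t \<le> u'} = {t\<in>T. t \<le> u})} = {t\<in>T. t \<le> u}"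
      by (rule someI[of "\<lambda>u'. {t\<in>T. t \<le> u'} = {t\<in>T. t \<le> u}" u]) simp
    from assms(2)[OF this]
    show "\<phi> u = (\<lambda>S. \<phi> (SOME u'. {t\<in>T. t \<le> u'} = S)) {t\<in>T. t \<le> u}" by simp
  qed
qed

lemma measurable_thresholds:
  fixes \<Phi> :: "real set \<Rightarrow> real"
  assumes "finite T"
  shows "(\<lambda>u. \<Phi> {t\<in>T. t \<le> u}) \<in> borel_measurable borel"
  using assms
proof (induction T arbitrary: \<Phi> rule: finite_induct)
  case (insert s T)
  have "(\<lambda>u. \<Phi> {t\<in>insert s T. t \<le> u}) =
      (\<lambda>u. if s \<le> u then \<Phi> (insert s {t\<in>T. t \<le> u}) else \<Phi> {t\<in>T. t \<le> u})"
    by (auto simp: fun_eq_iff intro!: arg_cong[of _ _ \<Phi>])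
  moreover have "\<dots> \<in> borel_measurable borel"
    using insert.IH[of "\<lambda>S. \<Phi> (insert s S)"] insert.IH[of \<Phi>] by measurable
  ultimately show ?case by simp
qed simp

lemma finite_measure_unit: "finite_measure unit_measure"
  by (rule finite_measure_lebesgue_on) auto

lemma measure_unit [simp]: "measure unit_measure {0..1} = 1" "measure unit_measure (space unit_measure) = 1"
  by (simp_all add: measure_restrict_space)

lemma step_integrable:
  fixes \<phi> :: "real \<Rightarrow> real"
  assumes "step \<phi>"
  shows "integrable unit_measure \<phi>"
proof -
  obtain T where T: "finite T" "\<And>u u'. {t\<in>T. t \<le> u} = {t\<in>T. t \<le> u'} \<Longrightarrow> \<phi> u = \<phi> u'"
    using assms unfolding step_def by blast
  obtain \<Phi> where \<Phi>: "\<phi> = (\<lambda>u. \<Phi> {t\<in>T. t \<le> u})" using step_factor[of T \<phi>, OF T] by blast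
  define B where "B = Max ((\<lambda>S. \<bar>\<Phi> S\<bar>) ` Pow T)"
  interpret finite_measure unit_measure by (rule finite_measure_unit)
  show ?thesis
  proof (rule integrable_const_bound)
    show "AE u in unit_measure. norm (\<phi> u) \<le> B"
      unfolding \<Phi> B_def using T(1) by (intro AE_I2) (auto intro!: Max_ge)
    have "\<phi> \<in> borel_measurable borel" unfolding \<Phi> using T(1) by (rule measurable_thresholds)
    then have "\<phi> \<in> borel_measurable lborel" by simp
    then have "\<phi> \<in> borel_measurable lebesgue" by (rule measurable_completion)
    then show "\<phi> \<in> borel_measurable unit_measure" by (rule measurable_restrict_space1)
  qed
qed

lemma step_const: "step (\<lambda>_. c)"
  unfolding step_def by (intro exI[of _ "{}"]) simp

lemma step2_const: "step2 (\<lambda>_ _. c)"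
  unfolding step2_def by (intro exI[of _ "{}"]) simp

lemma step2_threshold1: "step2 (\<lambda>u v. t \<le> u)"
  unfolding step2_def by (intro exI[of _ "{t}"]) (auto split: if_splits)

lemma step2_threshold2: "step2 (\<lambda>u v. t \<le> v)"
  unfolding step2_def by (intro exI[of _ "{t}"]) auto

lemma step2_comp2:
  assumes "step2 \<phi>" "step2 \<psi>"
  shows "step2 (\<lambda>u v. G (\<phi> u v) (\<psi> u v))"
proof -
  obtain S where S: "finite S" "\<And>u u' v v'. {t\<in>S. t \<le> u} = {t\<in>S. t \<le> u'} \<Longrightarrow>
     {t\<in>S. t \<le> v} = {t\<in>S. t \<le> v'} \<Longrightarrow> \<phi> u v = \<phi> u' v'" using assms(1) unfolding step2_def by metis
  obtain T where T: "finite T" "\<And>u u' v v'. {t\<in>T. t \<le> u} = {t\<in>T. t \<le> u'} \<Longrightarrow>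
     {t\<in>T. t \<le> v} = {t\<in>T. t \<le> v'} \<Longrightarrow> \<psi> u v = \<psi> u' v'" using assms(2) unfolding step2_def by metis
  have r: "{t\<in>S. t \<le> u} = {t\<in>S. t \<le> u'} \<and> {t\<in>T. t \<le> u} = {t\<in>T. t \<le> u'}"
    if "{t\<in>S \<union> T. t \<le> u} = {t\<in>S \<union> T. t \<le> u'}" for u u' using that by blast
  show ?thesis unfolding step2_def
    by (intro exI[of _ "S \<union> T"]) (metis (no_types, lifting) r S T finite_Un)
qed

lemma step2_comp: "step2 \<phi> \<Longrightarrow> step2 (\<lambda>u v. G (\<phi> u v))"
  unfolding step2_def by metis

lemma step2_sum: "(\<And>i. i \<in> I \<Longrightarrow> step2 (\<phi> i)) \<Longrightarrow> step2 (\<lambda>u v. \<Sum>i\<in>I. \<phi> i u v)"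
  by (induction I rule: infinite_finite_induct) (auto intro: step2_const step2_comp2)

lemma step2_left: "step2 \<psi> \<Longrightarrow> step (\<psi> u)"
  unfolding step_def step2_def by metis

lemma step2_mean: 
  assumes "step2 \<psi>" shows "step (\<lambda>u. mean (\<psi> u))"
proof -
  obtain T where T: "finite T" "\<And>u u' v v'. {t\<in>T. t \<le> u} = {t\<in>T. t \<le> u'} \<Longrightarrow>
     {t\<in>T. t \<le> v} = {t\<in>T. t \<le> v'} \<Longrightarrow> \<psi> u v = \<psi> u' v'" using assms unfolding step2_def by metis
  have "\<psi> u = \<psi> u'" if "{t\<in>T. t \<le> u} = {t\<in>T. t \<le> u'}" for u u'
    using T(2)[OF that refl] by (rule ext)
  then show ?thesis unfolding step_def using T(1) by metis
qed

lemma mean_const [simp]: "mean (\<lambda>_. c) = c"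
  by (simp add: mean_def)

lemma mean_add: "step \<phi> \<Longrightarrow> step \<psi> \<Longrightarrow> mean (\<lambda>u. \<phi> u + \<psi> u) = mean \<phi> + mean \<psi>"
  by (simp add: mean_def step_integrable)

lemma mean_cmult: "mean (\<lambda>u. c * \<phi> u) = c * mean \<phi>"
  by (simp add: mean_def)

lemma mean_mono: "step \<phi> \<Longrightarrow> step \<psi> \<Longrightarrow> (\<And>u. 0 \<le> u \<Longrightarrow> u \<le> 1 \<Longrightarrow> \<phi> u \<le> \<psi> u) \<Longrightarrow> mean \<phi> \<le> mean \<psi>"
  unfolding mean_def by (intro integral_mono step_integrable) auto

text \<open>A step function has finitely many values, and the smallest of them does not exceed the
  mean.\<close>

lemma mean_attained:
  assumes "step \<phi>"
  obtains u where "0 \<le> u" "u \<le> 1" "\<phi> u \<le> mean \<phi>"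
proof -
  obtain T where T: "finite T" "\<And>u u'. {t\<in>T. t \<le> u} = {t\<in>T. t \<le> u'} \<Longrightarrow> \<phi> u = \<phi> u'"
    using assms unfolding step_def by blast
  obtain \<Phi> where \<Phi>: "\<phi> = (\<lambda>u. \<Phi> {t\<in>T. t \<le> u})" using step_factor[of T \<phi>, OF T] by blast
  have "finite (\<phi> ` {0..1})"
    by (rule finite_subset[of _ "\<Phi> ` Pow T"]) (use T(1) in \<open>auto simp: \<Phi>\<close>)
  then have "Min (\<phi> ` {0..1}) \<in> \<phi> ` {0..1}" "\<And>u. u \<in> {0..1} \<Longrightarrow> Min (\<phi> ` {0..1}) \<le> \<phi> u"
    by (auto intro!: Min_in)
  then obtain u where u: "u \<in> {0..1}" "\<And>u'. u' \<in> {0..1} \<Longrightarrow> \<phi> u \<le> \<phi> u'" by (metis image_iff)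
  have "mean (\<lambda>_. \<phi> u) \<le> mean \<phi>" using u by (intro mean_mono step_const assms) auto
  then show thesis using u that by auto
qed

lemma mean2_const [simp]: "mean2 (\<lambda>_ _. c) = c"
  by (simp add: mean2_def)

lemma mean2_left: "mean2 (\<lambda>u v. \<phi> u) = mean \<phi>"
  by (simp add: mean2_def)

lemma mean2_right: "mean2 (\<lambda>u v. \<phi> v) = mean \<phi>"
  by (simp add: mean2_def)

lemma mean2_add: "step2 \<phi> \<Longrightarrow> step2 \<psi> \<Longrightarrow> mean2 (\<lambda>u v. \<phi> u v + \<psi> u v) = mean2 \<phi> + mean2 \<psi>"
  by (simp add: mean2_def mean_add step2_left step2_mean)

lemma mean2_cmult: "mean2 (\<lambda>u v. c * \<phi> u v) = c * mean2 \<phi>"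
  by (simp add: mean2_def mean_cmult)

lemma mean2_mono:
  assumes "step2 \<phi>" "step2 \<psi>"
    and "\<And>u v. 0 \<le> u \<Longrightarrow> u \<le> 1 \<Longrightarrow> 0 \<le> v \<Longrightarrow> v \<le> 1 \<Longrightarrow> \<phi> u v \<le> \<psi> u v"
  shows "mean2 \<phi> \<le> mean2 \<psi>"
  unfolding mean2_def using assms by (intro mean_mono step2_mean step2_left) auto

lemma mean2_nonneg:
  "step2 \<phi> \<Longrightarrow> (\<And>u v. 0 \<le> \<phi> u v) \<Longrightarrow> 0 \<le> mean2 \<phi>"
  using mean2_mono[OF step2_const[of 0], of \<phi>] by simp

text \<open>The two tests disagree exactly on the half-open interval between \<open>a\<close> and
  \<open>b\<close>.\<close>

lemma mean_crossing:
  "mean (\<lambda>u. if (a \<le> u) \<noteq> (b \<le> u) then 1 else 0) \<le> min 1 \<bar>a - b\<bar>"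
proof -
  let ?I = "{min a b..<max a b}"
  have eq: "(\<lambda>u. if (a \<le> u) \<noteq> (b \<le> u) then 1 else 0) = (indicator ?I :: real \<Rightarrow> real)"
    by (auto simp: fun_eq_iff indicator_def min_def max_def)
  have "mean (indicator ?I) = measure unit_measure (?I \<inter> {0..1})"
    by (simp add: mean_def)
  also have "\<dots> = measure lebesgue (?I \<inter> {0..1})"
    by (simp add: measure_restrict_space)
  finally have m: "mean (indicator ?I) = measure lebesgue (?I \<inter> {0..1})" .
  have "measure lebesgue (?I \<inter> {0..1}) \<le> measure lebesgue {0..1::real}"
    by (rule measure_mono_fmeasurable) auto
  moreover have "measure lebesgue (?I \<inter> {0..1}) \<le> measure lebesgue {min a b..max a b}"
    by (rule measure_mono_fmeasurable) auto
  ultimately show ?thesis unfolding eq m by (auto simp: min_def max_def split: if_splits)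
qed

section \<open>Random cuts of a Lipschitz map\<close>

text \<open>
  The thresholds are random: \<open>u\<close> and \<open>v\<close> are averaged over the unit interval.  For \<open>q < 1\<close> there may be no
  nonconstant Lipschitz functions into the reals, hence no deterministic Lipschitz cutoff.
\<close>

definition cut :: "('x \<Rightarrow> real) \<Rightarrow> real \<Rightarrow> real \<Rightarrow> 'x \<Rightarrow> real" where
  "cut h r u x = (if h x \<le> r * (1 + u) then 1 else 0)"

text \<open>The part of \<open>f\<close> between two random level sets of \<open>h\<close>, with a
  minus sign if the second is the outer one; the factor with \<open>k\<close> localizes it further.
  The two cuts of \<open>h\<close> use independent thresholds because \<open>scale_detection\<close>
  also needs \<open>r = r'\<close>, where equal thresholds would give 0.\<close>

definition piece :: "('x \<Rightarrow> 'v::real_vector) \<Rightarrow> ('x \<Rightarrow> real) \<Rightarrow> ('x \<Rightarrow> real) \<Rightarrow> real \<Rightarrow> real \<Rightarrow> real \<Rightarrow>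
    real \<Rightarrow> real \<Rightarrow> 'x \<Rightarrow> 'v" where
  "piece f h k r r' s u v x = (cut k s u x * (cut h r u x - cut h r' v x)) *\<^sub>R f x"

lemma threshold_iff: "0 < r \<Longrightarrow> (h x \<le> r * (1 + u)) = (h x / r - 1 \<le> u)" for r :: real
  by (auto simp: field_simps)

lemma step2_cut1: "0 < r \<Longrightarrow> step2 (\<lambda>u v. cut h r u x)"
  unfolding cut_def threshold_iff by (rule step2_comp[OF step2_threshold1])

lemma step2_cut2: "0 < r \<Longrightarrow> step2 (\<lambda>u v. cut h r v x)"
  unfolding cut_def threshold_iff by (rule step2_comp[OF step2_threshold2])

lemma step2_piece:
  assumes "0 < r" "0 < r'" "0 < s"
  shows "step2 (\<lambda>u v. piece f h k r r' s u v x)"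
  unfolding piece_def
  by (intro step2_comp[where G = "\<lambda>c. c *\<^sub>R f x"] step2_comp2[where G = "(*)"] step2_comp2[where G = "(-)"]
      step2_cut1 step2_cut2 assms)

lemma step2_lin_ext:
  assumes "\<And>x. step2 (\<lambda>u v. G u v x)"
  shows "step2 (\<lambda>u v. lin_ext (G u v) a)"
  unfolding lin_ext_def
  by (intro step2_sum step2_comp[where G = "\<lambda>w. _ *\<^sub>R w"] assms)

text \<open>For \<open>\<rho> \<ge> r\<close> the bound \<open>m \<le> 1\<close> suffices. Otherwise
  \<rho> / r is at most 1, so lowering its exponent to \<alpha> only enlarges it, and then the
  powers of \<open>r\<close> cancel.\<close>

lemma crossing_cost:
  fixes r \<rho> b m \<alpha> :: real
  assumes "0 < r" "0 \<le> \<rho>" "1 \<le> b" "0 < \<alpha>" "\<alpha> \<le> 1" "0 \<le> m" "m \<le> 1" "m \<le> b * \<rho> / r"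
  shows "r powr \<alpha> * m \<le> b * \<rho> powr \<alpha>"
proof (cases "\<rho> \<ge> r")
  case True
  have "r powr \<alpha> * m \<le> \<rho> powr \<alpha> * 1" using assms True by (intro mult_mono powr_mono2) auto
  also have "\<dots> \<le> b * \<rho> powr \<alpha>" using assms mult_right_mono[of 1 b "\<rho> powr \<alpha>"] by simp
  finally show ?thesis .
next
  case False
  then have "\<rho> / r \<le> 1" "0 \<le> \<rho> / r" using assms by auto
  then have "\<rho> / r \<le> (\<rho> / r) powr \<alpha>" using powr_mono'[of \<alpha> 1 "\<rho> / r"] assms by simp
  then have "b * \<rho> / r \<le> b * (\<rho> / r) powr \<alpha>"
    using assms mult_left_mono[of "\<rho> / r" "(\<rho> / r) powr \<alpha>" b] by simp
  then have "m \<le> b * (\<rho> / r) powr \<alpha>" using assms by linarith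
  then have "r powr \<alpha> * m \<le> r powr \<alpha> * (b * (\<rho> / r) powr \<alpha>)" using assms by (intro mult_left_mono) auto
  also have "\<dots> = b * \<rho> powr \<alpha>" using assms by (simp add: powr_divide)
  finally show ?thesis .
qed

lemma mean_cut_crossing:
  assumes "0 < r" "\<bar>h x - h y\<bar> \<le> \<rho>"
  shows "mean (\<lambda>u. if (h x \<le> r * (1 + u)) \<noteq> (h y \<le> r * (1 + u)) then 1 else 0) \<le> 1" (is "?m \<le> 1")
    and "mean (\<lambda>u. if (h x \<le> r * (1 + u)) \<noteq> (h y \<le> r * (1 + u)) then 1 else 0) \<le> \<rho> / r"
proof -
  have "?m \<le> min 1 \<bar>(h x / r - 1) - (h y / r - 1)\<bar>"
    unfolding threshold_iff[OF assms(1)] by (rule mean_crossing)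
  moreover have "\<bar>(h x / r - 1) - (h y / r - 1)\<bar> = \<bar>h x - h y\<bar> / r"
    using assms by (simp add: diff_divide_distrib[symmetric] abs_divide)
  moreover have "\<bar>h x - h y\<bar> / r \<le> \<rho> / r" using assms by (simp add: divide_right_mono)
  ultimately show "?m \<le> 1" "?m \<le> \<rho> / r" by auto
qed

text \<open>The factor 2 stands for the two cut-offs that make up a piece. In each,
  \<open>L powr \<alpha>\<close> pays for two retained points, and
  \<open>(2 * L) powr \<alpha>\<close> for a retained point separated from the other one: once
  through \<open>h\<close> and \<open>b\<close> times through \<open>k\<close>.\<close>

definition piece_const :: "real \<Rightarrow> real \<Rightarrow> real \<Rightarrow> real" where
  "piece_const L b \<alpha> = 2 * (L powr \<alpha> + (2 * L) powr \<alpha> * (1 + b))"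

lemma piece_const_nonneg: "0 \<le> b \<Longrightarrow> 0 \<le> piece_const L b \<alpha>"
  by (simp add: piece_const_def)

text \<open>
  A random threshold separates two points at distance \<open>\<rho>\<close> with probability at most \<open>\<rho> / r\<close>, and then costs at most
  \<open>(2 * L * r) powr \<alpha>\<close>.  As \<open>\<alpha> < 1\<close>, the expected cost is of order \<open>\<rho> powr \<alpha>\<close>, independently of the scale \<open>r\<close>.
\<close>

lemma (in gauge) half_piece_bound:
  fixes f :: "'x \<Rightarrow> 'v" and W :: "real \<Rightarrow> real \<Rightarrow> real"
  assumes \<alpha>: "0 < \<alpha>" "\<alpha> \<le> 1" and L: "0 \<le> L" and pos: "0 < r" "0 < s" and b: "1 \<le> b" and \<rho>: "0 \<le> \<rho>"
    and f: "\<nu> (f x - f y) \<le> L * \<rho>" "\<nu> (f x) \<le> L * h x" "\<nu> (f y) \<le> L * h y"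
    and h: "\<bar>h x - h y\<bar> \<le> \<rho>" and k: "\<bar>k x - k y\<bar> \<le> \<rho>"
    and rs: "k x = 0 \<and> k y = 0 \<or> r \<le> b * s"
    and W: "W = (\<lambda>u v. u) \<or> W = (\<lambda>u v. v)"
  shows "mean2 (\<lambda>u v. \<nu> ((cut k s u x * cut h r (W u v) x) *\<^sub>R f x - (cut k s u y * cut h r (W u v) y) *\<^sub>R f y) powr \<alpha>)
    \<le> (L powr \<alpha> + (2 * L) powr \<alpha> * (1 + b)) * \<rho> powr \<alpha>"
proof -
  define ck where "ck = (\<lambda>u. if (k x \<le> s * (1 + u)) \<noteq> (k y \<le> s * (1 + u)) then 1 else 0 :: real)"
  define ch where "ch = (\<lambda>u. if (h x \<le> r * (1 + u)) \<noteq> (h y \<le> r * (1 + u)) then 1 else 0 :: real)"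
  have st: "step2 (\<lambda>u v. ck u)" "step2 (\<lambda>u v. ch (W u v))"
  proof -
    let ?X = "\<lambda>a b. if a \<noteq> b then 1 else 0 :: real"
    show "step2 (\<lambda>u v. ck u)" unfolding ck_def threshold_iff[OF pos(2)]
      by (rule step2_comp2[where G = ?X, OF step2_threshold1 step2_threshold1])
    have "step2 (\<lambda>u v. ch u)" "step2 (\<lambda>u v. ch v)" unfolding ch_def threshold_iff[OF pos(1)]
      by (rule step2_comp2[where G = ?X, OF step2_threshold1 step2_threshold1]
          step2_comp2[where G = ?X, OF step2_threshold2 step2_threshold2])+
    then show "step2 (\<lambda>u v. ch (W u v))" using W by auto
  qed
  have stW: "step2 (\<lambda>u v. cut h r (W u v) z)" for z using W step2_cut1[OF pos(1)] step2_cut2[OF pos(1)] by auto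
  let ?\<phi> = "\<lambda>u v. \<nu> ((cut k s u x * cut h r (W u v) x) *\<^sub>R f x - (cut k s u y * cut h r (W u v) y) *\<^sub>R f y) powr \<alpha>"
  \<comment> \<open>If both points are retained, the Lipschitz bound applies. If just one is, some
    cut separates them, and the retained point has \<open>h z \<le> 2 * r\<close>, so its value
    costs at most \<open>2 * L * r\<close>.\<close>
  let ?\<psi> = "\<lambda>u v. (L * \<rho>) powr \<alpha> + (2 * L * r) powr \<alpha> * (ck u + ch (W u v))"
  have st\<phi>: "step2 ?\<phi>"
    by (intro step2_comp2[where G = "\<lambda>a b. \<nu> (a *\<^sub>R f x - b *\<^sub>R f y) powr \<alpha>"]
        step2_comp2[where G = "(*)"] stW step2_cut1 pos)
  have st\<psi>: "step2 ?\<psi>"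
    by (intro step2_comp2[where G = "\<lambda>a b. (L * \<rho>) powr \<alpha> + (2 * L * r) powr \<alpha> * (a + b)"] st)
  have "mean2 ?\<phi> \<le> mean2 ?\<psi>"
  proof (rule mean2_mono[OF st\<phi> st\<psi>])
    fix u v :: real assume uv: "0 \<le> u" "u \<le> 1" "0 \<le> v" "v \<le> 1"
    then have w: "W u v \<le> 1" using W by auto
    have rw: "r * (1 + W u v) \<le> 2 * r" using w pos by simp
    have big: "\<nu> (f z) powr \<alpha> \<le> (2 * L * r) powr \<alpha>" if "h z \<le> r * (1 + W u v)" "\<nu> (f z) \<le> L * h z" for z
    proof (rule powr_mono2)
      have "L * h z \<le> L * (2 * r)" using that rw L by (intro mult_left_mono) auto
      then show "\<nu> (f z) \<le> 2 * L * r" using that by simp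
    qed (use \<alpha> in auto)
    have close: "\<nu> (f x - f y) powr \<alpha> \<le> (L * \<rho>) powr \<alpha>"
      using f \<alpha> by (intro powr_mono2) auto
    have nn: "0 \<le> (L * \<rho>) powr \<alpha>" "0 \<le> (2 * L * r) powr \<alpha>" by auto
    show "?\<phi> u v \<le> ?\<psi> u v"
      using close big[of x] big[of y] f
      by (auto simp: cut_def ck_def ch_def split: if_splits) (use nn in linarith)+
  qed
  also have "mean2 ?\<psi> = (L * \<rho>) powr \<alpha> + (2 * L * r) powr \<alpha> * (mean ck + mean ch)"
  proof -
    have "mean2 (\<lambda>u v. ch (W u v)) = mean ch" using W mean2_left mean2_right by auto
    then have "mean2 (\<lambda>u v. ck u + ch (W u v)) = mean ck + mean ch"
      using mean2_add[OF st] by (simp add: mean2_left)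
    then show ?thesis
      using mean2_add[OF step2_const step2_comp[where G = "\<lambda>a. (2 * L * r) powr \<alpha> * a", OF step2_comp2[where G = "(+)", OF st]]]
      by (simp add: mean2_cmult)
  qed
  also have "\<dots> \<le> L powr \<alpha> * \<rho> powr \<alpha> + (2 * L) powr \<alpha> * (b * \<rho> powr \<alpha> + \<rho> powr \<alpha>)"
  proof -
    have nnm: "0 \<le> mean ck" "0 \<le> mean ch"
      using mean2_nonneg[OF st(1)] mean2_nonneg[OF st(2)] W
      by (auto simp: ck_def ch_def mean2_left mean2_right split: if_splits)
    have "r powr \<alpha> * mean ch \<le> 1 * \<rho> powr \<alpha>"
      using mean_cut_crossing[of r h x y \<rho>, OF pos(1) h] nnm pos \<rho> \<alpha> by (intro crossing_cost) (auto simp: ch_def)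
    moreover have "r powr \<alpha> * mean ck \<le> b * \<rho> powr \<alpha>"
    proof (rule crossing_cost)
      show "mean ck \<le> 1" unfolding ck_def by (rule mean_cut_crossing(1)[of s k x y \<rho>, OF pos(2) k])
      show "mean ck \<le> b * \<rho> / r"
      \<comment> \<open>Where \<open>k\<close> vanishes at both points it cannot separate them.
        Otherwise \<open>r \<le> b * s\<close> turns the crossing probability \<rho> / s into the
        required one.\<close>
      proof (cases "k x = 0 \<and> k y = 0")
        case True
        then show ?thesis using b \<rho> pos by (simp add: ck_def)
      next
        case False
        then have "r \<le> b * s" using rs by blast
        have "mean ck \<le> \<rho> / s" unfolding ck_def by (rule mean_cut_crossing(2)[of s k x y \<rho>, OF pos(2) k])
        also have "\<dots> \<le> b * \<rho> / r" using \<open>r \<le> b * s\<close> pos \<rho> b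
          by (simp add: field_simps) (metis mult.assoc mult.commute mult_left_mono)
        finally show ?thesis .
      qed
    qed (use pos \<rho> b \<alpha> nnm in auto)
    ultimately have "r powr \<alpha> * (mean ck + mean ch) \<le> b * \<rho> powr \<alpha> + \<rho> powr \<alpha>" by (simp add: distrib_left)
    then have "(2 * L) powr \<alpha> * (r powr \<alpha> * (mean ck + mean ch)) \<le> (2 * L) powr \<alpha> * (b * \<rho> powr \<alpha> + \<rho> powr \<alpha>)"
      by (intro mult_left_mono) auto
    then show ?thesis using L \<rho> pos by (simp add: powr_mult mult.assoc)
  qed
  also have "\<dots> = (L powr \<alpha> + (2 * L) powr \<alpha> * (1 + b)) * \<rho> powr \<alpha>" by (simp add: algebra_simps)
  finally show ?thesis .
qed

text \<open>A piece is the difference of two localized cut-offs of \<open>f\<close>, at the radii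
  \<open>r\<close> and \<open>r'\<close>, and \<open>half_piece_bound\<close> applies to
  each.\<close>

lemma (in gauge) piece_bound:
  fixes f :: "'x \<Rightarrow> 'v"
  assumes \<alpha>: "0 < \<alpha>" "\<alpha> \<le> 1" and L: "0 \<le> L" and pos: "0 < r" "0 < r'" "0 < s" and b: "1 \<le> b" and \<rho>: "0 \<le> \<rho>"
    and f: "\<nu> (f x - f y) \<le> L * \<rho>" "\<nu> (f x) \<le> L * h x" "\<nu> (f y) \<le> L * h y"
    and h: "\<bar>h x - h y\<bar> \<le> \<rho>" and k: "\<bar>k x - k y\<bar> \<le> \<rho>"
    and rs: "k x = 0 \<and> k y = 0 \<or> r \<le> b * s \<and> r' \<le> b * s"
  shows "mean2 (\<lambda>u v. \<nu> (piece f h k r r' s u v x - piece f h k r r' s u v y) powr \<alpha>) \<le> piece_const L b \<alpha> * \<rho> powr \<alpha>"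
proof -
  let ?G1 = "\<lambda>u v. (cut k s u x * cut h r u x) *\<^sub>R f x - (cut k s u y * cut h r u y) *\<^sub>R f y"
  let ?G2 = "\<lambda>u v. (cut k s u x * cut h r' v x) *\<^sub>R f x - (cut k s u y * cut h r' v y) *\<^sub>R f y"
  interpret a: gauge "\<lambda>x. \<nu> x powr \<alpha>" "q * \<alpha>" by (rule gauge_powr[OF gauge_axioms \<alpha>])
  have eq: "piece f h k r r' s u v x - piece f h k r r' s u v y = ?G1 u v - ?G2 u v" for u v
    by (simp add: piece_def algebra_simps)
  have s1: "step2 (\<lambda>u v. \<nu> (?G1 u v) powr \<alpha>)"
    by (intro step2_comp2[where G = "\<lambda>a b. \<nu> (a *\<^sub>R f x - b *\<^sub>R f y) powr \<alpha>"]
        step2_comp2[where G = "(*)"] step2_cut1 pos)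
  have s2: "step2 (\<lambda>u v. \<nu> (?G2 u v) powr \<alpha>)"
    by (intro step2_comp2[where G = "\<lambda>a b. \<nu> (a *\<^sub>R f x - b *\<^sub>R f y) powr \<alpha>"]
        step2_comp2[where G = "(*)"] step2_cut1 step2_cut2 pos)
  have "mean2 (\<lambda>u v. \<nu> (piece f h k r r' s u v x - piece f h k r r' s u v y) powr \<alpha>)
      \<le> mean2 (\<lambda>u v. \<nu> (?G1 u v) powr \<alpha> + \<nu> (?G2 u v) powr \<alpha>)"
    unfolding eq
  proof (rule mean2_mono)
    show "step2 (\<lambda>u v. \<nu> (?G1 u v - ?G2 u v) powr \<alpha>)"
      unfolding eq[symmetric]
      by (intro step2_comp2[where G = "\<lambda>a b. \<nu> (a - b) powr \<alpha>"] step2_piece pos)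
    show "step2 (\<lambda>u v. \<nu> (?G1 u v) powr \<alpha> + \<nu> (?G2 u v) powr \<alpha>)"
      by (rule step2_comp2[OF s1 s2])
  qed (rule a.triangle_diff)
  also have "\<dots> = mean2 (\<lambda>u v. \<nu> (?G1 u v) powr \<alpha>) + mean2 (\<lambda>u v. \<nu> (?G2 u v) powr \<alpha>)"
    by (rule mean2_add[OF s1 s2])
  also have "\<dots> \<le> (L powr \<alpha> + (2 * L) powr \<alpha> * (1 + b)) * \<rho> powr \<alpha> + (L powr \<alpha> + (2 * L) powr \<alpha> * (1 + b)) * \<rho> powr \<alpha>"
    using half_piece_bound[where W = "\<lambda>u v. u", OF \<alpha> L pos(1,3) b \<rho> f h k]
      half_piece_bound[where W = "\<lambda>u v. v", OF \<alpha> L pos(2,3) b \<rho> f h k] rs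
    by (intro add_mono) auto
  also have "\<dots> = piece_const L b \<alpha> * \<rho> powr \<alpha>" by (simp add: piece_const_def algebra_simps)
  finally show ?thesis .
qed

section \<open>Averaged energies and random signs\<close>

definition energy1 :: "real \<Rightarrow> ('v::real_vector \<Rightarrow> real) \<Rightarrow> (real \<Rightarrow> real \<Rightarrow> 'x \<Rightarrow> 'v) \<Rightarrow> ('x \<Rightarrow>\<^sub>0 real) \<Rightarrow> real" where
  "energy1 \<alpha> \<mu> G a = mean2 (\<lambda>u v. \<mu> (lin_ext (G u v) a) powr \<alpha>)"

lemma gauge_energy1:
  assumes \<mu>: "gauge \<mu> q" and \<alpha>: "0 < \<alpha>" "\<alpha> \<le> 1" and st: "\<And>x. step2 (\<lambda>u v. G u v x)"
  shows "gauge (energy1 \<alpha> \<mu> G) (q * \<alpha>)"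
proof
  interpret a: gauge "\<lambda>x. \<mu> x powr \<alpha>" "q * \<alpha>" by (rule gauge_powr[OF \<mu> \<alpha>])
  have s: "step2 (\<lambda>u v. \<mu> (lin_ext (G u v) a) powr \<alpha>)" for a
    by (intro step2_comp[where G = "\<lambda>w. \<mu> w powr \<alpha>"] step2_lin_ext st)
  fix a b and c :: real
  show "0 < q * \<alpha>" by (rule a.q_pos)
  show "0 \<le> energy1 \<alpha> \<mu> G a" unfolding energy1_def by (rule mean2_nonneg[OF s]) simp
  show "energy1 \<alpha> \<mu> G (a + b) \<le> energy1 \<alpha> \<mu> G a + energy1 \<alpha> \<mu> G b"
    unfolding energy1_def mean2_add[OF s s, symmetric]
    by (rule mean2_mono[OF s step2_comp2[OF s s]]) (simp only: lin_ext_simps a.triangle)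
  show "energy1 \<alpha> \<mu> G (c *\<^sub>R a) = \<bar>c\<bar> powr (q * \<alpha>) * energy1 \<alpha> \<mu> G a"
    unfolding energy1_def lin_ext_simps a.scale mean2_cmult ..
qed

lemma energy1_cong:
  assumes "\<And>u v. lin_ext (G u v) a = lin_ext (G' u v) a"
  shows "energy1 \<alpha> \<mu> G a = energy1 \<alpha> \<mu> G' a"
  using assms by (simp add: energy1_def)

lemma energy1_lower:
  assumes \<alpha>: "0 < \<alpha>" and st: "\<And>x. step2 (\<lambda>u v. G u v x)" and c: "0 \<le> c"
    and lb: "\<And>u v. 0 \<le> u \<Longrightarrow> u \<le> 1 \<Longrightarrow> 0 \<le> v \<Longrightarrow> v \<le> 1 \<Longrightarrow> c \<le> \<mu> (lin_ext (G u v) a)"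
  shows "c powr \<alpha> \<le> energy1 \<alpha> \<mu> G a"
proof -
  have "mean2 (\<lambda>u v. c powr \<alpha>) \<le> energy1 \<alpha> \<mu> G a" unfolding energy1_def
    by (intro mean2_mono step2_const step2_comp[where G = "\<lambda>w. \<mu> w powr \<alpha>"] step2_lin_ext st)
      (use lb \<alpha> c in \<open>auto intro!: powr_mono2\<close>)
  then show ?thesis by simp
qed

text \<open>Since each point lies in few supports, an edge is felt by few pieces only.\<close>

lemma energy_edge:
  assumes \<mu>: "\<And>n. n \<in> I \<Longrightarrow> gauge (\<mu> n) q" and \<alpha>: "0 < \<alpha>" "\<alpha> \<le> 1" and I: "finite I"
    and st: "\<And>n x. n \<in> I \<Longrightarrow> step2 (\<lambda>u v. G n u v x)"
    and edge: "\<And>n. n \<in> I \<Longrightarrow> mean2 (\<lambda>u v. \<mu> n (G n u v x - G n u v y) powr \<alpha>) \<le> C"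
    and U: "\<And>n u v x. n \<in> I \<Longrightarrow> 0 \<le> u \<Longrightarrow> u \<le> 1 \<Longrightarrow> 0 \<le> v \<Longrightarrow> v \<le> 1 \<Longrightarrow> G n u v x \<noteq> 0 \<Longrightarrow> x \<in> U n"
    and m: "\<And>x. card {n \<in> I. x \<in> U n} \<le> m" and C: "0 \<le> C"
  shows "(\<Sum>n\<in>I. energy1 \<alpha> (\<mu> n) (G n) (pt x - pt y)) \<le> 2 * real m * C"
proof -
  let ?J = "{n \<in> I. x \<in> U n} \<union> {n \<in> I. y \<in> U n}"
  have e: "energy1 \<alpha> (\<mu> n) (G n) (pt x - pt y) = mean2 (\<lambda>u v. \<mu> n (G n u v x - G n u v y) powr \<alpha>)" for n
    by (simp add: energy1_def lin_ext_simps)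
  have z: "energy1 \<alpha> (\<mu> n) (G n) (pt x - pt y) \<le> 0" if n: "n \<in> I - ?J" for n
  proof -
    interpret gauge "\<mu> n" q using \<mu> n by blast
    have n': "n \<in> I" using n by blast
    have "mean2 (\<lambda>u v. \<mu> n (G n u v x - G n u v y) powr \<alpha>) \<le> mean2 (\<lambda>u v. 0)"
    proof (rule mean2_mono)
      fix u v :: real assume uv: "0 \<le> u" "u \<le> 1" "0 \<le> v" "v \<le> 1"
      have "G n u v x = 0" "G n u v y = 0" using U[OF n' uv] n by blast+
      then show "\<mu> n (G n u v x - G n u v y) powr \<alpha> \<le> 0" by simp
    qed (intro step2_const step2_comp2[where G = "\<lambda>a b. \<mu> n (a - b) powr \<alpha>"] st n')+
    then show ?thesis by (simp add: e)
  qed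
  have "(\<Sum>n\<in>I. energy1 \<alpha> (\<mu> n) (G n) (pt x - pt y)) \<le> (\<Sum>n\<in>I. if n \<in> ?J then C else 0)"
    using z edge by (intro sum_mono) (auto simp: e)
  also have "\<dots> = (\<Sum>n\<in>?J. C)"
    using I by (intro sum.mono_neutral_cong_right) auto
  also have "\<dots> = real (card ?J) * C" by simp
  also have "\<dots> \<le> real (m + m) * C"
    using order_trans[OF card_Un_le add_mono[OF m m]] C by (intro mult_right_mono) (auto simp del: of_nat_add)
  finally show ?thesis by simp
qed

text \<open>The power \<open>t = p / (q * \<alpha>)\<close>, at most 1, turns a gauge of exponent
  \<open>q * \<alpha>\<close> into one of exponent \<open>p\<close>, to which the universal property
  applies; the power 1 / t undoes this.\<close>

lemma (in free_gauge) energy_bound: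
  assumes R: "gauge R (q * \<alpha>)" and \<alpha>: "0 < \<alpha>" "p \<le> q * \<alpha>" and C: "0 \<le> C"
    and edge: "\<And>x y. R (pt x - pt y) \<le> C * \<nu> (x - y) powr \<alpha>" and R0: "R (pt 0) = 0"
  shows "R a \<le> C * NF (lin_ext D a) powr (q * \<alpha>)"
proof -
  interpret R: gauge R "q * \<alpha>" by fact
  define t where "t = p / (q * \<alpha>)"
  have qa: "0 < q * \<alpha>" using q_pos \<alpha> by simp
  have t: "0 < t" "t \<le> 1" "q * \<alpha> * t = p" using p \<alpha> qa by (auto simp: t_def)
  have pq: "\<alpha> * t = p / q" using q_pos \<alpha> by (simp add: t_def field_simps)
  have "R a powr t \<le> C powr t * NF (lin_ext D a) powr p"
  proof (rule gauge_bound)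
    show "gauge (\<lambda>a. R a powr t) p" using gauge_powr[OF R t(1,2)] t(3) by simp
    show "R (pt x - pt y) powr t \<le> C powr t * \<nu> (x - y) powr (p / q)" for x y
    proof -
      have "R (pt x - pt y) powr t \<le> (C * \<nu> (x - y) powr \<alpha>) powr t"
        using edge t by (intro powr_mono2) auto
      then show ?thesis using C by (simp add: powr_mult powr_powr pq)
    qed
  qed (use R0 in auto)
  then have "(R a powr t) powr (1 / t) \<le> (C powr t * NF (lin_ext D a) powr p) powr (1 / t)"
    using t by (intro powr_mono2) auto
  moreover have "p * (1 / t) = q * \<alpha>" using t by (simp add: field_simps)
  ultimately show ?thesis using t C by (simp add: powr_mult powr_powr)
qed

definition sgn_sum :: "'i set \<Rightarrow> ('i \<Rightarrow> 'v::real_vector) \<Rightarrow> 'i set \<Rightarrow> 'v" where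
  "sgn_sum I a S = (\<Sum>i\<in>I. (if i \<in> S then 1 else - 1) *\<^sub>R a i)"

text \<open>
  Average over all signs: flipping the sign of \<open>a n\<close> changes the signed sum by \<open>2 * a n\<close>, so that one of the
  two values of \<open>\<psi> n\<close> is large.
\<close>

lemma exists_signs:
  fixes I :: "'i set"
  assumes I: "finite I" and \<psi>: "\<And>n. n \<in> I \<Longrightarrow> gauge (\<psi> n) t"
  obtains S where "(\<Sum>n\<in>I. \<psi> n (a n)) / 2 \<le> (\<Sum>n\<in>I. \<psi> n (sgn_sum I a S))"
proof -
  define flip where "flip = (\<lambda>(n::'i) S. if n \<in> S then S - {n} else insert n S)"
  have avg: "(\<Sum>S\<in>Pow I. \<psi> n (a n)) / 2 \<le> (\<Sum>S\<in>Pow I. \<psi> n (sgn_sum I a S))" if n: "n \<in> I" for n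
  proof -
    interpret gauge "\<psi> n" t using \<psi> n by blast
    have "(\<Sum>S\<in>Pow I. \<psi> n (sgn_sum I a S)) = (\<Sum>S\<in>Pow I. \<psi> n (sgn_sum I a (flip n S)))"
      by (rule sum.reindex_bij_witness[where i = "flip n" and j = "flip n"])
        (use n in \<open>auto simp: flip_def intro!: arg_cong[of _ _ "\<lambda>S. \<psi> n (sgn_sum I a S)"]\<close>)
    then have "2 * (\<Sum>S\<in>Pow I. \<psi> n (sgn_sum I a S)) =
        (\<Sum>S\<in>Pow I. \<psi> n (sgn_sum I a S) + \<psi> n (sgn_sum I a (flip n S)))"
      by (simp add: sum.distrib)
    moreover have "\<psi> n (a n) \<le> \<psi> n (sgn_sum I a S) + \<psi> n (sgn_sum I a (flip n S))" for S
    proof -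
      have d: "sgn_sum I a S - sgn_sum I a (flip n S) = (if n \<in> S then 2 else - 2) *\<^sub>R a n"
      proof -
        have "sgn_sum I a S - sgn_sum I a (flip n S) =
            (\<Sum>i\<in>I. if i = n then (if n \<in> S then 2 else - 2) *\<^sub>R a n else 0)"
          unfolding sgn_sum_def sum_subtractf[symmetric]
        proof (rule sum.cong[OF refl])
          fix i assume "i \<in> I"
          have "- (2 *\<^sub>R a n) = - a n - a n" by (simp add: scaleR_2)
          then show "(if i \<in> S then 1 else - 1) *\<^sub>R a i - (if i \<in> flip n S then 1 else - 1) *\<^sub>R a i =
              (if i = n then (if n \<in> S then 2 else - 2) *\<^sub>R a n else 0)"
            by (cases "i = n"; cases "n \<in> S"; cases "i \<in> S") (simp_all add: flip_def scaleR_2)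
        qed
        then show ?thesis using I n by simp
      qed
      have "1 \<le> 2 powr t" using q_pos by (intro ge_one_powr_ge_zero) auto
      then have "\<psi> n (a n) \<le> 2 powr t * \<psi> n (a n)" using mult_right_mono[of 1 "2 powr t" "\<psi> n (a n)"] by simp
      also have "\<dots> = \<psi> n (sgn_sum I a S - sgn_sum I a (flip n S))" unfolding d scale by simp
      also have "\<dots> \<le> \<psi> n (sgn_sum I a S) + \<psi> n (sgn_sum I a (flip n S))" by (rule triangle_diff)
      finally show ?thesis .
    qed
    ultimately have "(\<Sum>S\<in>Pow I. \<psi> n (a n)) \<le> 2 * (\<Sum>S\<in>Pow I. \<psi> n (sgn_sum I a S))"
      by (simp only:) (intro sum_mono)
    then show ?thesis by simp
  qed
  have "\<exists>S\<in>Pow I. (\<Sum>n\<in>I. \<psi> n (a n)) / 2 \<le> (\<Sum>n\<in>I. \<psi> n (sgn_sum I a S))"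
  proof (rule ccontr)
    assume "\<not> ?thesis"
    then have "(\<Sum>S\<in>Pow I. \<Sum>n\<in>I. \<psi> n (sgn_sum I a S)) < (\<Sum>S\<in>Pow I. (\<Sum>n\<in>I. \<psi> n (a n)) / 2)"
      using I by (intro sum_strict_mono) (auto simp: not_le)
    also have "\<dots> = (\<Sum>n\<in>I. (\<Sum>S\<in>Pow I. \<psi> n (a n)) / 2)"
      by (simp add: sum_divide_distrib sum_distrib_left)
    also have "\<dots> \<le> (\<Sum>n\<in>I. \<Sum>S\<in>Pow I. \<psi> n (sgn_sum I a S))"
      by (intro sum_mono avg)
    finally show False by (subst (asm) sum.swap) simp
  qed
  then show thesis using that by blast
qed

section \<open>Detection of scales and cluster points\<close>

lemma mean2_cong:
  assumes "step2 \<phi>" "step2 \<psi>"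
    and "\<And>u v. 0 \<le> u \<Longrightarrow> u \<le> 1 \<Longrightarrow> 0 \<le> v \<Longrightarrow> v \<le> 1 \<Longrightarrow> \<phi> u v = \<psi> u v"
  shows "mean2 \<phi> = mean2 \<psi>"
  using mean2_mono[OF assms(1,2)] mean2_mono[OF assms(2,1)] assms(3) by (force intro: antisym)

text \<open>The upper end belonging to the smallest admissible index exceeds the lower end belonging
  to any other, so admissible indices differ by less than \<open>m\<close>.\<close>

lemma card_dyadic:
  fixes \<kappa> H :: real
  assumes "0 < \<kappa>"
  shows "card {j \<in> {..<J}. 2 ^ j * \<kappa> < H \<and> H \<le> 2 ^ (j + m) * \<kappa>} \<le> m"
proof (cases "{j \<in> {..<J}. 2 ^ j * \<kappa> < H \<and> H \<le> 2 ^ (j + m) * \<kappa>} = {}")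
  case True
  then show ?thesis by (metis card.empty zero_le)
next
  case False
  let ?S = "{j \<in> {..<J}. 2 ^ j * \<kappa> < H \<and> H \<le> 2 ^ (j + m) * \<kappa>}"
  define j0 where "j0 = Min ?S"
  have fin: "finite ?S" by simp
  have j0: "j0 \<in> ?S" unfolding j0_def using fin False by (rule Min_in)
  have "?S \<subseteq> {j0..<j0 + m}"
  proof
    fix j assume j: "j \<in> ?S"
    then have "j0 \<le> j" unfolding j0_def using fin by (intro Min_le)
    moreover have "2 ^ j * \<kappa> < 2 ^ (j0 + m) * \<kappa>" using j j0 by auto
    then have "(2::real) ^ j < 2 ^ (j0 + m)" using assms by simp
    then have "j < j0 + m" by simp
    ultimately show "j \<in> {j0..<j0 + m}" by simp
  qed
  then have "card ?S \<le> card {j0..<j0 + m}" by (rule card_mono[rotated]) simp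
  then show ?thesis by simp
qed

lemma (in gauge) gauge_chain_bound:
  assumes R: "gauge R (q * \<alpha>)" and C: "0 \<le> C" and edge: "\<And>x y. R (pt x - pt y) \<le> C * \<nu> (x - y) powr \<alpha>"
  shows "R (chain xs) \<le> C * cost \<alpha> xs"
proof (induction xs)
  case Nil
  interpret R: gauge R "q * \<alpha>" by fact
  show ?case by simp
next
  case (Cons z xs)
  interpret R: gauge R "q * \<alpha>" by fact
  obtain c x y where z: "z = (c, x, y)" by (cases z)
  have "R (chain (z # xs)) \<le> R (c *\<^sub>R (pt x - pt y)) + R (chain xs)"
    unfolding z chain_Cons by (rule R.triangle)
  also have "R (c *\<^sub>R (pt x - pt y)) \<le> \<bar>c\<bar> powr (q * \<alpha>) * (C * \<nu> (x - y) powr \<alpha>)"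
    unfolding R.scale by (intro mult_left_mono edge) auto
  also have "\<dots> = C * weight z powr \<alpha>" by (simp add: z weight_def powr_mult powr_powr)
  finally show ?case using Cons by (simp add: cost_Cons distrib_left)
qed

text \<open>
  \<open>\<Phi> \<tau>\<close> is the part of the image where \<open>h \<le> \<tau>\<close>.  Choosing a medoid \<open>t j\<close> in each dyadic interval turns the
  average increments into increments of a single chain \<open>t 0, t 1, \<dots>\<close>; these cannot all be small, since
  the exponent \<open>1 / \<alpha>\<close> exceeds \<open>1\<close>.
\<close>

lemma (in gauge) scale_detection:
  fixes f :: "'v \<Rightarrow> 'v" and \<mu> h :: "'v \<Rightarrow> real" and xs :: "'v molecule list"
  assumes \<mu>: "gauge \<mu> q" and \<alpha>: "0 < \<alpha>" "\<alpha> < 1" and L: "0 \<le> L" and \<kappa>: "0 < \<kappa>"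
    and f: "\<And>x y. \<mu> (f x - f y) \<le> L * \<nu> (x - y)" "\<And>x. \<mu> (f x) \<le> L * h x"
    and h: "\<And>x y. \<bar>h x - h y\<bar> \<le> \<nu> (x - y)"
    and \<Phi>: "\<Phi> = (\<lambda>\<tau>. lin_ext (\<lambda>x. if h x \<le> \<tau> then f x else 0) (chain xs))"
    and ends: "\<And>\<tau> \<tau>'. \<kappa> \<le> \<tau> \<Longrightarrow> \<tau> \<le> 2 * \<kappa> \<Longrightarrow> 2 ^ J * \<kappa> \<le> \<tau>' \<Longrightarrow> c2 \<le> \<mu> (\<Phi> \<tau>' - \<Phi> \<tau>)"
    and K: "cost \<alpha> xs \<le> K" and c3: "0 < c3" "(3 * c3) powr (1 / \<alpha> - 1) * (8 * piece_const L 1 \<alpha> * K) < c2"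
  obtains j r where "r = 2 ^ j * \<kappa> \<or> r = 2 * (2 ^ j * \<kappa>)"
    "c3 \<le> energy1 \<alpha> \<mu> (piece f h (\<lambda>_. 0) r (2 ^ j * \<kappa>) 1) (chain xs)"
proof -
  interpret m: gauge \<mu> q by fact
  interpret a: gauge "\<lambda>x. \<mu> x powr \<alpha>" "q * \<alpha>" by (rule gauge_powr[OF \<mu>]) (use \<alpha> in auto)
  \<comment> \<open>For \<open>i = 0\<close> two independent thresholds of the same scale are
    compared, for \<open>i = 1\<close> thresholds of adjacent scales. With \<open>k\<close> zero and
    \<open>s = 1\<close> there is no localization.\<close>
  define G where "G = (\<lambda>j i. piece f h (\<lambda>_. 0) (2 ^ (j + i) * \<kappa>) (2 ^ j * \<kappa>) 1)"
  define en where "en = (\<lambda>i j. energy1 \<alpha> \<mu> (G j i) (chain xs))"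
  have stG: "step2 (\<lambda>u v. G j i u v x)" for j i x unfolding G_def using \<kappa> by (intro step2_piece) auto
  define P where "P = (\<lambda>j i u v. \<mu> (\<Phi> (2 ^ (j + i) * \<kappa> * (1 + u)) - \<Phi> (2 ^ j * \<kappa> * (1 + v))) powr \<alpha>)"
  have st\<Phi>: "step2 (\<lambda>u v. \<Phi> (r * (1 + u)))" "step2 (\<lambda>u v. \<Phi> (r * (1 + v)))" if "0 < r" for r
    unfolding \<Phi> threshold_iff[OF that]
    by (intro step2_lin_ext step2_comp[where G = "\<lambda>b. if b then _ else _"] step2_threshold1 step2_threshold2)+
  have stP: "step2 (P j i)" for j i unfolding P_def
    by (rule step2_comp2[where G = "\<lambda>x y. \<mu> (x - y) powr \<alpha>", OF st\<Phi>(1) st\<Phi>(2)]) (use \<kappa> in auto)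
  have enP: "en i j = mean2 (P j i)" for i j unfolding en_def energy1_def
  proof (rule mean2_cong[OF _ stP])
    show "step2 (\<lambda>u v. \<mu> (lin_ext (G j i u v) (chain xs)) powr \<alpha>)"
      by (intro step2_comp[where G = "\<lambda>w. \<mu> w powr \<alpha>"] step2_lin_ext stG)
    fix u v :: real assume uv: "0 \<le> u"
    have "lin_ext (G j i u v) (chain xs) = \<Phi> (2 ^ (j + i) * \<kappa> * (1 + u)) - \<Phi> (2 ^ j * \<kappa> * (1 + v))"
      unfolding \<Phi> lin_ext_diff[symmetric] using uv
      by (intro lin_ext_cong) (auto simp: G_def piece_def cut_def)
    then show "\<mu> (lin_ext (G j i u v) (chain xs)) powr \<alpha> = P j i u v" by (simp add: P_def)
  qed
  have en_nonneg: "0 \<le> en i j" for i j unfolding enP by (rule mean2_nonneg[OF stP]) (simp add: P_def)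
  \<comment> \<open>Each point lies in at most \<open>i + 1\<close> of the dyadic annuli, so the
    total energy over all scales is bounded independently of their number \<open>J'\<close>.\<close>
  have sum_en: "(\<Sum>j<J'. en i j) \<le> 2 * real (i + 1) * piece_const L 1 \<alpha> * K" if i: "i \<le> 1" for i J'
  proof -
    have pc: "0 \<le> piece_const L 1 \<alpha>" by (rule piece_const_nonneg) simp
    have "gauge (\<lambda>b. \<Sum>j<J'. energy1 \<alpha> \<mu> (G j i) b) (q * \<alpha>)"
      using \<alpha> a.q_pos by (intro gauge_sum gauge_energy1 \<mu> stG) auto
    then have "(\<Sum>j<J'. en i j) \<le> 2 * real (i + 1) * piece_const L 1 \<alpha> * cost \<alpha> xs" unfolding en_def
    proof (rule gauge_chain_bound)
      fix x y
      have "(\<Sum>j<J'. energy1 \<alpha> \<mu> (G j i) (pt x - pt y)) \<le> 2 * real (i + 1) * (piece_const L 1 \<alpha> * \<nu> (x - y) powr \<alpha>)"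
      proof (rule energy_edge[where U = "\<lambda>j. {x. 2 ^ j * \<kappa> < h x \<and> h x \<le> 2 ^ (j + (i + 1)) * \<kappa>}"])
        show "mean2 (\<lambda>u v. \<mu> (G j i u v x - G j i u v y) powr \<alpha>) \<le> piece_const L 1 \<alpha> * \<nu> (x - y) powr \<alpha>" for j
          unfolding G_def by (rule m.piece_bound) (use \<alpha> L \<kappa> f h in auto)
        show "card {j \<in> {..<J'}. z \<in> {x. 2 ^ j * \<kappa> < h x \<and> h x \<le> 2 ^ (j + (i + 1)) * \<kappa>}} \<le> i + 1" for z
          using card_dyadic[OF \<kappa>, of J' "h z" "i + 1"] by simp
        fix j z and u v :: real assume uv: "0 \<le> u" "u \<le> 1" "0 \<le> v" "v \<le> 1" and nz: "G j i u v z \<noteq> 0"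
        have pow: "2 ^ j * \<kappa> \<le> 2 ^ (j + i) * \<kappa>" using \<kappa> by simp
        have r: "r \<le> r * (1 + w)" "r * (1 + w) \<le> 2 * r" if "0 < r" "0 \<le> w" "w \<le> 1" for r w :: real
          using that by auto
        have r1: "2 ^ (j + i) * \<kappa> \<le> 2 ^ (j + i) * \<kappa> * (1 + u)" "2 ^ (j + i) * \<kappa> * (1 + u) \<le> 2 * (2 ^ (j + i) * \<kappa>)"
          using uv \<kappa> by (intro r; simp)+
        have r2: "2 ^ j * \<kappa> \<le> 2 ^ j * \<kappa> * (1 + v)" "2 ^ j * \<kappa> * (1 + v) \<le> 2 * (2 ^ j * \<kappa>)"
          using uv \<kappa> by (intro r; simp)+
        have "(h z \<le> 2 ^ (j + i) * \<kappa> * (1 + u)) \<noteq> (h z \<le> 2 ^ j * \<kappa> * (1 + v))"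
          using nz by (auto simp: G_def piece_def cut_def split: if_splits)
        then have "2 ^ j * \<kappa> < h z \<and> h z \<le> 2 * (2 ^ (j + i) * \<kappa>)"
          using r1 r2 pow by linarith
        then show "z \<in> {x. 2 ^ j * \<kappa> < h x \<and> h x \<le> 2 ^ (j + (i + 1)) * \<kappa>}" by (simp add: mult.assoc)
      qed (use \<mu> \<alpha> stG pc in auto)
      then show "(\<Sum>j<J'. energy1 \<alpha> \<mu> (G j i) (pt x - pt y)) \<le> 2 * real (i + 1) * piece_const L 1 \<alpha> * \<nu> (x - y) powr \<alpha>"
        by (simp add: mult.assoc)
    qed (use pc in auto)
    also have "\<dots> \<le> 2 * real (i + 1) * piece_const L 1 \<alpha> * K" using K pc by (intro mult_left_mono) auto
    finally show ?thesis .
  qed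
  have "\<exists>i j. i \<le> 1 \<and> c3 \<le> en i j"
  proof (rule ccontr)
    assume "\<not> ?thesis"
    then have small: "en i j < c3" if "i \<le> 1" for i j using that by (meson not_le)
    have "\<exists>u. 0 \<le> u \<and> u \<le> 1 \<and> mean (P j 0 u) \<le> en 0 j" for j
      using mean_attained[OF step2_mean[OF stP, of j 0]] unfolding enP mean2_def by metis
    then obtain w where w: "\<And>j. 0 \<le> w j" "\<And>j. w j \<le> 1" "\<And>j. mean (P j 0 (w j)) \<le> en 0 j" by metis
    define t where "t = (\<lambda>j. 2 ^ j * \<kappa> * (1 + w j))"
    define Dl where "Dl = (\<lambda>j. \<mu> (\<Phi> (t (Suc j)) - \<Phi> (t j)) powr \<alpha>)"
    \<comment> \<open>Insert two random scales and average. Each medoid is close on average to a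
      random scale of its own interval, and the two random scales are compared by
      \<open>en 1 j\<close>.\<close>
    have Dle: "Dl j \<le> en 0 (Suc j) + en 1 j + en 0 j" for j
    proof -
      let ?A = "\<lambda>u v :: real. P (Suc j) 0 (w (Suc j)) u"
      let ?B = "\<lambda>u v :: real. P j 0 (w j) v"
      have sA: "step2 ?A" unfolding P_def
        by (rule step2_comp[where G = "\<lambda>y. \<mu> (_ - y) powr \<alpha>", OF st\<Phi>(1)]) (use \<kappa> in auto)
      have sB: "step2 ?B" unfolding P_def
        by (rule step2_comp[where G = "\<lambda>y. \<mu> (_ - y) powr \<alpha>", OF st\<Phi>(2)]) (use \<kappa> in auto)
      have "mean2 (\<lambda>u v. Dl j) \<le> mean2 (\<lambda>u v. ?A u v + (P j 1 u v + ?B u v))"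
      proof (rule mean2_mono)
        fix u v :: real
        show "Dl j \<le> ?A u v + (P j 1 u v + ?B u v)"
          using a.triangle3[of "\<Phi> (t (Suc j))" "\<Phi> (t j)" "\<Phi> (2 ^ Suc j * \<kappa> * (1 + u))"]
            a.triangle3[of "\<Phi> (2 ^ Suc j * \<kappa> * (1 + u))" "\<Phi> (t j)" "\<Phi> (2 ^ j * \<kappa> * (1 + v))"]
            a.commute[of "\<Phi> (2 ^ j * \<kappa> * (1 + v))" "\<Phi> (t j)"]
          by (simp add: Dl_def P_def t_def)
      qed (intro step2_const step2_comp2[where G = "(+)"] sA sB stP)+
      also have "\<dots> = mean2 ?A + (mean2 (P j 1) + mean2 ?B)"
        by (simp add: mean2_add[OF sA step2_comp2[where G = "(+)", OF stP sB]] mean2_add[OF stP sB])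
      also have "\<dots> \<le> en 0 (Suc j) + (en 1 j + en 0 j)"
        using w(3)[of j] w(3)[of "Suc j"] by (simp add: mean2_left mean2_right enP)
      finally show ?thesis by simp
    qed
    have D0: "0 \<le> Dl j" for j by (simp add: Dl_def)
    \<comment> \<open>Undoing the power \<alpha> leaves the surplus exponent 1 / \<alpha> - 1 > 0,
      whose factor is small if all increments are. This is the origin of the condition on
      \<open>c3\<close>.\<close>
    have D1: "\<mu> (\<Phi> (t (Suc j)) - \<Phi> (t j)) \<le> (3 * c3) powr (1 / \<alpha> - 1) * Dl j" for j
    proof -
      have "Dl j \<le> 3 * c3" using Dle[of j] small[of 0 "Suc j"] small[of 0 j] small[of 1 j] by simp
      then have "Dl j powr (1 / \<alpha> - 1) \<le> (3 * c3) powr (1 / \<alpha> - 1)"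
        using \<alpha> D0 by (intro powr_mono2) auto
      moreover have "\<mu> (\<Phi> (t (Suc j)) - \<Phi> (t j)) = Dl j powr (1 / \<alpha> - 1) * Dl j"
      proof (cases "\<mu> (\<Phi> (t (Suc j)) - \<Phi> (t j)) = 0")
        case False
        then have "Dl j > 0" using m.nonneg[of "\<Phi> (t (Suc j)) - \<Phi> (t j)"] by (simp add: Dl_def)
        then have "Dl j powr (1 / \<alpha> - 1) * Dl j = Dl j powr (1 / \<alpha>)" by (simp add: powr_diff)
        then show ?thesis using \<alpha> by (simp add: Dl_def powr_powr)
      qed (simp add: Dl_def)
      ultimately show ?thesis using D0 by (simp add: mult_right_mono)
    qed
    have "c2 \<le> \<mu> (\<Phi> (t J) - \<Phi> (t 0))"
    proof (rule ends)
      show "\<kappa> \<le> t 0" "t 0 \<le> 2 * \<kappa>" "2 ^ J * \<kappa> \<le> t J" using w[of 0] w[of J] \<kappa> by (auto simp: t_def)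
    qed
    also have "\<dots> = \<mu> (\<Sum>j<J. \<Phi> (t (Suc j)) - \<Phi> (t j))"
      using sum_lessThan_telescope[of "\<lambda>j. \<Phi> (t j)" J] by simp
    also have "\<dots> \<le> (\<Sum>j<J. \<mu> (\<Phi> (t (Suc j)) - \<Phi> (t j)))" by (rule m.sum_le)
    also have "\<dots> \<le> (\<Sum>j<J. (3 * c3) powr (1 / \<alpha> - 1) * Dl j)" by (intro sum_mono D1)
    also have "\<dots> = (3 * c3) powr (1 / \<alpha> - 1) * (\<Sum>j<J. Dl j)" by (simp add: sum_distrib_left)
    also have "\<dots> \<le> (3 * c3) powr (1 / \<alpha> - 1) * (8 * piece_const L 1 \<alpha> * K)"
    proof (rule mult_left_mono)
      have "(\<Sum>j<J. Dl j) \<le> (\<Sum>j<J. en 0 (Suc j)) + (\<Sum>j<J. en 1 j) + (\<Sum>j<J. en 0 j)"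
        unfolding sum.distrib[symmetric] by (intro sum_mono Dle)
      moreover have "(\<Sum>j<J. en 0 (Suc j)) \<le> (\<Sum>j<Suc J. en 0 j)"
        by (subst sum.lessThan_Suc_shift) (simp add: en_nonneg)
      \<comment> \<open>The three sums contribute 2, 4 and 2, since the factor in
        \<open>sum_en\<close> is \<open>2 * (i + 1)\<close>.\<close>
      ultimately show "(\<Sum>j<J. Dl j) \<le> 8 * piece_const L 1 \<alpha> * K"
        using sum_en[of 0 "Suc J"] sum_en[of 0 J] sum_en[of 1 J] by simp
    qed simp
    finally show False using c3 by simp
  qed
  then obtain i j where ij: "i \<le> 1" "c3 \<le> en i j" by blast
  show thesis
  proof (rule that[of "2 ^ (j + i) * \<kappa>" j])
    have "i = 0 \<or> i = 1" using ij(1) by auto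
    then show "2 ^ (j + i) * \<kappa> = 2 ^ j * \<kappa> \<or> 2 ^ (j + i) * \<kappa> = 2 * (2 ^ j * \<kappa>)" by auto
    show "c3 \<le> energy1 \<alpha> \<mu> (piece f h (\<lambda>_. 0) (2 ^ (j + i) * \<kappa>) (2 ^ j * \<kappa>) 1) (chain xs)"
      using ij(2) by (simp add: en_def G_def)
  qed
qed

section \<open>Subsequences that converge or escape from finite sets\<close>

context gauge
begin

definition converges_to :: "(nat \<Rightarrow> 'v) \<Rightarrow> 'v \<Rightarrow> bool" where
  "converges_to P z \<longleftrightarrow> (\<lambda>n. \<nu> (P n - z)) \<longlonglongrightarrow> 0"

definition escapes :: "real \<Rightarrow> (nat \<Rightarrow> 'v) \<Rightarrow> bool" where
  "escapes \<sigma> P \<longleftrightarrow> (\<forall>A. finite A \<longrightarrow> eventually (\<lambda>n. \<forall>a\<in>A. \<sigma> \<le> \<nu> (P n - a)) sequentially)"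

lemma converges_to_subseq: "converges_to P z \<Longrightarrow> strict_mono r \<Longrightarrow> converges_to (\<lambda>n. P (r n)) z"
  unfolding converges_to_def by (drule (1) LIMSEQ_subseq_LIMSEQ) (simp add: o_def)

lemma escapes_subseq: "escapes \<sigma> P \<Longrightarrow> strict_mono r \<Longrightarrow> escapes \<sigma> (\<lambda>n. P (r n))"
  unfolding escapes_def using eventually_subseq by blast

text \<open>Two terms within \<sigma>/2 of the same point would be closer to each other than
  \<sigma>, so each point has at most one term that near.\<close>

lemma escapes_of_separated:
  assumes "\<And>j k. j < k \<Longrightarrow> \<sigma> \<le> \<nu> (P k - P j)"
  shows "escapes (\<sigma> / 2) P"
  unfolding escapes_def
proof (intro allI impI eventually_ball_finite ballI)
  fix a
  have "\<exists>k. \<forall>n>k. \<sigma>/2 \<le> \<nu> (P n - a)"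
  proof (cases "\<exists>k. \<nu> (P k - a) < \<sigma>/2")
    case True
    then obtain k where k: "\<nu> (P k - a) < \<sigma>/2" by blast
    have "\<sigma>/2 \<le> \<nu> (P n - a)" if "n > k" for n
      using assms[OF that] triangle3[of "P n" "P k" a] commute[of a "P k"] k by linarith
    then show ?thesis by blast
  qed (auto simp: not_less)
  then show "eventually (\<lambda>n. \<sigma>/2 \<le> \<nu> (P n - a)) sequentially"
    unfolding eventually_at_top_dense .
qed

text \<open>If for some \<sigma> no initial segment is a \<sigma>-net of the sequence, a
  \<sigma>-separated subsequence can be chosen. Otherwise the pigeonhole principle gives nested
  infinite index sets of shrinking diameter, and a diagonal subsequence is Cauchy.\<close>

lemma sequence_dichotomy:
  assumes complete: "\<And>c. (\<forall>e>0. \<exists>n0. \<forall>m\<ge>n0. \<forall>n\<ge>n0. \<nu> (c m - c n) < e) \<Longrightarrow> \<exists>z. converges_to c z"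
  obtains r :: "nat \<Rightarrow> nat" where "strict_mono r"
    "(\<exists>z. converges_to (\<lambda>n. P (r n)) z) \<or> (\<exists>\<sigma>>0. escapes \<sigma> (\<lambda>n. P (r n)))"
proof (cases "\<exists>\<sigma>>0. \<forall>n0. \<exists>n. \<forall>i\<le>n0. \<sigma> \<le> \<nu> (P n - P i)")
  case True
  then obtain \<sigma> where \<sigma>: "\<sigma> > 0" "\<And>n0. \<exists>n. \<forall>i\<le>n0. \<sigma> \<le> \<nu> (P n - P i)" by blast
  have "\<exists>r :: nat \<Rightarrow> nat. \<forall>k. True \<and> (\<forall>i\<le>r k. \<sigma> \<le> \<nu> (P (r (Suc k)) - P i))"
    by (rule dependent_nat_choice) (use \<sigma>(2) in auto)
  then obtain r :: "nat \<Rightarrow> nat" where r: "\<And>k i. i \<le> r k \<Longrightarrow> \<sigma> \<le> \<nu> (P (r (Suc k)) - P i)" by blast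
  have "r k < r (Suc k)" for k
    using r[of "r (Suc k)" k] \<sigma>(1) by (cases "r (Suc k) \<le> r k") auto
  then have sm: "strict_mono r" by (simp add: strict_mono_Suc_iff)
  have "escapes (\<sigma>/2) (\<lambda>n. P (r n))"
  proof (rule escapes_of_separated)
    fix j k :: nat assume "j < k"
    then obtain k' where k': "k = Suc k'" "j \<le> k'" by (cases k) auto
    then have "r j \<le> r k'" using sm by (simp add: strict_mono_less_eq)
    then show "\<sigma> \<le> \<nu> (P (r k) - P (r j))" using r k' by simp
  qed
  then show thesis using that[OF sm] \<sigma>(1) half_gt_zero by blast
next
  case False
  have refine: "\<exists>S'. infinite S' \<and> S' \<subseteq> S \<and> (\<forall>m\<in>S'. \<forall>n\<in>S'. \<nu> (P m - P n) < \<sigma>)"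
    if S: "infinite S" and \<sigma>: "\<sigma> > 0" for S \<sigma>
  proof -
    have "\<sigma>/2 > 0" using \<sigma> by simp
    with False obtain n0 where n0: "\<And>n. \<exists>i\<le>n0. \<nu> (P n - P i) < \<sigma>/2" by (meson not_le)
    have "S = (\<Union>i\<in>{..n0}. {n\<in>S. \<nu> (P n - P i) < \<sigma>/2})" using n0 by auto
    then have "infinite (\<Union>i\<in>{..n0}. {n\<in>S. \<nu> (P n - P i) < \<sigma>/2})" using S by simp
    then obtain i where i: "infinite {n\<in>S. \<nu> (P n - P i) < \<sigma>/2}" by auto
    have "\<nu> (P m - P n) < \<sigma>" if "\<nu> (P m - P i) < \<sigma>/2" "\<nu> (P n - P i) < \<sigma>/2" for m n
      using triangle3[of "P m" "P n" "P i"] commute[of "P i" "P n"] that by linarith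
    then show ?thesis using i by (intro exI[of _ "{n\<in>S. \<nu> (P n - P i) < \<sigma>/2}"]) auto
  qed
  have "\<exists>S :: nat \<Rightarrow> nat set. \<forall>k. infinite (S k) \<and>
      (S (Suc k) \<subseteq> S k \<and> (\<forall>m\<in>S (Suc k). \<forall>n\<in>S (Suc k). \<nu> (P m - P n) < inverse (real (Suc k))))"
  proof (rule dependent_nat_choice)
    show "\<exists>S :: nat set. infinite S" using infinite_UNIV_nat by blast
    fix S :: "nat set" and k assume "infinite S"
    from refine[OF this, of "inverse (real (Suc k))"]
    show "\<exists>S'. infinite S' \<and> S' \<subseteq> S \<and> (\<forall>m\<in>S'. \<forall>n\<in>S'. \<nu> (P m - P n) < inverse (real (Suc k)))" by simp
  qed
  then obtain S :: "nat \<Rightarrow> nat set" where S: "\<And>k. infinite (S k)" "\<And>k. S (Suc k) \<subseteq> S k"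
    "\<And>k m n. m \<in> S (Suc k) \<Longrightarrow> n \<in> S (Suc k) \<Longrightarrow> \<nu> (P m - P n) < inverse (real (Suc k))" by metis
  have "\<exists>r :: nat \<Rightarrow> nat. \<forall>k. r k \<in> S k \<and> r k < r (Suc k)"
  proof (rule dependent_nat_choice)
    show "\<exists>n. n \<in> S 0" using S(1)[of 0] infinite_imp_nonempty by blast
    show "\<exists>m. m \<in> S (Suc k) \<and> n < m" for n k
      using S(1)[of "Suc k"] unfolding infinite_nat_iff_unbounded by blast
  qed
  then obtain r :: "nat \<Rightarrow> nat" where r: "\<And>k. r k \<in> S k" "\<And>k. r k < r (Suc k)" by blast
  have sm: "strict_mono r" using r(2) by (simp add: strict_mono_Suc_iff)
  have anti: "S n \<subseteq> S m" if "m \<le> n" for m n using lift_Suc_antimono_le[of S, OF S(2) that] .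
  have "\<exists>z. converges_to (\<lambda>n. P (r n)) z"
  proof (rule complete, intro allI impI)
    fix e :: real assume "e > 0"
    from order_tendstoD(2)[OF LIMSEQ_inverse_real_of_nat this]
    obtain k where k: "inverse (real (Suc k)) < e" by (auto simp: eventually_sequentially)
    have "\<nu> (P (r m) - P (r n)) < e" if "m \<ge> Suc k" "n \<ge> Suc k" for m n
      using S(3)[of "r m" k "r n"] r(1)[of m] r(1)[of n] anti[OF that(1)] anti[OF that(2)] k by (meson less_trans subsetD)
    then show "\<exists>n0. \<forall>m\<ge>n0. \<forall>n\<ge>n0. \<nu> (P (r m) - P (r n)) < e" by blast
  qed
  then show thesis using that[OF sm] by blast
qed

lemma sequences_dichotomy:
  fixes P :: "nat \<Rightarrow> nat \<Rightarrow> 'v"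
  assumes complete: "\<And>c. (\<forall>e>0. \<exists>n0. \<forall>m\<ge>n0. \<forall>n\<ge>n0. \<nu> (c m - c n) < e) \<Longrightarrow> \<exists>z. converges_to c z"
  shows "\<exists>r :: nat \<Rightarrow> nat. strict_mono r \<and> (\<forall>i<d. (\<exists>z. converges_to (\<lambda>n. P i (r n)) z) \<or> (\<exists>\<sigma>>0. escapes \<sigma> (\<lambda>n. P i (r n))))"
proof (induction d)
  case 0
  show ?case by (intro exI[of _ id]) (simp add: strict_mono_def)
next
  case (Suc d)
  then obtain r :: "nat \<Rightarrow> nat" where r: "strict_mono r"
    "\<And>i. i < d \<Longrightarrow> (\<exists>z. converges_to (\<lambda>n. P i (r n)) z) \<or> (\<exists>\<sigma>>0. escapes \<sigma> (\<lambda>n. P i (r n)))" by blast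
  obtain r' :: "nat \<Rightarrow> nat" where r': "strict_mono r'"
    "(\<exists>z. converges_to (\<lambda>n. P d (r (r' n))) z) \<or> (\<exists>\<sigma>>0. escapes \<sigma> (\<lambda>n. P d (r (r' n))))"
    using sequence_dichotomy[OF complete, of "\<lambda>n. P d (r n)"] .
  have "(\<exists>z. converges_to (\<lambda>n. P i (r (r' n))) z) \<or> (\<exists>\<sigma>>0. escapes \<sigma> (\<lambda>n. P i (r (r' n))))" if "i < Suc d" for i
  proof (cases "i = d")
    case False
    then have "i < d" using that by simp
    from r(2)[OF this] converges_to_subseq[OF _ r'(1), of "\<lambda>n. P i (r n)"]
      escapes_subseq[OF _ r'(1), of _ "\<lambda>n. P i (r n)"] show ?thesis by blast
  qed (use r'(2) in simp)
  moreover have "strict_mono (\<lambda>n. r (r' n))" using strict_mono_o[OF r(1) r'(1)] by (simp add: o_def)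
  ultimately show ?case by blast
qed

end

section \<open>Lifts of Lipschitz maps\<close>

text \<open>Subadditivity of the inverse power 1 / t.\<close>

lemma powr_superadditive:
  fixes a b t :: real
  assumes "0 \<le> a" "0 \<le> b" "1 \<le> t"
  shows "a powr t + b powr t \<le> (a + b) powr t"
proof -
  have "(a powr t + b powr t) powr (1/t) \<le> (a powr t) powr (1/t) + (b powr t) powr (1/t)"
    using assms by (intro powr_subadditive) auto
  then have "(a powr t + b powr t) powr (1/t) \<le> a + b" using assms by (simp add: powr_powr)
  then have "((a powr t + b powr t) powr (1/t)) powr t \<le> (a + b) powr t"
    using assms by (intro powr_mono2) auto
  then show ?thesis using assms by (simp add: powr_powr)
qed

text \<open>A nonincreasing sequence of natural numbers is constant from the place of its minimum
  on.\<close>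

lemma monotone_nat_subseq:
  fixes j :: "nat \<Rightarrow> nat"
  obtains g :: "nat \<Rightarrow> nat" where "strict_mono g" "\<And>m n. m \<le> n \<Longrightarrow> j (g m) \<le> j (g n)"
proof -
  obtain g :: "nat \<Rightarrow> nat" where g: "strict_mono g" "monoseq (\<lambda>n. j (g n))"
    using seq_monosub by blast
  from g(2) consider "\<And>m n. m \<le> n \<Longrightarrow> j (g m) \<le> j (g n)" | "\<And>m n. m \<le> n \<Longrightarrow> j (g n) \<le> j (g m)"
    unfolding monoseq_def by blast
  then show thesis
  proof cases
    case 2
    obtain n0 where n0: "\<And>n. j (g n0) \<le> j (g n)"
      using ex_has_least_nat[of "\<lambda>_. True" _ "\<lambda>n. j (g n)"] by auto
    show thesis
    proof
      show "strict_mono (\<lambda>n. g (n0 + n))" using g(1) by (simp add: strict_mono_def)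
      show "j (g (n0 + m)) \<le> j (g (n0 + n))" for m n
        using 2[of n0 "n0 + m"] n0[of "n0 + n"] by simp
    qed
  qed (use g(1) that in blast)
qed

context gauge
begin

text \<open>The monotonicity of sequence-space quasi-norms in the exponent, applied to the
  weights.\<close>

lemma cost_le_powr:
  assumes "0 < \<beta>" "\<beta> \<le> \<alpha>"
  shows "cost \<alpha> xs \<le> cost \<beta> xs powr (\<alpha> / \<beta>)"
proof (induction xs)
  case (Cons z xs)
  have "weight z powr \<alpha> = (weight z powr \<beta>) powr (\<alpha> / \<beta>)" using assms by (simp add: powr_powr)
  then have "cost \<alpha> (z # xs) \<le> (weight z powr \<beta>) powr (\<alpha> / \<beta>) + cost \<beta> xs powr (\<alpha> / \<beta>)"
    using Cons by (simp add: cost_Cons)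
  also have "\<dots> \<le> cost \<beta> (z # xs) powr (\<alpha> / \<beta>)"
    unfolding cost_Cons using assms by (intro powr_superadditive) auto
  finally show ?case .
qed simp

lemma cost_filter_le: "cost t (filter Q xs) \<le> cost t xs"
  by (induction xs) (auto simp: cost_Cons add_increasing)

text \<open>A weight below \<theta> yields the factor
  \<open>\<theta> powr (\<alpha> - \<beta>)\<close> when its exponent is lowered; with \<beta> = p /
  q < \<alpha> this makes the light molecules negligible.\<close>

lemma cost_small:
  assumes "\<beta> \<le> \<alpha>" "0 < \<theta>"
  shows "cost \<alpha> (filter (\<lambda>z. \<not> \<theta> \<le> weight z) xs) \<le> \<theta> powr (\<alpha> - \<beta>) * cost \<beta> xs"
proof (induction xs)
  case (Cons z xs)
  have "weight z powr \<alpha> \<le> \<theta> powr (\<alpha> - \<beta>) * weight z powr \<beta>" if "weight z < \<theta>"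
  proof -
    have "weight z powr \<alpha> = weight z powr (\<alpha> - \<beta>) * weight z powr \<beta>"
      by (simp add: powr_add[symmetric])
    also have "\<dots> \<le> \<theta> powr (\<alpha> - \<beta>) * weight z powr \<beta>"
      using that assms by (intro mult_right_mono powr_mono2) auto
    finally show ?thesis .
  qed
  then show ?case using Cons by (auto simp: cost_Cons distrib_left add_increasing)
qed simp

text \<open>Chebyshev's inequality for the counting measure.\<close>

lemma length_big:
  assumes "0 < \<theta>" "0 < \<beta>"
  shows "real (length (filter (\<lambda>z. \<theta> \<le> weight z) xs)) * \<theta> powr \<beta> \<le> cost \<beta> xs"
proof (induction xs)
  case (Cons z xs)
  have "\<theta> powr \<beta> \<le> weight z powr \<beta>" if "\<theta> \<le> weight z" using that assms by (intro powr_mono2) auto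
  then show ?case using Cons by (auto simp: cost_Cons distrib_right add_increasing)
qed simp

lemma lin_ext_chain_le:
  assumes f: "\<And>x y. \<nu> (f x - f y) \<le> L * \<nu> (x - y)"
  shows "\<nu> (lin_ext f (chain xs)) \<le> L * cost 1 xs"
proof (induction xs)
  case (Cons z xs)
  obtain c x y where z: "z = (c, x, y)" by (cases z)
  have "\<nu> (lin_ext f (chain (z # xs))) \<le> \<nu> (c *\<^sub>R (f x - f y)) + \<nu> (lin_ext f (chain xs))"
    using triangle[of "c *\<^sub>R (f x - f y)" "lin_ext f (chain xs)"] by (simp add: z chain_Cons lin_ext_simps)
  also have "\<nu> (c *\<^sub>R (f x - f y)) \<le> \<bar>c\<bar> powr q * (L * \<nu> (x - y))"
    unfolding scale by (intro mult_left_mono f) auto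
  finally show ?case using Cons by (simp add: cost_Cons z weight_def algebra_simps)
qed (simp add: lin_ext_simps)

lemma card_keys_chain: "card (Poly_Mapping.keys (chain xs)) \<le> 2 * length xs"
proof -
  have "card (\<Union>(c, x, y)\<in>set xs. {x, y}) \<le> (\<Sum>z\<in>set xs. card (case z of (c, x, y) \<Rightarrow> {x, y}))"
    by (rule card_UN_le) simp
  also have "\<dots> \<le> (\<Sum>z\<in>set xs. 2)" by (rule sum_mono) (auto simp: card_insert_if)
  also have "\<dots> \<le> 2 * length xs" using card_length[of xs] by simp
  finally have "card (\<Union>(c, x, y)\<in>set xs. {x, y}) \<le> 2 * length xs" .
  moreover have "card (Poly_Mapping.keys (chain xs)) \<le> card (\<Union>(c, x, y)\<in>set xs. {x, y})"
    by (rule card_mono[OF _ keys_chain]) auto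
  ultimately show ?thesis by simp
qed

text \<open>Meant for quotient gauges, where two maps often agree only up to vectors of gauge
  0.\<close>

lemma lin_ext_gauge_zero:
  assumes "\<And>x. x \<in> Poly_Mapping.keys a \<Longrightarrow> \<nu> (\<phi> x - \<psi> x) = 0"
  shows "\<nu> (lin_ext \<phi> a) = \<nu> (lin_ext \<psi> a)"
proof -
  have "\<nu> (lin_ext (\<lambda>x. \<phi> x - \<psi> x) a) \<le> (\<Sum>x\<in>Poly_Mapping.keys a. \<nu> (Poly_Mapping.lookup a x *\<^sub>R (\<phi> x - \<psi> x)))"
    unfolding lin_ext_def by (rule sum_le)
  also have "\<dots> = 0" by (rule sum.neutral) (simp add: assms scale)
  finally show ?thesis using triangle_abs[of "lin_ext \<phi> a" "lin_ext \<psi> a"] by (simp add: lin_ext_diff)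
qed

section \<open>Distance to a finite set and cluster points\<close>

definition set_dist :: "'v set \<Rightarrow> 'v \<Rightarrow> real" where
  "set_dist A x = Min ((\<lambda>a. \<nu> (x - a)) ` A)"

lemma set_dist_le: "finite A \<Longrightarrow> a \<in> A \<Longrightarrow> set_dist A x \<le> \<nu> (x - a)"
  unfolding set_dist_def by (intro Min_le) auto

lemma set_dist_attained:
  assumes "finite A" "A \<noteq> {}"
  obtains a where "a \<in> A" "set_dist A x = \<nu> (x - a)"
proof -
  have "set_dist A x \<in> (\<lambda>a. \<nu> (x - a)) ` A" unfolding set_dist_def using assms by (intro Min_in) auto
  then show thesis using that by auto
qed

lemma set_dist_nonneg: "finite A \<Longrightarrow> A \<noteq> {} \<Longrightarrow> 0 \<le> set_dist A x"
  using set_dist_attained[of A x] nonneg by metis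

lemma set_dist_member: "finite A \<Longrightarrow> a \<in> A \<Longrightarrow> set_dist A a = 0"
  using set_dist_le[of A a a] set_dist_nonneg[of A a] by force

lemma set_dist_antimono: "finite B \<Longrightarrow> A \<subseteq> B \<Longrightarrow> A \<noteq> {} \<Longrightarrow> set_dist B x \<le> set_dist A x"
  unfolding set_dist_def by (intro Min_antimono) auto

lemma set_dist_lipschitz:
  assumes "finite A" "A \<noteq> {}"
  shows "\<bar>set_dist A x - set_dist A y\<bar> \<le> \<nu> (x - y)"
proof -
  have "set_dist A x \<le> set_dist A y + \<nu> (x - y)" for x y
  proof -
    obtain a where a: "a \<in> A" "set_dist A y = \<nu> (y - a)" using set_dist_attained[OF assms] .
    show ?thesis using set_dist_le[OF assms(1) a(1), of x] triangle3[of x a y] a(2) by linarith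
  qed
  from this[of x y] this[of y x] show ?thesis using commute[of x y] by linarith
qed

text \<open>If \<open>a\<close> is a nearest point of \<open>A\<close>, then \<open>f a\<close> lies
  in the span and may be subtracted. This supplies the growth bound that the random cuts
  require.\<close>

lemma mod_gauge_set_dist:
  assumes f: "\<And>x y. \<nu> (f x - f y) \<le> L * \<nu> (x - y)" and A: "finite A" "A \<noteq> {}"
  shows "mod_gauge (span (f ` A)) (f x) \<le> L * set_dist A x"
proof -
  obtain a where a: "a \<in> A" "set_dist A x = \<nu> (x - a)" using set_dist_attained[OF A] .
  have "mod_gauge (span (f ` A)) (f x) \<le> \<nu> (f x - f a)"
    using a by (intro mod_gauge_le span_base) auto
  then show ?thesis using f[of x a] a by simp
qed

lemma mod_gauge_diff:
  assumes f: "\<And>x y. \<nu> (f x - f y) \<le> L * \<nu> (x - y)" and E: "subspace E"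
  shows "mod_gauge E (f x - f y) \<le> L * \<nu> (x - y)"
  using mod_gauge_le_self[OF E, of "f x - f y"] f[of x y] by linarith

text \<open>The points of \<open>S n\<close> are listed as \<open>d\<close> sequences, padded with
  0, and a common subsequence makes each converge or escape. \<open>Z\<close> contains all the
  limits and 0; \<sigma> is a lower bound for all escape distances.\<close>

lemma cluster_points:
  assumes complete: "\<And>c. (\<forall>e>0. \<exists>n0. \<forall>m\<ge>n0. \<forall>n\<ge>n0. \<nu> (c m - c n) < e) \<Longrightarrow> \<exists>z. converges_to c z"
    and S: "\<And>n::nat. finite (S n)" "\<And>n. card (S n) \<le> d"
  obtains r :: "nat \<Rightarrow> nat" and Z \<sigma> where "strict_mono r" "finite Z" "0 \<in> Z" "0 < \<sigma>"
    "\<And>\<delta> A. 0 < \<delta> \<Longrightarrow> finite A \<Longrightarrow>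
      eventually (\<lambda>n. \<forall>x\<in>S (r n). (\<exists>z\<in>Z. \<nu> (x - z) < \<delta>) \<or> (\<forall>a\<in>A. \<sigma> \<le> \<nu> (x - a))) sequentially"
proof -
  have "\<exists>xs. set xs = S n \<and> length xs \<le> d" for n
    using finite_distinct_list[OF S(1)[of n]] S(2)[of n] by (metis distinct_card)
  then obtain ks where ks: "\<And>n. set (ks n) = S n" "\<And>n. length (ks n) \<le> d" by metis
  define P where "P = (\<lambda>i n. if i < length (ks n) then ks n ! i else 0)"
  have SP: "\<exists>i<d. x = P i n" if "x \<in> S n" for x n
    using that ks(1)[of n] ks(2)[of n] unfolding P_def by (metis in_set_conv_nth less_le_trans)
  obtain r :: "nat \<Rightarrow> nat" where r: "strict_mono r"
    "\<And>i. i < d \<Longrightarrow> (\<exists>z. converges_to (\<lambda>n. P i (r n)) z) \<or> (\<exists>\<sigma>>0. escapes \<sigma> (\<lambda>n. P i (r n)))"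
    using sequences_dichotomy[OF complete, of d P] by blast
  have "\<exists>z \<sigma>. 0 < \<sigma> \<and> (i < d \<longrightarrow> converges_to (\<lambda>n. P i (r n)) z \<or> escapes \<sigma> (\<lambda>n. P i (r n)))" for i
    using r(2)[of i] zero_less_one by blast
  then obtain z \<tau> where z\<tau>: "\<And>i. 0 < \<tau> i"
    "\<And>i. i < d \<Longrightarrow> converges_to (\<lambda>n. P i (r n)) (z i) \<or> escapes (\<tau> i) (\<lambda>n. P i (r n))" by metis
  define \<sigma> where "\<sigma> = Min (insert 1 (\<tau> ` {..<d}))"
  have \<sigma>: "0 < \<sigma>" "\<And>i. i < d \<Longrightarrow> \<sigma> \<le> \<tau> i" using z\<tau>(1) by (auto simp: \<sigma>_def)
  define Z where "Z = insert 0 (z ` {..<d})"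
  show thesis
  proof (rule that[OF r(1) _ _ \<sigma>(1)])
    show "finite Z" "0 \<in> Z" by (auto simp: Z_def)
    fix \<delta> :: real and A :: "'v set" assume \<delta>: "0 < \<delta>" and A: "finite A"
    have "eventually (\<lambda>n. (\<exists>z\<in>Z. \<nu> (P i (r n) - z) < \<delta>) \<or> (\<forall>a\<in>A. \<sigma> \<le> \<nu> (P i (r n) - a))) sequentially"
      if i: "i < d" for i
      using z\<tau>(2)[OF i]
    proof
      assume "converges_to (\<lambda>n. P i (r n)) (z i)"
      then have "eventually (\<lambda>n. \<nu> (P i (r n) - z i) < \<delta>) sequentially"
        unfolding converges_to_def using \<delta> by (rule order_tendstoD)
      then show ?thesis by eventually_elim (use i in \<open>auto simp: Z_def\<close>)
    next
      assume "escapes (\<tau> i) (\<lambda>n. P i (r n))"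
      then have "eventually (\<lambda>n. \<forall>a\<in>A. \<tau> i \<le> \<nu> (P i (r n) - a)) sequentially"
        using A by (simp add: escapes_def)
      then show ?thesis by eventually_elim (use \<sigma>(2)[OF i] order_trans in blast)
    qed
    then have "eventually (\<lambda>n. \<forall>i\<in>{..<d}. (\<exists>z\<in>Z. \<nu> (P i (r n) - z) < \<delta>) \<or> (\<forall>a\<in>A. \<sigma> \<le> \<nu> (P i (r n) - a))) sequentially"
      by (intro eventually_ball_finite) auto
    then show "eventually (\<lambda>n. \<forall>x\<in>S (r n). (\<exists>z\<in>Z. \<nu> (x - z) < \<delta>) \<or> (\<forall>a\<in>A. \<sigma> \<le> \<nu> (x - a))) sequentially"
      by eventually_elim (use SP in blast)
  qed
qed

end

text \<open>
  Assumption \<open>lift\<close> says that the extension of \<open>f\<close> to \<open>F\<close> is a left inverse of \<open>i\<close>.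
\<close>

locale lipschitz_lift = free_gauge \<nu> q p F NF D
  for \<nu> :: "'x::real_vector \<Rightarrow> real" and q p F and NF :: "'f::real_vector \<Rightarrow> real" and D :: "'x \<Rightarrow> 'f" +
  fixes f :: "'x \<Rightarrow> 'x" and i :: "'x \<Rightarrow> 'f" and L K\<^sub>i K\<^sub>P \<alpha> :: real
  assumes L: "0 \<le> L" and f: "\<nu> (f x - f y) \<le> L * \<nu> (x - y)" and f0: "f 0 = 0"
    and i: "linear i" "i x \<in> F" "NF (i x) powr p \<le> K\<^sub>i * \<nu> x powr (p / q)"
    and K: "0 \<le> K\<^sub>i" "0 \<le> K\<^sub>P"
    and lift: "\<nu> (x - lin_ext f a) \<le> K\<^sub>P * NF (i x - lin_ext D a) powr q"
    and \<alpha>: "p < q * \<alpha>" "\<alpha> < 1"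
begin

section \<open>Energies of disjointly supported pieces\<close>

lemma \<alpha>_pos: "0 < \<alpha>"
  using \<alpha> p q_pos by (metis less_trans zero_less_mult_pos)

lemma beta: "0 < p / q" "p / q < \<alpha>" "p / q < 1"
  using p q_pos \<alpha> by (auto simp: field_simps)

text \<open>The hypotheses of \<open>piece_bound\<close> for the quotient gauge of \<open>E\<close>,
  with \<open>b = 4\<close>. The 4 fits \<open>separated_pieces\<close>, where the radii are at most
  \<open>2 * R\<close> and the localization scale is \<open>R / 2\<close>.\<close>

definition good_piece :: "'x set \<Rightarrow> ('x \<Rightarrow> real) \<Rightarrow> ('x \<Rightarrow> real) \<Rightarrow> real \<Rightarrow> real \<Rightarrow> real \<Rightarrow> bool" where
  "good_piece E h k r r' s \<longleftrightarrow> subspace E \<and> (\<forall>x. mod_gauge E (f x) \<le> L * h x) \<and>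
     (\<forall>x y. \<bar>h x - h y\<bar> \<le> \<nu> (x - y)) \<and> (\<forall>x y. \<bar>k x - k y\<bar> \<le> \<nu> (x - y)) \<and>
     0 < r \<and> 0 < r' \<and> 0 < s \<and> ((\<forall>x. k x = 0) \<or> r \<le> 4 * s \<and> r' \<le> 4 * s)"

definition support :: "('x \<Rightarrow> real) \<Rightarrow> ('x \<Rightarrow> real) \<Rightarrow> real \<Rightarrow> real \<Rightarrow> real \<Rightarrow> 'x set" where
  "support h k r r' s = {x. \<exists>u v. 0 \<le> u \<and> u \<le> 1 \<and> 0 \<le> v \<and> v \<le> 1 \<and> piece f h k r r' s u v x \<noteq> 0}"

lemma supportD:
  assumes "x \<in> support h k r r' s" "0 < r" "0 < r'" "0 < s"
  shows "k x \<le> 2 * s" "min r r' < h x" "h x \<le> 2 * max r r'"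
proof -
  obtain u v where uv: "0 \<le> u" "u \<le> 1" "0 \<le> v" "v \<le> 1" "piece f h k r r' s u v x \<noteq> 0"
    using assms(1) by (auto simp: support_def)
  have b: "t \<le> t * (1 + w)" "t * (1 + w) \<le> 2 * t" if "0 < t" "0 \<le> w" "w \<le> 1" for t w :: real using that by auto
  have "k x \<le> s * (1 + u)" "(h x \<le> r * (1 + u)) \<noteq> (h x \<le> r' * (1 + v))"
    using uv(5) by (auto simp: piece_def cut_def split: if_splits)
  then show "k x \<le> 2 * s" "min r r' < h x" "h x \<le> 2 * max r r'"
    using b[OF assms(2) uv(1,2)] b[OF assms(3) uv(3,4)] b[OF assms(4) uv(1,2)] by linarith+
qed

abbreviation (input) energy where
  "energy E h k r r' s \<equiv> energy1 \<alpha> (mod_gauge E) (piece f h k r r' s)"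

text \<open>The 2 counts the endpoints of an edge, each lying in at most one support.\<close>

definition C\<^sub>E :: real where "C\<^sub>E = 2 * piece_const L 4 \<alpha>"

lemma C\<^sub>E_nonneg: "0 \<le> C\<^sub>E"
  unfolding C\<^sub>E_def using piece_const_nonneg[of 4 L \<alpha>] by simp

lemma gauge_energy: "good_piece E h k r r' s \<Longrightarrow> gauge (energy E h k r r' s) (q * \<alpha>)"
  unfolding good_piece_def using \<alpha> \<alpha>_pos
  by (intro gauge_energy1 gauge_mod_gauge step2_piece) auto

text \<open>Disjointness of the supports lets an edge meet at most two pieces, so the sum of all
  energies is one gauge whose edge constant does not depend on \<open>N\<close>.\<close>

lemma energies_bound:
  assumes good: "\<And>n::nat. n < N \<Longrightarrow> good_piece (E n) (h n) (k n) (r n) (r' n) (s n)"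
    and disj: "\<And>m n x. m < n \<Longrightarrow> n < N \<Longrightarrow> x \<in> support (h m) (k m) (r m) (r' m) (s m) \<Longrightarrow>
      x \<notin> support (h n) (k n) (r n) (r' n) (s n)"
  shows "(\<Sum>n<N. energy (E n) (h n) (k n) (r n) (r' n) (s n) a) \<le> C\<^sub>E * NF (lin_ext D a) powr (q * \<alpha>)" (is "?R a \<le> _")
    and "(\<Sum>n<N. energy (E n) (h n) (k n) (r n) (r' n) (s n) (chain xs)) \<le> C\<^sub>E * cost \<alpha> xs"
proof -
  note g = good[unfolded good_piece_def]
  have R: "gauge ?R (q * \<alpha>)" using q_pos \<alpha>_pos good by (intro gauge_sum gauge_energy) auto
  have pc: "0 \<le> piece_const L 4 \<alpha>" by (rule piece_const_nonneg) simp
  have edge: "?R (pt x - pt y) \<le> C\<^sub>E * \<nu> (x - y) powr \<alpha>" for x y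
  proof -
    have "?R (pt x - pt y) \<le> 2 * real 1 * (piece_const L 4 \<alpha> * \<nu> (x - y) powr \<alpha>)"
    proof (rule energy_edge[where U = "\<lambda>n. support (h n) (k n) (r n) (r' n) (s n)"])
      show "mean2 (\<lambda>u v. mod_gauge (E n) (piece f (h n) (k n) (r n) (r' n) (s n) u v x -
          piece f (h n) (k n) (r n) (r' n) (s n) u v y) powr \<alpha>) \<le> piece_const L 4 \<alpha> * \<nu> (x - y) powr \<alpha>"
        if "n \<in> {..<N}" for n
      proof -
        have n: "n < N" using that by simp
        interpret m: gauge "mod_gauge (E n)" q using g[OF n] by (intro gauge_mod_gauge) auto
        show ?thesis using g[OF n] \<alpha> \<alpha>_pos L mod_gauge_diff[OF f]
          by (intro m.piece_bound) auto
      qed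
      show "card {n \<in> {..<N}. z \<in> support (h n) (k n) (r n) (r' n) (s n)} \<le> 1" for z
        using disj[of _ _ z] by (auto simp: card_le_Suc0_iff_eq) (metis linorder_cases)
      show "gauge (mod_gauge (E n)) q" if "n \<in> {..<N}" for n
        using g[of n] that by (intro gauge_mod_gauge) auto
      show "step2 (\<lambda>u v. piece f (h n) (k n) (r n) (r' n) (s n) u v x)" if "n \<in> {..<N}" for n x
        using g[of n] that by (intro step2_piece) auto
      show "x \<in> support (h n) (k n) (r n) (r' n) (s n)"
        if "0 \<le> u" "u \<le> 1" "0 \<le> v" "v \<le> 1" "piece f (h n) (k n) (r n) (r' n) (s n) u v x \<noteq> 0" for n u v x
        using that by (auto simp: support_def)
    qed (use \<alpha> \<alpha>_pos pc in auto)
    then show ?thesis by (simp add: C\<^sub>E_def)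
  qed
  have R0: "?R (pt 0) = 0"
    using g by (auto intro!: sum.neutral simp: energy1_def piece_def f0 gauge.zero[OF gauge_mod_gauge])
  show "?R a \<le> C\<^sub>E * NF (lin_ext D a) powr (q * \<alpha>)"
    by (rule energy_bound[OF R \<alpha>_pos _ C\<^sub>E_nonneg edge R0]) (use \<alpha> in simp)
  show "?R (chain xs) \<le> C\<^sub>E * cost \<alpha> xs"
    by (rule gauge_chain_bound[OF R C\<^sub>E_nonneg edge])
qed

definition piece_seq :: "real \<Rightarrow> (nat \<Rightarrow> 'x \<Rightarrow>\<^sub>0 real) \<Rightarrow> (nat \<Rightarrow> nat) \<Rightarrow> (nat \<Rightarrow> 'x set) \<Rightarrow> (nat \<Rightarrow> 'x \<Rightarrow> real) \<Rightarrow>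
    (nat \<Rightarrow> 'x \<Rightarrow> real) \<Rightarrow> (nat \<Rightarrow> real) \<Rightarrow> (nat \<Rightarrow> real) \<Rightarrow> (nat \<Rightarrow> real) \<Rightarrow> bool" where
  "piece_seq c b idx E h k r r' s \<longleftrightarrow> strict_mono idx \<and>
     (\<forall>n. good_piece (E n) (h n) (k n) (r n) (r' n) (s n)) \<and>
     (\<forall>m n x. m < n \<longrightarrow> x \<in> support (h m) (k m) (r m) (r' m) (s m) \<longrightarrow> x \<notin> support (h n) (k n) (r n) (r' n) (s n)) \<and>
     (\<forall>n. c \<le> energy (E n) (h n) (k n) (r n) (r' n) (s n) (b (idx n)))"

text \<open>
  \<open>N\<close> disjointly supported pieces of energy at least \<open>c\<close> bound a signed sum of \<open>N\<close> lifts below by a multiple of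
  \<open>N\<close>, while the \<open>q\<close>-triangle inequality in the domain of \<open>i\<close> bounds it above by a multiple of \<open>N powr \<alpha>\<close>.
\<close>

lemma pieces_count:
  assumes \<xi>: "\<And>n::nat. \<nu> (\<xi> n) \<le> 1"
    and xs: "\<And>n. NF (i (\<xi> n) - lin_ext D (chain (xs n))) powr p \<le> (1/2) ^ n"
    and split: "\<And>n. chain (xs n) = b n + chain (sm n)" "\<And>n. C\<^sub>E * cost \<alpha> (sm n) \<le> c / 4"
    and pcs: "piece_seq c b idx E h k r r' s"
  shows "c * real N / 4 \<le> C\<^sub>E * (K\<^sub>i * real N powr (p / q) + 2) powr (q * \<alpha> / p)"
proof -
  have good: "good_piece (E n) (h n) (k n) (r n) (r' n) (s n)"
    and disj: "m < n \<Longrightarrow> x \<in> support (h m) (k m) (r m) (r' m) (s m) \<Longrightarrow> x \<notin> support (h n) (k n) (r n) (r' n) (s n)"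
    and big: "c \<le> energy (E n) (h n) (k n) (r n) (r' n) (s n) (b (idx n))" for m n x
    using pcs by (auto simp: piece_seq_def)
  have idx: "inj_on idx {..<N}"
    using pcs by (auto simp: piece_seq_def intro: inj_on_subset[OF strict_mono_imp_inj_on])
  define A where "A = (\<lambda>a. \<Sum>n<N. energy (E n) (h n) (k n) (r n) (r' n) (s n) a)"
  have gA: "gauge A (q * \<alpha>)" unfolding A_def using q_pos \<alpha>_pos good by (intro gauge_sum gauge_energy) auto
  interpret A: gauge A "q * \<alpha>" by fact
  obtain S where S: "(\<Sum>n<N. energy (E n) (h n) (k n) (r n) (r' n) (s n) (b (idx n))) / 2 \<le> A (sgn_sum {..<N} (\<lambda>n. b (idx n)) S)"
    unfolding A_def
    by (rule exists_signs[where I = "{..<N}" and a = "\<lambda>n. b (idx n)" and t = "q * \<alpha>"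
          and \<psi> = "\<lambda>n. energy (E n) (h n) (k n) (r n) (r' n) (s n)"])
      (use good gauge_energy in auto)
  define e where "e = (\<lambda>n. if n \<in> S then 1 else - 1 :: real)"
  have e: "\<bar>e n\<bar> = 1" for n by (simp add: e_def)
  have "c * real N / 2 \<le> (\<Sum>n<N. energy (E n) (h n) (k n) (r n) (r' n) (s n) (b (idx n))) / 2"
    using sum_mono[of "{..<N}" "\<lambda>_. c"] big by (simp add: mult.commute)
  also have "\<dots> \<le> A (sgn_sum {..<N} (\<lambda>n. b (idx n)) S)" by (rule S)
  \<comment> \<open>Back from the heavy parts to the full representations. The light parts use up at
    most c / 4 per index, half of the c / 2 secured by the signs.\<close>
  also have "sgn_sum {..<N} (\<lambda>n. b (idx n)) S =
      (\<Sum>n<N. e n *\<^sub>R chain (xs (idx n))) - (\<Sum>n<N. e n *\<^sub>R chain (sm (idx n)))"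
    unfolding sgn_sum_def sum_subtractf[symmetric]
    by (rule sum.cong) (auto simp: e_def split(1) scaleR_add_right)
  also have "A \<dots> \<le> A (\<Sum>n<N. e n *\<^sub>R chain (xs (idx n))) + A (\<Sum>n<N. e n *\<^sub>R chain (sm (idx n)))"
    by (rule A.triangle_diff)
  also have "A (\<Sum>n<N. e n *\<^sub>R chain (sm (idx n))) \<le> c / 4 * real N"
  proof -
    have "A (\<Sum>n<N. e n *\<^sub>R chain (sm (idx n))) \<le> (\<Sum>n<N. A (e n *\<^sub>R chain (sm (idx n))))" by (rule A.sum_le)
    also have "\<dots> \<le> (\<Sum>n<N. c / 4)"
    proof (rule sum_mono)
      fix n
      have "A (e n *\<^sub>R chain (sm (idx n))) = A (chain (sm (idx n)))" by (simp add: A.scale e)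
      also have "\<dots> \<le> C\<^sub>E * cost \<alpha> (sm (idx n))" unfolding A_def by (rule energies_bound(2)[OF good disj])
      also have "\<dots> \<le> c / 4" by (rule split(2))
      finally show "A (e n *\<^sub>R chain (sm (idx n))) \<le> c / 4" .
    qed
    finally show ?thesis by (simp add: mult.commute)
  qed
  also have "A (\<Sum>n<N. e n *\<^sub>R chain (xs (idx n))) \<le> C\<^sub>E * (K\<^sub>i * real N powr (p / q) + 2) powr (q * \<alpha> / p)"
  proof -
    let ?a = "\<Sum>n<N. e n *\<^sub>R chain (xs (idx n))" and ?x = "\<Sum>n<N. e n *\<^sub>R \<xi> (idx n)"
    let ?d = "\<lambda>n. lin_ext D (chain (xs (idx n))) - i (\<xi> (idx n))"
    have dF: "?d n \<in> F" for n using lin_ext_D i(2) subF by (simp add: subspace_diff)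
    have edF: "e n *\<^sub>R ?d n \<in> F" for n using dF subF by (simp add: subspace_scale)
    \<comment> \<open>Linearity of \<open>i\<close> turns the signed sum of lifts into the lift of a
      signed sum, whose gauge is at most \<open>N\<close>; the rest is approximation error.\<close>
    have eq: "lin_ext D ?a = i ?x + (\<Sum>n<N. e n *\<^sub>R ?d n)"
      by (simp add: lin_ext_simps linear_sum[OF i(1)] linear_scale[OF i(1)] scaleR_diff_right sum_subtractf)
    have "NF (lin_ext D ?a) powr p \<le> NF (i ?x) powr p + NF (\<Sum>n<N. e n *\<^sub>R ?d n) powr p"
      unfolding eq by (intro NF_triangle i(2) subspace_sum[OF subF edF])
    also have "NF (\<Sum>n<N. e n *\<^sub>R ?d n) powr p \<le> (\<Sum>n<N. NF (e n *\<^sub>R ?d n) powr p)"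
      by (rule NF_sum) (use edF in auto)
    also have "\<dots> \<le> (\<Sum>n<N. (1/2) ^ idx n)"
    proof (rule sum_mono)
      fix n
      have "NF (e n *\<^sub>R ?d n) = NF (i (\<xi> (idx n)) - lin_ext D (chain (xs (idx n))))"
        using s_BanachD(6)[OF F dF] e norm_minus_commute_on[OF F i(2) lin_ext_D] by simp
      then show "NF (e n *\<^sub>R ?d n) powr p \<le> (1/2) ^ idx n" using xs by simp
    qed
    \<comment> \<open>Since the indices are distinct, the errors are bounded by the whole geometric
      series, with sum 2, for every \<open>N\<close>.\<close>
    also have "\<dots> = (\<Sum>m\<in>idx ` {..<N}. (1/2) ^ m)" using idx by (simp add: sum.reindex)
    also have "\<dots> \<le> suminf (\<lambda>m. (1/2) ^ m)" by (rule sum_le_suminf) (auto intro: summable_geometric)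
    also have "\<dots> = 2" by (simp add: suminf_geometric)
    also have "NF (i ?x) powr p \<le> K\<^sub>i * real N powr (p / q)"
    proof -
      have "\<nu> ?x \<le> (\<Sum>n<N. \<nu> (e n *\<^sub>R \<xi> (idx n)))" by (rule sum_le)
      also have "\<dots> \<le> (\<Sum>n<N. 1)" by (rule sum_mono) (use \<xi> e in \<open>simp add: scale\<close>)
      finally have "\<nu> ?x powr (p / q) \<le> real N powr (p / q)" using beta by (intro powr_mono2) auto
      then show ?thesis using i(3)[of ?x] mult_left_mono[OF _ K(1)] by (meson order_trans)
    qed
    finally have "NF (lin_ext D ?a) powr p \<le> K\<^sub>i * real N powr (p / q) + 2" by simp
    then have "(NF (lin_ext D ?a) powr p) powr (q * \<alpha> / p) \<le> (K\<^sub>i * real N powr (p / q) + 2) powr (q * \<alpha> / p)"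
      using p q_pos \<alpha>_pos by (intro powr_mono2) auto
    then have "NF (lin_ext D ?a) powr (q * \<alpha>) \<le> (K\<^sub>i * real N powr (p / q) + 2) powr (q * \<alpha> / p)"
      using p by (simp add: powr_powr)
    moreover have "A ?a \<le> C\<^sub>E * NF (lin_ext D ?a) powr (q * \<alpha>)"
      unfolding A_def by (rule energies_bound(1)[OF good disj])
    ultimately show ?thesis using mult_left_mono[OF _ C\<^sub>E_nonneg] by (meson order_trans)
  qed
  finally show ?thesis by simp
qed

text \<open>The right-hand side grows like N powr \<alpha>, because the exponents p / q and q *
  \<alpha> / p multiply to \<alpha>, and \<alpha> < 1.\<close>

lemma count_bounded:
  assumes c: "0 < c" and bound: "\<And>N::nat. c * real N / 4 \<le> C\<^sub>E * (K\<^sub>i * real N powr (p / q) + 2) powr (q * \<alpha> / p)"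
  shows False
proof -
  define M where "M = 4 * C\<^sub>E * (K\<^sub>i + 2) powr (q * \<alpha> / p) / c"
  have M: "real N powr (1 - \<alpha>) \<le> M" if N: "N \<ge> 1" for N :: nat
  proof -
    have N1: "1 \<le> real N powr (p / q)" using N beta by (intro ge_one_powr_ge_zero) auto
    have "c * real N / 4 \<le> C\<^sub>E * (K\<^sub>i * real N powr (p / q) + 2) powr (q * \<alpha> / p)" by (rule bound)
    also have "\<dots> \<le> C\<^sub>E * ((K\<^sub>i + 2) * real N powr (p / q)) powr (q * \<alpha> / p)"
      using N1 K C\<^sub>E_nonneg p q_pos \<alpha>_pos
      by (intro mult_left_mono powr_mono2) (auto simp: distrib_right add_nonneg_nonneg)
    also have "\<dots> = C\<^sub>E * (K\<^sub>i + 2) powr (q * \<alpha> / p) * real N powr \<alpha>"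
      using K p q_pos by (simp add: powr_mult powr_powr)
    finally have "c * (real N powr \<alpha> * real N powr (1 - \<alpha>)) \<le> 4 * (C\<^sub>E * (K\<^sub>i + 2) powr (q * \<alpha> / p) * real N powr \<alpha>)"
      using N by (simp add: powr_add[symmetric])
    then have "real N powr \<alpha> * (c * real N powr (1 - \<alpha>)) \<le> real N powr \<alpha> * (4 * C\<^sub>E * (K\<^sub>i + 2) powr (q * \<alpha> / p))"
      by (simp add: algebra_simps)
    then have "c * real N powr (1 - \<alpha>) \<le> 4 * C\<^sub>E * (K\<^sub>i + 2) powr (q * \<alpha> / p)"
      using N by (subst (asm) mult_le_cancel_left_pos) auto
    then show ?thesis using c by (simp add: M_def field_simps)
  qed
  have M0: "0 \<le> M" using C\<^sub>E_nonneg c by (simp add: M_def)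
  obtain N :: nat where N: "real N > (M + 1) powr (1 / (1 - \<alpha>)) + 1" using reals_Archimedean2 by blast
  then have "N \<ge> 1" by (smt (verit) powr_ge_zero of_nat_1 of_nat_le_iff)
  have "M + 1 = ((M + 1) powr (1 / (1 - \<alpha>))) powr (1 - \<alpha>)" using M0 \<alpha> by (simp add: powr_powr)
  also have "\<dots> \<le> real N powr (1 - \<alpha>)" using N \<alpha> by (intro powr_mono2) auto
  also have "\<dots> \<le> M" by (rule M[OF \<open>N \<ge> 1\<close>])
  finally show False by simp
qed

end

section \<open>Construction of sequences of pieces and the contradiction\<close>

context lipschitz_lift
begin

lemma good_piece_set_dist:
  assumes "finite A" "A \<noteq> {}" "0 < r" "0 < r'" "0 < s"
  shows "good_piece (span (f ` A)) (set_dist A) (\<lambda>_. 0) r r' s"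
    and "finite B \<Longrightarrow> B \<noteq> {} \<Longrightarrow> r \<le> 4 * s \<Longrightarrow> r' \<le> 4 * s \<Longrightarrow>
      good_piece (span (f ` A)) (set_dist A) (set_dist B) r r' s"
  unfolding good_piece_def
  using assms mod_gauge_set_dist[OF f assms(1,2)] set_dist_lipschitz[OF assms(1,2)] set_dist_lipschitz[of B]
  by auto

text \<open>Clusters shrinking to a finite set \<open>Z\<close> occupy, along a subsequence, disjoint annuli around \<open>Z\<close>.\<close>

lemma shrinking_pieces:
  assumes Z: "finite Z" "Z \<noteq> {}" and \<sigma>: "0 < \<sigma>" and c: "0 \<le> c"
    and tail: "\<And>\<delta>. 0 < \<delta> \<Longrightarrow> eventually (\<lambda>n. \<forall>x\<in>Poly_Mapping.keys (b n). set_dist Z x < \<delta> \<or> \<sigma> \<le> set_dist Z x) sequentially"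
    and freq: "\<exists>\<^sub>F n in sequentially. c \<le> mod_gauge (span (f ` Z)) (lin_ext (\<lambda>x. if set_dist Z x \<le> \<sigma>/2 then f x else 0) (b n))"
  shows "\<exists>idx r r'. piece_seq (c powr \<alpha>) b idx (\<lambda>_. span (f ` Z)) (\<lambda>_. set_dist Z) (\<lambda>_ _. 0) r r' (\<lambda>_. 1)"
proof -
  define H where "H = set_dist Z"
  let ?E = "span (f ` Z)"
  define g where "g = (\<lambda>n. lin_ext (\<lambda>x. if H x \<le> \<sigma>/2 then f x else 0) (b n))"
  \<comment> \<open>Apart from points at distance 0 from \<open>Z\<close> and points beyond
    \<sigma>, everything lies in the annulus from \<open>2 * r'\<close> to \<open>r\<close>. As
    thresholds at most double a radius, and \<open>2 * r \<le> \<sigma>/2\<close>, every choice of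
    thresholds yields \<open>g m\<close> modulo the span.\<close>
  define Q where "Q = (\<lambda>(m, r, r'). 0 < r' \<and> r' < r \<and> 4 * r \<le> \<sigma> \<and> c \<le> mod_gauge ?E (g m) \<and>
    (\<forall>x\<in>Poly_Mapping.keys (b m). H x = 0 \<or> (2 * r' < H x \<and> H x \<le> r) \<or> \<sigma> \<le> H x))"
  have next_ex: "\<exists>m r'. m0 < m \<and> Q (m, \<rho>, r')" if \<rho>: "0 < \<rho>" "4 * \<rho> \<le> \<sigma>" for m0 and \<rho> :: real
  proof -
    have "\<exists>\<^sub>F n in sequentially. (c \<le> mod_gauge ?E (g n) \<and>
        (\<forall>x\<in>Poly_Mapping.keys (b n). H x < \<rho> \<or> \<sigma> \<le> H x)) \<and> m0 < n"
      using frequently_eventually_frequently[OF frequently_eventually_frequently[OF freq tail[OF \<rho>(1)]]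
          eventually_gt_at_top[of m0]] by (simp add: g_def H_def)
    then obtain m where m: "m0 < m" "c \<le> mod_gauge ?E (g m)"
      "\<And>x. x \<in> Poly_Mapping.keys (b m) \<Longrightarrow> H x < \<rho> \<or> \<sigma> \<le> H x"
      using frequently_ex by blast
    \<comment> \<open>A quarter of the least positive distance leaves strict room for doubling the
      inner radius; the inserted element keeps the set nonempty and
      \<open>r' < \<rho>\<close>.\<close>
    define T where "T = insert (\<rho>/2) ((\<lambda>x. H x / 4) ` {x \<in> Poly_Mapping.keys (b m). 0 < H x})"
    define r' where "r' = Min T"
    have T: "finite T" by (simp add: T_def)
    have "0 < r'" unfolding r'_def using T \<rho> by (subst Min_gr_iff) (auto simp: T_def)
    moreover have "r' \<le> \<rho>/2" unfolding r'_def using T by (rule Min_le) (simp add: T_def)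
    moreover have "2 * r' < H x" if x: "x \<in> Poly_Mapping.keys (b m)" "0 < H x" for x
    proof -
      have "r' \<le> H x / 4" unfolding r'_def using T by (rule Min_le) (use x in \<open>auto simp: T_def\<close>)
      then show ?thesis using x by simp
    qed
    moreover have "0 \<le> H x" for x unfolding H_def by (rule set_dist_nonneg[OF Z])
    ultimately have "Q (m, \<rho>, r')" unfolding Q_def using m \<rho>
      by (auto simp: less_le)
    then show ?thesis using m(1) by blast
  qed
  have st_ex: "\<exists>st. \<forall>n. Q (st n) \<and> (case st n of (m, r, r') \<Rightarrow> case st (Suc n) of (m2, r2, r2') \<Rightarrow> m < m2 \<and> 2 * r2 \<le> r')"
  proof (rule dependent_nat_choice)
    show "\<exists>st. Q st" using next_ex[of "\<sigma>/4" 0] \<sigma> by auto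
    fix st and n :: nat assume "Q st"
    obtain m r r' where st: "st = (m, r, r')" by (cases st)
    have "0 < r'/2" "4 * (r'/2) \<le> \<sigma>" using \<open>Q st\<close> by (auto simp: st Q_def)
    from next_ex[OF this, of m] obtain m2 r2' where m2: "m < m2" "Q (m2, r'/2, r2')" by blast
    show "\<exists>st'. Q st' \<and> (case st of (m, r, r') \<Rightarrow> case st' of (m2, r2, r2') \<Rightarrow> m < m2 \<and> 2 * r2 \<le> r')"
      by (rule exI[of _ "(m2, r'/2, r2')"]) (use m2 in \<open>simp add: st\<close>)
  qed
  obtain st where st_all: "\<forall>n. Q (st n) \<and> (case st n of (m, r, r') \<Rightarrow> case st (Suc n) of (m2, r2, r2') \<Rightarrow>
      m < m2 \<and> 2 * r2 \<le> r')"
    using st_ex by (rule exE)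
  note st = st_all[rule_format, THEN conjunct1] st_all[rule_format, THEN conjunct2]
  define idx r r' where "idx = (\<lambda>n. fst (st n))" and "r = (\<lambda>n. fst (snd (st n)))" and "r' = (\<lambda>n. snd (snd (st n)))"
  have st_eq: "st n = (idx n, r n, r' n)" for n by (simp add: idx_def r_def r'_def)
  have q: "0 < r' n" "r' n < r n" "4 * r n \<le> \<sigma>" "c \<le> mod_gauge ?E (g (idx n))"
    "\<And>x. x \<in> Poly_Mapping.keys (b (idx n)) \<Longrightarrow> H x = 0 \<or> (2 * r' n < H x \<and> H x \<le> r n) \<or> \<sigma> \<le> H x" for n
    using st(1)[of n] unfolding st_eq Q_def by auto
  have q2: "idx n < idx (Suc n)" "2 * r (Suc n) \<le> r' n" for n
    using st(2)[of n] unfolding st_eq by auto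
  have r0: "0 < r n" for n using q(1,2)[of n] by linarith
  have dec: "r' n \<le> r' m" if "m \<le> n" for m n
  proof (rule lift_Suc_antimono_le[of r', OF _ that])
    show "r' (Suc n) \<le> r' n" for n using q2(2)[of n] q(2)[of "Suc n"] r0[of "Suc n"] by linarith
  qed
  have "piece_seq (c powr \<alpha>) b idx (\<lambda>_. ?E) (\<lambda>_. set_dist Z) (\<lambda>_ _. 0) r r' (\<lambda>_. 1)"
    unfolding piece_seq_def
  proof (intro conjI allI impI)
    show "strict_mono idx" using q2(1) by (simp add: strict_mono_Suc_iff)
    show "good_piece ?E (set_dist Z) (\<lambda>_. 0) (r n) (r' n) 1" for n
      by (rule good_piece_set_dist(1)[OF Z r0 q(1)]) simp
    fix m n :: nat and x assume mn: "m < n" and x: "x \<in> support (set_dist Z) (\<lambda>_. 0) (r m) (r' m) 1"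
    obtain n' where n': "n = Suc n'" "m \<le> n'" using mn by (cases n) auto
    have "r' m < set_dist Z x" using supportD(2)[OF x r0 q(1)] q(2)[of m] by simp
    moreover have "2 * r n \<le> r' m" using q2(2)[of n'] dec[OF n'(2)] n' by simp
    ultimately show "x \<notin> support (set_dist Z) (\<lambda>_. 0) (r n) (r' n) 1"
      using supportD(3)[of x "set_dist Z" "\<lambda>_. 0" "r n" "r' n" 1] r0[of n] q(1,2)[of n] by force
  next
    fix n
    interpret m: gauge "mod_gauge ?E" q by (rule gauge_mod_gauge) simp
    show "c powr \<alpha> \<le> energy ?E (set_dist Z) (\<lambda>_. 0) (r n) (r' n) 1 (b (idx n))"
    proof (rule energy1_lower[OF \<alpha>_pos _ c])
      show "step2 (\<lambda>u v. piece f (set_dist Z) (\<lambda>_. 0) (r n) (r' n) 1 u v x)" for x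
        by (intro step2_piece r0 q(1)) simp
      fix u v :: real assume uv: "0 \<le> u" "u \<le> 1" "0 \<le> v" "v \<le> 1"
      have "mod_gauge ?E (lin_ext (piece f (set_dist Z) (\<lambda>_. 0) (r n) (r' n) 1 u v) (b (idx n))) = mod_gauge ?E (g (idx n))"
        unfolding g_def
      proof (rule m.lin_ext_gauge_zero)
        fix x assume x: "x \<in> Poly_Mapping.keys (b (idx n))"
        have b1: "r n \<le> r n * (1 + u)" "r n * (1 + u) \<le> 2 * r n" "r' n * (1 + v) \<le> 2 * r' n"
          using uv r0[of n] q(1)[of n] by auto
        have b2: "0 \<le> r n * (1 + u)" "0 \<le> r' n * (1 + v)"
          using uv r0[of n] q(1)[of n] by auto
        consider "H x = 0" | "2 * r' n < H x" "H x \<le> r n" | "\<sigma> \<le> H x" using q(5)[OF x] by blast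
        then show "mod_gauge ?E (piece f (set_dist Z) (\<lambda>_. 0) (r n) (r' n) 1 u v x - (if H x \<le> \<sigma>/2 then f x else 0)) = 0"
        proof cases
          case 1
          \<comment> \<open>At distance 0 from \<open>Z\<close> the piece vanishes whereas
            \<open>g\<close> retains \<open>f x\<close>; the difference is invisible modulo the
            span.\<close>
          then have "mod_gauge ?E (f x) \<le> 0" using mod_gauge_set_dist[OF f Z, of x] by (simp add: H_def)
          then have "mod_gauge ?E (f x) = 0" using m.nonneg[of "f x"] by linarith
          then show ?thesis using 1 b2 \<sigma> by (simp add: piece_def cut_def H_def[symmetric])
        next
          case 2
          then have "H x \<le> r n * (1 + u)" "\<not> H x \<le> r' n * (1 + v)" "H x \<le> \<sigma>/2"
            using b1 q(3)[of n] r0[of n] by linarith+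
          then show ?thesis using uv by (simp add: piece_def cut_def H_def[symmetric])
        next
          case 3
          then have "\<not> H x \<le> r n * (1 + u)" "\<not> H x \<le> r' n * (1 + v)" "\<not> H x \<le> \<sigma>/2"
            using b1 q(2,3)[of n] r0[of n] \<sigma> by linarith+
          then show ?thesis by (simp add: piece_def cut_def H_def[symmetric])
        qed
      qed
      then show "c \<le> mod_gauge ?E (lin_ext (piece f (set_dist Z) (\<lambda>_. 0) (r n) (r' n) 1 u v) (b (idx n)))"
        using q(4)[of n] by simp
    qed
  qed
  then show ?thesis by blast
qed

text \<open>
  A piece living near scale \<open>2 ^ j * \<kappa>\<close> from the points used before is localized near its own points.  If the
  scales do not decrease, a later piece, which keeps away from all earlier points, has disjoint support.
\<close>

lemma separated_pieces:
  assumes Z: "finite Z" "Z \<noteq> {}" and \<kappa>: "0 < \<kappa>"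
    and detect: "\<And>A m0. finite A \<Longrightarrow> Z \<subseteq> A \<Longrightarrow> \<exists>m j r. m0 < m \<and> (r = 2 ^ j * \<kappa> \<or> r = 2 * (2 ^ j * \<kappa>)) \<and>
      c \<le> energy (span (f ` A)) (set_dist A) (\<lambda>_. 0) r (2 ^ j * \<kappa>) 1 (b m)"
  shows "\<exists>idx E h k r r' s. piece_seq c b idx E h k r r' s"
proof -
  define Q where "Q = (\<lambda>(A, m, j, r). finite A \<and> Z \<subseteq> A \<and> (r = 2 ^ j * \<kappa> \<or> r = 2 * (2 ^ j * \<kappa>)) \<and>
      c \<le> energy (span (f ` A)) (set_dist A) (\<lambda>_. 0) r (2 ^ j * \<kappa>) 1 (b m))"
  have st_ex: "\<exists>st. \<forall>n. Q (st n) \<and> (case st n of (A, m, j, r) \<Rightarrow> case st (Suc n) of (A', m', j', r') \<Rightarrow>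
      m < m' \<and> A' = A \<union> Poly_Mapping.keys (b m))"
  proof (rule dependent_nat_choice)
    from detect[OF Z(1) order_refl, of 0] obtain m j r where d: "r = 2 ^ j * \<kappa> \<or> r = 2 * (2 ^ j * \<kappa>)"
      "c \<le> energy (span (f ` Z)) (set_dist Z) (\<lambda>_. 0) r (2 ^ j * \<kappa>) 1 (b m)" by blast
    have "Q (Z, m, j, r)" unfolding Q_def prod.case by (intro conjI Z order_refl d)
    then show "\<exists>st. Q st" by blast
    fix st and n :: nat assume "Q st"
    obtain A m j r where st: "st = (A, m, j, r)" by (cases st)
    let ?A = "A \<union> Poly_Mapping.keys (b m)"
    have A: "finite ?A" "Z \<subseteq> ?A" using \<open>Q st\<close> by (auto simp: Q_def st)
    from detect[OF A, of m] obtain m' j' r' where d: "m < m'" "r' = 2 ^ j' * \<kappa> \<or> r' = 2 * (2 ^ j' * \<kappa>)"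
      "c \<le> energy (span (f ` ?A)) (set_dist ?A) (\<lambda>_. 0) r' (2 ^ j' * \<kappa>) 1 (b m')" by blast
    have "Q (?A, m', j', r')" unfolding Q_def prod.case by (intro conjI A d(2,3))
    with d(1) show "\<exists>st'. Q st' \<and> (case st of (A, m, j, r) \<Rightarrow> case st' of (A', m', j', r') \<Rightarrow>
      m < m' \<and> A' = A \<union> Poly_Mapping.keys (b m))"
      by (intro exI[of _ "(?A, m', j', r')"]) (simp add: st)
  qed
  obtain st where st_all: "\<forall>n. Q (st n) \<and> (case st n of (A, m, j, r) \<Rightarrow> case st (Suc n) of (A', m', j', r') \<Rightarrow>
      m < m' \<and> A' = A \<union> Poly_Mapping.keys (b m))"
    using st_ex by (rule exE)
  note st = st_all[rule_format, THEN conjunct1] st_all[rule_format, THEN conjunct2]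
  define A idx j r where "A = (\<lambda>n. fst (st n))" and "idx = (\<lambda>n. fst (snd (st n)))"
    and "j = (\<lambda>n. fst (snd (snd (st n))))" and "r = (\<lambda>n. snd (snd (snd (st n))))"
  have st_eq: "st n = (A n, idx n, j n, r n)" for n by (simp add: A_def idx_def j_def r_def)
  have q: "finite (A n)" "Z \<subseteq> A n" "r n = 2 ^ j n * \<kappa> \<or> r n = 2 * (2 ^ j n * \<kappa>)"
    "c \<le> energy (span (f ` A n)) (set_dist (A n)) (\<lambda>_. 0) (r n) (2 ^ j n * \<kappa>) 1 (b (idx n))" for n
    using st(1)[of n] unfolding st_eq Q_def by auto
  have q2: "idx n < idx (Suc n)" "A (Suc n) = A n \<union> Poly_Mapping.keys (b (idx n))" for n
    using st(2)[of n] unfolding st_eq by auto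
  have ne: "A n \<noteq> {}" for n using q(2) Z(2) by blast
  have mono: "A m \<subseteq> A n" if "m \<le> n" for m n
    by (rule lift_Suc_mono_le[of A, OF _ that]) (use q2(2) in auto)
  obtain g :: "nat \<Rightarrow> nat" where g: "strict_mono g" "\<And>m n. m \<le> n \<Longrightarrow> j (g m) \<le> j (g n)"
    using monotone_nat_subseq[of j] by blast
  define R where "R = (\<lambda>n. 2 ^ j n * \<kappa>)"
  have R: "0 < R n" "r n = R n \<or> r n = 2 * R n" for n using \<kappa> q(3) by (auto simp: R_def)
  have r0: "0 < r n" "R n \<le> r n" "r n \<le> 2 * R n" for n using R[of n] by auto
  \<comment> \<open>The scale \<open>R / 2\<close> confines a support to distance
    \<open>R (g m)\<close> from \<open>A (Suc (g m))\<close>. A later support has distance more than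
    \<open>R (g n)\<close>, which is at least \<open>R (g m)\<close>, from the larger set
    \<open>A (g n)\<close>.\<close>
  have "piece_seq c b (\<lambda>n. idx (g n)) (\<lambda>n. span (f ` A (g n))) (\<lambda>n. set_dist (A (g n)))
      (\<lambda>n. set_dist (A (Suc (g n)))) (\<lambda>n. r (g n)) (\<lambda>n. R (g n)) (\<lambda>n. R (g n) / 2)"
    unfolding piece_seq_def
  proof (intro conjI allI impI)
    have "strict_mono idx" using q2(1) by (simp add: strict_mono_Suc_iff)
    then show "strict_mono (\<lambda>n. idx (g n))" using g(1) by (simp add: strict_mono_def)
    show "good_piece (span (f ` A (g n))) (set_dist (A (g n))) (set_dist (A (Suc (g n)))) (r (g n)) (R (g n)) (R (g n) / 2)" for n
      by (rule good_piece_set_dist(2)[OF q(1) ne]) (use r0[of "g n"] R(1)[of "g n"] q(1) ne in auto)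
    fix m n :: nat and x
    assume mn: "m < n" and x: "x \<in> support (set_dist (A (g m))) (set_dist (A (Suc (g m)))) (r (g m)) (R (g m)) (R (g m) / 2)"
    have "Suc (g m) \<le> g n" using g(1) mn by (simp add: Suc_le_eq strict_mono_def)
    have "set_dist (A (g n)) x \<le> set_dist (A (Suc (g m))) x"
      by (intro set_dist_antimono q(1) mono ne) fact
    also have "\<dots> \<le> R (g m)" using supportD(1)[OF x] r0[of "g m"] R(1)[of "g m"] by simp
    also have "\<dots> \<le> R (g n)" using g(2)[of m n] mn \<kappa> by (simp add: R_def)
    finally show "x \<notin> support (set_dist (A (g n))) (set_dist (A (Suc (g n)))) (r (g n)) (R (g n)) (R (g n) / 2)"
      using supportD(2)[of x "set_dist (A (g n))" "set_dist (A (Suc (g n)))" "r (g n)" "R (g n)" "R (g n) / 2"]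
        r0[of "g n"] R(1)[of "g n"] by auto
  next
    fix n
    \<comment> \<open>The vector's own points belong to \<open>A (Suc (g n))\<close>, where the
      localizing cut equals 1; localization changes the supports but not this energy.\<close>
    have "energy (span (f ` A (g n))) (set_dist (A (g n))) (set_dist (A (Suc (g n)))) (r (g n)) (R (g n)) (R (g n) / 2) (b (idx (g n))) =
      energy (span (f ` A (g n))) (set_dist (A (g n))) (\<lambda>_. 0) (r (g n)) (R (g n)) 1 (b (idx (g n)))"
    proof (rule energy1_cong, rule lin_ext_cong)
      fix u v x assume "x \<in> Poly_Mapping.keys (b (idx (g n)))"
      then have "set_dist (A (Suc (g n))) x = 0" using q2(2)[of "g n"] by (intro set_dist_member q(1)) auto
      then show "piece f (set_dist (A (g n))) (set_dist (A (Suc (g n)))) (r (g n)) (R (g n)) (R (g n) / 2) u v x =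
        piece f (set_dist (A (g n))) (\<lambda>_. 0) (r (g n)) (R (g n)) 1 u v x"
        using R(1)[of "g n"] by (simp add: piece_def cut_def zero_le_mult_iff)
    qed
    then show "c \<le> energy (span (f ` A (g n))) (set_dist (A (g n))) (set_dist (A (Suc (g n)))) (r (g n)) (R (g n)) (R (g n) / 2) (b (idx (g n)))"
      using q(4)[of "g n"] by (simp add: R_def)
  qed
  then show ?thesis by blast
qed

lemma small_powr: "0 < t \<Longrightarrow> 0 < \<epsilon> \<Longrightarrow> \<exists>x>0. \<forall>y. 0 < y \<longrightarrow> y \<le> x \<longrightarrow> y powr t \<le> \<epsilon>" for t \<epsilon> :: real
proof (intro exI conjI allI impI)
  fix y :: real assume a: "0 < t" "0 < \<epsilon>" "0 < y" "y \<le> \<epsilon> powr (1 / t)"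
  then have "y powr t \<le> (\<epsilon> powr (1 / t)) powr t" by (intro powr_mono2) auto
  then show "y powr t \<le> \<epsilon>" using a by (simp add: powr_powr)
qed simp

text \<open>If infinitely often a definite share of the image comes from points near the cluster set
  \<open>Z\<close>, shrinking annuli around \<open>Z\<close> give the pieces. Otherwise this share
  is eventually negligible, so for any finite set containing \<open>Z\<close> the image changes
  substantially between scale \<kappa> and infinity, and \<open>scale_detection\<close> finds a
  scale responsible for it.\<close>

theorem lift_impossible:
  assumes complete: "\<And>c. (\<forall>e>0. \<exists>n0. \<forall>m\<ge>n0. \<forall>n\<ge>n0. \<nu> (c m - c n) < e) \<Longrightarrow> \<exists>z. converges_to c z"
    and inf: "\<And>B. finite B \<Longrightarrow> \<exists>x. \<forall>e\<in>span B. \<nu> (x - e) \<noteq> 0"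
  shows False
proof -
  define \<beta> where "\<beta> = p / q"
  have \<beta>: "0 < \<beta>" "\<beta> < \<alpha>" "\<beta> < 1" using beta by (auto simp: \<beta>_def)
  obtain \<xi> :: "nat \<Rightarrow> 'x" where \<xi>: "\<And>n. \<nu> (\<xi> n) \<le> 1"
    "\<And>B. finite B \<Longrightarrow> eventually (\<lambda>n. mod_gauge (span B) (\<xi> n) \<ge> 1/16) sequentially"
    using far_sequence[OF inf] by blast
  define K\<^sub>1 where "K\<^sub>1 = K\<^sub>i + 1"
  have K\<^sub>1: "0 < K\<^sub>1" using K by (simp add: K\<^sub>1_def)
  have "\<exists>xs. cost \<beta> xs \<le> NF (i (\<xi> n)) powr p + (1/2) ^ n \<and> NF (i (\<xi> n) - lin_ext D (chain xs)) powr p \<le> (1/2) ^ n" for n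
    using representation[OF i(2), of "(1/2) ^ n" "\<xi> n"] unfolding \<beta>_def by (metis half_gt_zero_iff zero_less_one zero_less_power)
  then obtain xs where xs0: "\<And>n. cost \<beta> (xs n) \<le> NF (i (\<xi> n)) powr p + (1/2) ^ n"
    and xs: "\<And>n. NF (i (\<xi> n) - lin_ext D (chain (xs n))) powr p \<le> (1/2) ^ n" by metis
  have cost1: "cost \<beta> (xs n) \<le> K\<^sub>1" for n
  proof -
    have "\<nu> (\<xi> n) powr (p / q) \<le> 1" using \<xi>(1)[of n] beta powr_mono2[of "p / q" "\<nu> (\<xi> n)" 1] by simp
    then have "K\<^sub>i * \<nu> (\<xi> n) powr (p / q) \<le> K\<^sub>i" using K mult_left_mono[of _ 1 K\<^sub>i] by simp
    moreover have "(1/2 :: real) ^ n \<le> 1" by (rule power_le_one) auto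
    ultimately show ?thesis using xs0[of n] i(3)[of "\<xi> n"] by (simp add: K\<^sub>1_def)
  qed
  define K\<^sub>2 where "K\<^sub>2 = K\<^sub>1 powr (\<alpha> / \<beta>)"
  have cost2: "cost \<alpha> ys \<le> K\<^sub>2" if "cost \<beta> ys \<le> K\<^sub>1" for ys
  proof -
    have "cost \<alpha> ys \<le> cost \<beta> ys powr (\<alpha> / \<beta>)" using \<beta> by (intro cost_le_powr) auto
    also have "\<dots> \<le> K\<^sub>2" unfolding K\<^sub>2_def using that \<beta> by (intro powr_mono2) auto
    finally show ?thesis .
  qed
  \<comment> \<open>Here \<open>1/64\<close> is the size of the change, called \<open>gap\<close>
    below, to which \<open>scale_detection\<close> will be applied.\<close>
  obtain c3 where c3: "0 < c3" "(3 * c3) powr (1 / \<alpha> - 1) * (8 * piece_const L 1 \<alpha> * K\<^sub>2) < 1/64"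
  proof -
    define M where "M = 8 * piece_const L 1 \<alpha> * K\<^sub>2"
    have M: "0 \<le> M" using piece_const_nonneg[of 1 L \<alpha>] by (simp add: M_def K\<^sub>2_def)
    have "0 < 1 / \<alpha> - 1" using \<alpha>_pos \<alpha> by simp
    moreover have "0 < 1 / (128 * (M + 1))" using M by simp
    ultimately obtain x where x: "x > 0" "\<And>y. 0 < y \<Longrightarrow> y \<le> x \<Longrightarrow> y powr (1 / \<alpha> - 1) \<le> 1 / (128 * (M + 1))"
      using small_powr by metis
    have "x powr (1 / \<alpha> - 1) * M \<le> 1 / (128 * (M + 1)) * M" using x M by (intro mult_right_mono) auto
    also have "\<dots> < 1/64" using M by (simp add: field_simps)
    finally show thesis using that[of "x / 3"] x(1) by (simp add: M_def)
  qed
  define c where "c = min ((1/64) powr \<alpha>) c3"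
  have c: "0 < c" using c3 by (simp add: c_def)
  \<comment> \<open>The weight below which molecules are discarded. The first condition, possible as
    \<beta> < 1, keeps their image under \<open>f\<close> small; the second, possible as \<beta> <
    \<alpha>, keeps their energy within the c / 4 tolerated by \<open>pieces_count\<close>.\<close>
  obtain \<theta> where \<theta>: "0 < \<theta>" "L * (\<theta> powr (1 - \<beta>) * K\<^sub>1) \<le> 1/64" "C\<^sub>E * (\<theta> powr (\<alpha> - \<beta>) * K\<^sub>1) \<le> c / 4"
  proof -
    have p1: "0 < 1 - \<beta>" "0 < \<alpha> - \<beta>" using \<beta> by auto
    have p2: "0 < 1 / (64 * ((L + 1) * K\<^sub>1))" "0 < c / (4 * ((C\<^sub>E + 1) * K\<^sub>1))" using L C\<^sub>E_nonneg K\<^sub>1 c by (auto intro!: divide_pos_pos)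
    obtain x where x: "x > 0" "\<And>y. 0 < y \<Longrightarrow> y \<le> x \<Longrightarrow> y powr (1 - \<beta>) \<le> 1 / (64 * ((L + 1) * K\<^sub>1))"
      using small_powr[OF p1(1) p2(1)] by metis
    obtain y where y: "y > 0" "\<And>z. 0 < z \<Longrightarrow> z \<le> y \<Longrightarrow> z powr (\<alpha> - \<beta>) \<le> c / (4 * ((C\<^sub>E + 1) * K\<^sub>1))"
      using small_powr[OF p1(2) p2(2)] by metis
    define \<theta> where "\<theta> = min x y"
    have t: "0 < \<theta>" "\<theta> \<le> x" "\<theta> \<le> y" using x y by (auto simp: \<theta>_def)
    have "L * (\<theta> powr (1 - \<beta>) * K\<^sub>1) \<le> (L + 1) * (1 / (64 * ((L + 1) * K\<^sub>1)) * K\<^sub>1)"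
      using x(2)[OF t(1,2)] L K\<^sub>1 by (intro mult_mono) auto
    also have "\<dots> = ((L + 1) * K\<^sub>1) / (64 * ((L + 1) * K\<^sub>1))" by simp
    also have "\<dots> = 1/64"
    proof -
      have "L + 1 \<noteq> 0" "K\<^sub>1 \<noteq> 0" using L K\<^sub>1 by linarith+
      then show ?thesis by simp
    qed
    finally have 1: "L * (\<theta> powr (1 - \<beta>) * K\<^sub>1) \<le> 1/64" .
    have "C\<^sub>E * (\<theta> powr (\<alpha> - \<beta>) * K\<^sub>1) \<le> (C\<^sub>E + 1) * (c / (4 * ((C\<^sub>E + 1) * K\<^sub>1)) * K\<^sub>1)"
      using y(2)[OF t(1,3)] C\<^sub>E_nonneg K\<^sub>1 p2(2) by (intro mult_mono) (auto simp del: zero_less_divide_iff dest: less_imp_le)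
    also have "\<dots> = c / 4"
    proof -
      define w where "w = (C\<^sub>E + 1) * K\<^sub>1"
      have "w \<noteq> 0" using C\<^sub>E_nonneg K\<^sub>1 by (simp add: w_def add_nonneg_pos)
      moreover have "(C\<^sub>E + 1) * (c / (4 * w) * K\<^sub>1) = w * (c / (4 * w))"
        unfolding w_def by (simp only: mult_ac)
      moreover have "w * (c / (4 * w)) = c / 4" using \<open>w \<noteq> 0\<close> by simp
      ultimately show ?thesis unfolding w_def[symmetric] by (simp only:)
    qed
    finally have 2: "C\<^sub>E * (\<theta> powr (\<alpha> - \<beta>) * K\<^sub>1) \<le> c / 4" .
    show thesis using that[OF t(1) 1 2] .
  qed
  define bg sm where "bg = (\<lambda>n. filter (\<lambda>z. \<theta> \<le> weight z) (xs n))" and "sm = (\<lambda>n. filter (\<lambda>z. \<not> \<theta> \<le> weight z) (xs n))"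
  have split: "chain (xs n) = chain (bg n) + chain (sm n)" for n
    by (simp add: bg_def sm_def chain_partition)
  have sm_cost: "cost t (sm n) \<le> \<theta> powr (t - \<beta>) * K\<^sub>1" if "\<beta> \<le> t" for t n
  proof -
    have "cost t (sm n) \<le> \<theta> powr (t - \<beta>) * cost \<beta> (xs n)" unfolding sm_def by (rule cost_small[OF that \<theta>(1)])
    then show ?thesis using mult_left_mono[OF cost1[of n], of "\<theta> powr (t - \<beta>)"] by simp
  qed
  have sm1: "C\<^sub>E * cost \<alpha> (sm n) \<le> c / 4" for n
    using mult_left_mono[OF sm_cost[of \<alpha> n] C\<^sub>E_nonneg] \<beta> \<theta>(3) by simp
  have sm2: "\<nu> (lin_ext f (chain (sm n))) \<le> 1/64" for n
    using lin_ext_chain_le[OF f, of "sm n"] mult_left_mono[OF sm_cost[of 1 n] L] \<beta> \<theta>(2) by simp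
  have bg_cost: "cost \<alpha> (bg n) \<le> K\<^sub>2" for n
    by (rule cost2) (use cost_filter_le[of \<beta> _ "xs n"] cost1[of n] in \<open>auto simp: bg_def intro: order_trans\<close>)
  \<comment> \<open>A bound on the number of heavy molecules that is uniform in \<open>n\<close>,
    times two points each; \<open>cluster_points\<close> depends on it.\<close>
  define d where "d = 2 * nat \<lceil>K\<^sub>1 / \<theta> powr \<beta>\<rceil>"
  have card_bg: "card (Poly_Mapping.keys (chain (bg n))) \<le> d" for n
  proof -
    have "real (length (bg n)) * \<theta> powr \<beta> \<le> K\<^sub>1"
      using length_big[OF \<theta>(1) \<beta>(1), of "xs n"] cost1[of n] by (simp add: bg_def)
    then have "real (length (bg n)) \<le> K\<^sub>1 / \<theta> powr \<beta>" using \<theta>(1) by (simp add: field_simps)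
    then have "length (bg n) \<le> nat \<lceil>K\<^sub>1 / \<theta> powr \<beta>\<rceil>" by linarith
    then show ?thesis using card_keys_chain[of "bg n"] by (simp add: d_def)
  qed
  obtain \<rho> :: "nat \<Rightarrow> nat" and Z \<sigma> where \<rho>: "strict_mono \<rho>" and Z: "finite Z" "0 \<in> Z" and \<sigma>: "0 < \<sigma>"
    and cl: "\<And>\<delta> A. 0 < \<delta> \<Longrightarrow> finite A \<Longrightarrow> eventually (\<lambda>n. \<forall>x\<in>Poly_Mapping.keys (chain (bg (\<rho> n))).
      (\<exists>z\<in>Z. \<nu> (x - z) < \<delta>) \<or> (\<forall>a\<in>A. \<sigma> \<le> \<nu> (x - a))) sequentially"
    using cluster_points[OF complete, of "\<lambda>n. Poly_Mapping.keys (chain (bg n))" d] card_bg by auto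
  define b where "b = (\<lambda>n. chain (bg (\<rho> n)))"
  have Zne: "Z \<noteq> {}" using Z by blast
  have tail: "eventually (\<lambda>n. \<forall>x\<in>Poly_Mapping.keys (b n). set_dist Z x < \<delta> \<or> \<sigma> \<le> set_dist A x) sequentially"
    if "0 < \<delta>" "finite A" "A \<noteq> {}" for \<delta> A
    using cl[OF that(1,2)]
  proof eventually_elim
    case (elim n)
    show ?case
    proof
      fix x assume "x \<in> Poly_Mapping.keys (b n)"
      then have "(\<exists>z\<in>Z. \<nu> (x - z) < \<delta>) \<or> (\<forall>a\<in>A. \<sigma> \<le> \<nu> (x - a))" using elim by (simp add: b_def)
      then show "set_dist Z x < \<delta> \<or> \<sigma> \<le> set_dist A x"
        using set_dist_le[OF Z(1)] set_dist_attained[OF that(2,3)] by (metis le_less_trans)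
    qed
  qed
  have approx: "eventually (\<lambda>n. \<nu> (\<xi> (\<rho> n) - lin_ext f (b n)) \<le> 1/32) sequentially"
  proof -
    have e: "\<nu> (\<xi> n - lin_ext f (chain (bg n))) \<le> K\<^sub>P * ((1/2) ^ n) powr (q / p) + 1/64" for n
    proof -
      have "NF (i (\<xi> n) - lin_ext D (chain (xs n))) powr q = (NF (i (\<xi> n) - lin_ext D (chain (xs n))) powr p) powr (q / p)"
        using p by (simp add: powr_powr)
      also have "\<dots> \<le> ((1/2) ^ n) powr (q / p)" using xs[of n] p q_pos by (intro powr_mono2) auto
      finally have "\<nu> (\<xi> n - lin_ext f (chain (xs n))) \<le> K\<^sub>P * ((1/2) ^ n) powr (q / p)"
        using lift[of "\<xi> n" "chain (xs n)"] mult_left_mono[OF _ K(2)] by (meson order_trans)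
      then show ?thesis
        using triangle[of "\<xi> n - lin_ext f (chain (xs n))" "lin_ext f (chain (sm n))"] sm2[of n]
        by (simp add: split lin_ext_simps)
    qed
    have "(\<lambda>n. K\<^sub>P * ((1/2) ^ n) powr (q / p)) \<longlonglongrightarrow> K\<^sub>P * 0"
      using p q_pos by (intro tendsto_mult_left tendsto_zero_powrI[where b = "q / p"] LIMSEQ_realpow_zero) auto
    then have "(\<lambda>n. K\<^sub>P * ((1/2) ^ n) powr (q / p)) \<longlonglongrightarrow> 0" by simp
    then have "eventually (\<lambda>n. K\<^sub>P * ((1/2) ^ n) powr (q / p) < 1/64) sequentially"
      by (rule order_tendstoD) simp
    then have "eventually (\<lambda>n. \<nu> (\<xi> n - lin_ext f (chain (bg n))) \<le> 1/32) sequentially"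
    proof eventually_elim
      case (elim n)
      then show ?case using e[of n] by simp
    qed
    then show ?thesis unfolding b_def by (rule eventually_subseq[OF \<rho>])
  qed
  define near where "near = (\<lambda>n. lin_ext (\<lambda>x. if set_dist Z x \<le> \<sigma>/2 then f x else 0) (b n))"
  have "\<exists>idx E h k r r' s. piece_seq c b idx E h k r r' s"
  proof (cases "\<exists>\<^sub>F n in sequentially. 1/64 \<le> mod_gauge (span (f ` Z)) (near n)")
    case True
    have c0: "0 \<le> (1/64 :: real)" by simp
    obtain idx r r' where "piece_seq ((1/64) powr \<alpha>) b idx (\<lambda>_. span (f ` Z)) (\<lambda>_. set_dist Z) (\<lambda>_ _. 0) r r' (\<lambda>_. 1)"
      using shrinking_pieces[OF Z(1) Zne \<sigma> c0 tail[OF _ Z(1) Zne] True[unfolded near_def]] by blast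
    then have "piece_seq c b idx (\<lambda>_. span (f ` Z)) (\<lambda>_. set_dist Z) (\<lambda>_ _. 0) r r' (\<lambda>_. 1)"
      unfolding piece_seq_def c_def by (meson min.coboundedI1)
    then show ?thesis by blast
  next
    case False
    then have far: "eventually (\<lambda>n. mod_gauge (span (f ` Z)) (near n) < 1/64) sequentially"
      by (simp add: frequently_def not_le)
    \<comment> \<open>All scales from \<kappa> to \<open>2 * \<kappa> = \<sigma>/2\<close> lie
      between the points within \<kappa> of \<open>Z\<close> and those beyond \<sigma>, so cutting
      at any of them leaves exactly \<open>near\<close>.\<close>
    define \<kappa> where "\<kappa> = \<sigma> / 4"
    have \<kappa>: "0 < \<kappa>" using \<sigma> by (simp add: \<kappa>_def)
    have "\<exists>m j r. m0 < m \<and> (r = 2 ^ j * \<kappa> \<or> r = 2 * (2 ^ j * \<kappa>)) \<and>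
      c3 \<le> energy (span (f ` A)) (set_dist A) (\<lambda>_. 0) r (2 ^ j * \<kappa>) 1 (b m)" if A: "finite A" "Z \<subseteq> A" for A m0
    proof -
      let ?E = "span (f ` A)"
      interpret m: gauge "mod_gauge ?E" q by (rule gauge_mod_gauge) simp
      have Ane: "A \<noteq> {}" using A Zne by blast
      have "eventually (\<lambda>n. mod_gauge ?E (\<xi> (\<rho> n)) \<ge> 1/16) sequentially"
        using A(1) by (intro eventually_subseq[OF \<rho>] \<xi>(2)) auto
      with far approx tail[OF \<kappa> A(1) Ane] eventually_gt_at_top[of m0]
      have "eventually (\<lambda>n. m0 < n \<and> mod_gauge ?E (\<xi> (\<rho> n)) \<ge> 1/16 \<and> mod_gauge (span (f ` Z)) (near n) < 1/64 \<and>
        \<nu> (\<xi> (\<rho> n) - lin_ext f (b n)) \<le> 1/32 \<and>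
        (\<forall>x\<in>Poly_Mapping.keys (b n). set_dist Z x < \<kappa> \<or> \<sigma> \<le> set_dist A x)) sequentially"
        by eventually_elim simp
      then obtain m where m: "m0 < m" "mod_gauge ?E (\<xi> (\<rho> m)) \<ge> 1/16" "mod_gauge (span (f ` Z)) (near m) < 1/64"
        "\<nu> (\<xi> (\<rho> m) - lin_ext f (b m)) \<le> 1/32"
        "\<And>x. x \<in> Poly_Mapping.keys (b m) \<Longrightarrow> set_dist Z x < \<kappa> \<or> \<sigma> \<le> set_dist A x"
        using eventually_happens'[OF sequentially_bot] by blast
      have near_le: "mod_gauge ?E (near m) < 1/64"
        using mod_gauge_antimono[OF subspace_span span_mono[OF image_mono[OF A(2)]], of f "near m"] m(3) by linarith
      have "mod_gauge ?E (\<xi> (\<rho> m) - lin_ext f (b m)) \<le> 1/32"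
        using mod_gauge_le_self[of ?E "\<xi> (\<rho> m) - lin_ext f (b m)"] m(4) by simp
      then have "mod_gauge ?E (lin_ext f (b m)) \<ge> 1/32"
        using m.triangle_rev[of "\<xi> (\<rho> m)" "lin_ext f (b m)"] m(2) by linarith
      \<comment> \<open>The budget: \<open>1/16\<close> from \<open>far_sequence\<close>, minus
        \<open>1/32\<close> for replacing the vector by the image of its heavy part, minus
        \<open>1/64\<close> for \<open>near\<close>.\<close>
      then have gap: "1/64 \<le> mod_gauge ?E (lin_ext f (b m) - near m)"
        using m.triangle_rev[of "lin_ext f (b m)" "near m"] near_le by linarith
      define \<Phi> where "\<Phi> = (\<lambda>\<tau>. lin_ext (\<lambda>x. if set_dist A x \<le> \<tau> then f x else 0) (chain (bg (\<rho> m))))"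
      obtain J :: nat where J: "\<And>x. x \<in> Poly_Mapping.keys (b m) \<Longrightarrow> set_dist A x \<le> 2 ^ J * \<kappa>"
      proof -
        define H where "H = Max (set_dist A ` Poly_Mapping.keys (b m))"
        have H: "set_dist A x \<le> H" if "x \<in> Poly_Mapping.keys (b m)" for x
          unfolding H_def using that by (intro Max_ge) auto
        obtain J :: nat where "H / \<kappa> < 2 ^ J" using real_arch_pow[of 2 "H / \<kappa>"] by auto
        then have "H \<le> 2 ^ J * \<kappa>" using \<kappa> by (simp add: field_simps)
        then show thesis using that[of J] H order_trans by blast
      qed
      have Phi_low: "\<Phi> \<tau> = near m" if "\<kappa> \<le> \<tau>" "\<tau> \<le> 2 * \<kappa>" for \<tau>
        unfolding \<Phi>_def near_def b_def
      proof (rule lin_ext_cong)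
        fix x assume "x \<in> Poly_Mapping.keys (chain (bg (\<rho> m)))"
        then have "set_dist Z x < \<kappa> \<or> \<sigma> \<le> set_dist A x" using m(5) by (simp add: b_def)
        moreover have "set_dist A x \<le> set_dist Z x" by (rule set_dist_antimono[OF A Zne])
        ultimately have "(set_dist A x \<le> \<tau>) = (set_dist Z x \<le> \<sigma>/2)"
          using that \<sigma> by (auto simp: \<kappa>_def)
        then show "(if set_dist A x \<le> \<tau> then f x else 0) = (if set_dist Z x \<le> \<sigma>/2 then f x else 0)" by simp
      qed
      have Phi_high: "\<Phi> \<tau> = lin_ext f (b m)" if "2 ^ J * \<kappa> \<le> \<tau>" for \<tau>
        unfolding \<Phi>_def b_def
        by (rule lin_ext_cong) (use J that in \<open>force simp: b_def\<close>)
      obtain j r where jr: "r = 2 ^ j * \<kappa> \<or> r = 2 * (2 ^ j * \<kappa>)"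
        "c3 \<le> energy1 \<alpha> (mod_gauge ?E) (piece f (set_dist A) (\<lambda>_. 0) r (2 ^ j * \<kappa>) 1) (chain (bg (\<rho> m)))"
      proof (rule scale_detection[OF m.gauge_axioms \<alpha>_pos \<alpha>(2) L \<kappa> _ _ _ \<Phi>_def _ bg_cost c3])
        show "mod_gauge ?E (f x - f y) \<le> L * \<nu> (x - y)" for x y by (rule mod_gauge_diff[OF f]) simp
        show "mod_gauge ?E (f x) \<le> L * set_dist A x" for x by (rule mod_gauge_set_dist[OF f A(1) Ane])
        show "\<bar>set_dist A x - set_dist A y\<bar> \<le> \<nu> (x - y)" for x y by (rule set_dist_lipschitz[OF A(1) Ane])
        show "1/64 \<le> mod_gauge ?E (\<Phi> \<tau>' - \<Phi> \<tau>)" if "\<kappa> \<le> \<tau>" "\<tau> \<le> 2 * \<kappa>" "2 ^ J * \<kappa> \<le> \<tau>'" for \<tau> \<tau>'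
          using gap Phi_low[OF that(1,2)] Phi_high[OF that(3)] by simp
      qed blast
      then show ?thesis using m(1) unfolding b_def by blast
    qed
    then have "\<exists>m j r. m0 < m \<and> (r = 2 ^ j * \<kappa> \<or> r = 2 * (2 ^ j * \<kappa>)) \<and>
      c \<le> energy (span (f ` A)) (set_dist A) (\<lambda>_. 0) r (2 ^ j * \<kappa>) 1 (b m)" if "finite A" "Z \<subseteq> A" for A m0
      using that unfolding c_def by (meson min.coboundedI2)
    from separated_pieces[OF Z(1) Zne \<kappa> this] show ?thesis .
  qed
  then obtain idx E h k r r' s where pcs: "piece_seq c b idx E h k r r' s" by blast
  then have pcs': "piece_seq c (\<lambda>n. chain (bg n)) (\<lambda>n. \<rho> (idx n)) E h k r r' s"
    using \<rho> by (simp add: piece_seq_def b_def strict_mono_def)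
  have "c * real N / 4 \<le> C\<^sub>E * (K\<^sub>i * real N powr (p / q) + 2) powr (q * \<alpha> / p)" for N
    by (rule pieces_count[OF \<xi>(1) xs split sm1 pcs'])
  then show False by (rule count_bounded[OF c])
qed

end

section \<open>The barycenter sequence\<close>

lemma keys_in_subspace: "subspace {a :: 'x \<Rightarrow>\<^sub>0 real. Poly_Mapping.keys a \<subseteq> X}"
  unfolding subspace_def
proof (intro conjI ballI allI CollectI)
  fix a b :: "'x \<Rightarrow>\<^sub>0 real"
  assume "a \<in> {a. Poly_Mapping.keys a \<subseteq> X}" "b \<in> {a. Poly_Mapping.keys a \<subseteq> X}"
  then show "Poly_Mapping.keys (a + b) \<subseteq> X" using Poly_Mapping.keys_add[of a b] by blast
qed (auto simp: in_keys_iff lookup_scaleR)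

lemma s_Banach_gauge:
  assumes X: "s_Banach q X N" and \<pi>: "linear \<pi>" "range \<pi> \<subseteq> X"
  shows "gauge (\<lambda>x. N (\<pi> x) powr q) q"
proof
  fix x y and c :: real
  have in_X: "\<pi> x \<in> X" "\<pi> y \<in> X" using \<pi> by auto
  show "0 < q" by (rule s_BanachD(1)[OF X])
  show "0 \<le> N (\<pi> x) powr q" by simp
  show "N (\<pi> (x + y)) powr q \<le> N (\<pi> x) powr q + N (\<pi> y) powr q"
    unfolding linear_add[OF \<pi>(1)] by (rule s_BanachD(7)[OF X in_X])
  show "N (\<pi> (c *\<^sub>R x)) powr q = \<bar>c\<bar> powr q * N (\<pi> x) powr q"
    unfolding linear_scale[OF \<pi>(1)] s_BanachD(6)[OF X in_X(1)] by (simp add: powr_mult)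
qed

text \<open>
  A linear projection \<open>\<pi>\<close> of the whole type onto \<open>X\<close> extends norm and \<open>\<delta>\<close>, which makes the membership conditions of
  the general lemmas superfluous.
\<close>

lemma lipschitz_free_free_gauge:
  fixes X :: "'x::real_vector set" and \<delta> :: "'x \<Rightarrow> 'f::real_vector"
  assumes X: "s_Banach q X N" and p: "0 < p" "p < q"
    and free: "lipschitz_free p X (qdist N) 0 F NF \<delta>"
    and \<pi>: "linear \<pi>" "range \<pi> \<subseteq> X" "\<And>x. x \<in> X \<Longrightarrow> \<pi> x = x"
  shows "free_gauge (\<lambda>x. N (\<pi> x) powr q) q p F NF (\<lambda>x. \<delta> (\<pi> x))"
proof -
  define \<nu> where "\<nu> = (\<lambda>x. N (\<pi> x) powr q)"
  define D where "D = (\<lambda>x. \<delta> (\<pi> x))"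
  have F: "s_Banach p F NF" and \<delta>F: "\<delta> ` X \<subseteq> F" and \<delta>0: "\<delta> 0 = 0"
    and dense: "\<And>v e. v \<in> F \<Longrightarrow> e > 0 \<Longrightarrow> \<exists>w\<in>span (\<delta> ` X). NF (v - w) < e"
    using free by (auto simp: lipschitz_free_def)
  note subX = s_BanachD(3)[OF X]
  have \<pi>X: "\<pi> x \<in> X" for x using \<pi>(2) by auto
  have nn: "0 \<le> N (\<pi> x)" for x using s_BanachD(4)[OF X \<pi>X] .
  have \<nu>p: "\<nu> x powr (p / q) = N (\<pi> x) powr p" for x using p by (simp add: \<nu>_def powr_powr)
  interpret gauge \<nu> q unfolding \<nu>_def by (rule s_Banach_gauge[OF X \<pi>(1,2)])
  have "free_gauge \<nu> q p F NF D"
  proof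
    show "0 < p" "p < q" "s_Banach p F NF" by fact+
    show "D x \<in> F" for x using \<delta>F \<pi>X by (auto simp: D_def)
    show "D 0 = 0" by (simp add: D_def linear_0[OF \<pi>(1)] \<delta>0)
  next
    fix v and e :: real assume "v \<in> F" "0 < e"
    then obtain w where w: "w \<in> span (\<delta> ` X)" "NF (v - w) < e" using dense by blast
    have "span (\<delta> ` X) \<subseteq> range (lin_ext D)"
    proof (rule span_minimal)
      show "\<delta> ` X \<subseteq> range (lin_ext D)"
      proof
        fix u assume "u \<in> \<delta> ` X"
        then obtain x where "x \<in> X" "u = \<delta> x" by blast
        then have "u = lin_ext D (pt x)" by (simp add: D_def \<pi>(3))
        then show "u \<in> range (lin_ext D)" by blast
      qed
      show "subspace (range (lin_ext D))" by (rule linear_subspace_image[OF linear_lin_ext subspace_UNIV])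
    qed
    then show "\<exists>a. NF (v - lin_ext D a) < e" using w by blast
  next
    fix R :: "('x \<Rightarrow>\<^sub>0 real) \<Rightarrow> real" and B a
    assume R: "gauge R p" and B: "0 \<le> B" "\<And>x y. R (pt x - pt y) \<le> B * \<nu> (x - y) powr (p / q)" and R0: "R (pt 0) = 0"
    interpret R: gauge R p by fact
    \<comment> \<open>Moving each point \<open>x\<close> to \<open>\<pi> x\<close> does not affect
      \<open>R\<close>, since these points have gauge distance 0, and it brings all points into
      \<open>X\<close>.\<close>
    define a' where "a' = lin_ext (\<lambda>x. pt (\<pi> x)) a"
    have "\<nu> (x - \<pi> x) = 0" for x
      using \<pi>(3)[OF \<pi>X] s_BanachD(5)[OF X, of 0] subX by (simp add: \<nu>_def linear_diff[OF \<pi>(1)] subspace_0)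
    then have "R (pt x - pt (\<pi> x)) = 0" for x
      using B(2)[of x "\<pi> x"] R.nonneg[of "pt x - pt (\<pi> x)"] by simp
    then have "R (lin_ext pt a) = R a'" unfolding a'_def by (rule R.lin_ext_gauge_zero)
    then have "R a = R a'" by (simp add: lin_ext_id)
    also have "R a' \<le> B * NF (lin_ext \<delta> a') powr p"
    proof (rule lipschitz_free_gauge_bound[OF free R B(1) _ R0])
      have "a' \<in> {a. Poly_Mapping.keys a \<subseteq> X}"
        unfolding a'_def using \<pi>X by (intro lin_ext_in_subspace keys_in_subspace) auto
      then show "Poly_Mapping.keys a' \<subseteq> X" by simp
      fix x y assume xy: "x \<in> X" "y \<in> X"
      then have d: "x - y \<in> X" using subX by (simp add: subspace_diff)
      show "R (pt x - pt y) \<le> B * N (x - y) powr p" using B(2)[of x y] by (simp add: \<nu>p \<pi>(3)[OF d])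
      show "0 \<le> N (x - y)" using s_BanachD(4)[OF X d] .
    qed
    also have "lin_ext \<delta> a' = lin_ext D a"
      unfolding a'_def lin_ext_comp[OF linear_lin_ext] by (simp add: D_def)
    finally show "R a \<le> B * NF (lin_ext D a) powr p" .
  qed
  then show ?thesis by (simp add: \<nu>_def D_def)
qed

text \<open>\<open>S\<close> is a linear right inverse of \<open>P\<close>, and \<open>P\<close>
  extends the Lipschitz map \<open>P\<close> after \<delta>; composed with a projection onto
  \<open>X\<close>, they form the configuration excluded by \<open>lift_impossible\<close>.\<close>

lemma not_complemented:
  fixes X :: "'x::real_vector set" and N :: "'x \<Rightarrow> real"
    and F :: "'f::real_vector set" and NF :: "'f \<Rightarrow> real" and \<delta> :: "'x \<Rightarrow> 'f"
  assumes X: "s_Banach q X N" and p: "0 < p" "p < q"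
    and inf: "infinite_dimensional X"
    and free: "lipschitz_free p X (qdist N) 0 F NF \<delta>"
    and S: "bounded_linear_between X N F NF S" and P: "bounded_linear_between F NF X N P"
    and PS: "\<And>x. x \<in> X \<Longrightarrow> P (S x) = x"
  shows False
proof -
  have F: "s_Banach p F NF" and \<delta>F: "\<delta> ` X \<subseteq> F" and \<delta>0: "\<delta> 0 = 0"
    and iso: "\<And>x y. x \<in> X \<Longrightarrow> y \<in> X \<Longrightarrow> NF (\<delta> x - \<delta> y) = N (x - y)"
    using free by (auto simp: lipschitz_free_def qdist_def)
  note subX = s_BanachD(3)[OF X] and subF = s_BanachD(3)[OF F]
  have q: "0 < q" using p by simp
  obtain \<pi> :: "'x \<Rightarrow> 'x" where \<pi>: "linear \<pi>" "range \<pi> \<subseteq> X" "\<And>x. x \<in> X \<Longrightarrow> \<pi> x = x"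
    using linear_exists_left_inverse_on[of id X] subX by (auto simp: linear_id)
  have \<pi>X: "\<pi> x \<in> X" for x using \<pi>(2) by auto
  define \<nu> where "\<nu> = (\<lambda>x. N (\<pi> x) powr q)"
  define D where "D = (\<lambda>x. \<delta> (\<pi> x))"
  define i where "i = (\<lambda>x. S (\<pi> x))"
  define f where "f = (\<lambda>x. P (D x))"
  interpret free_gauge \<nu> q p F NF D
    unfolding \<nu>_def D_def by (rule lipschitz_free_free_gauge[OF X p free \<pi>])
  have nn: "0 \<le> N (\<pi> x)" for x using s_BanachD(4)[OF X \<pi>X] .
  have \<nu>p: "\<nu> x powr (p / q) = N (\<pi> x) powr p" for x using p by (simp add: \<nu>_def powr_powr)
  obtain C where C: "\<And>x. x \<in> X \<Longrightarrow> NF (S x) \<le> C * N x" using bounded_linear_betweenD(4)[OF S] by blast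
  obtain C' where C': "\<And>v. v \<in> F \<Longrightarrow> N (P v) \<le> C' * NF v" using bounded_linear_betweenD(4)[OF P] by blast
  note SF = bounded_linear_betweenD(1-3)[OF S] and PX = bounded_linear_betweenD(1)[OF P]
  note Pdiff = bounded_linear_between_diff[OF P subF]
  have fX: "f x \<in> X" for x unfolding f_def by (rule PX[OF D(1)])
  have Pb: "N (P v) powr q \<le> \<bar>C'\<bar> powr q * NF v powr q" if "v \<in> F" for v
  proof -
    have n: "0 \<le> N (P v)" "0 \<le> NF v" using s_BanachD(4)[OF X PX[OF that]] s_BanachD(4)[OF F that] by auto
    have "N (P v) \<le> \<bar>C'\<bar> * NF v" using C'[OF that] n mult_right_mono[OF abs_ge_self[of C'] n(2)] by linarith
    then have "N (P v) powr q \<le> (\<bar>C'\<bar> * NF v) powr q" using n q by (intro powr_mono2) auto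
    then show ?thesis using n by (simp add: powr_mult)
  qed
  have Psum: "P (lin_ext D a) = lin_ext f a" for a
    unfolding f_def by (rule bounded_linear_between_lin_ext[OF P subF D(1)])
  \<comment> \<open>The exponent \<alpha> is the midpoint of p / q and 1.\<close>
  interpret lipschitz_lift \<nu> q p F NF D f i "\<bar>C'\<bar> powr q" "\<bar>C\<bar> powr p" "\<bar>C'\<bar> powr q" "(p + q) / (2 * q)"
  proof (rule lipschitz_lift.intro[OF free_gauge_axioms lipschitz_lift_axioms.intro])
    fix x y a
    have dF: "D x - D y \<in> F" using D(1) subF by (simp add: subspace_diff)
    have "\<nu> (f x - f y) = N (P (D x - D y)) powr q"
      using \<pi>(3) fX subX D(1) by (simp add: \<nu>_def f_def Pdiff subspace_diff)
    also have "\<dots> \<le> \<bar>C'\<bar> powr q * NF (D x - D y) powr q" by (rule Pb[OF dF])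
    also have "\<dots> = \<bar>C'\<bar> powr q * \<nu> (x - y)"
      using iso[OF \<pi>X \<pi>X] by (simp add: D_def \<nu>_def linear_diff[OF \<pi>(1)])
    finally show "\<nu> (f x - f y) \<le> \<bar>C'\<bar> powr q * \<nu> (x - y)" .
    show "f 0 = 0" by (simp add: f_def D bounded_linear_between_zero[OF P subF])
    show "linear i"
    proof (rule linearI)
      fix x y and c :: real
      show "i (x + y) = i x + i y" unfolding i_def linear_add[OF \<pi>(1)] by (rule SF(2)[OF \<pi>X \<pi>X])
      show "i (c *\<^sub>R x) = c *\<^sub>R i x" unfolding i_def linear_scale[OF \<pi>(1)] by (rule SF(3)[OF \<pi>X])
    qed
    show iF: "i x \<in> F" unfolding i_def by (rule SF(1)[OF \<pi>X])
    have "NF (i x) \<le> \<bar>C\<bar> * N (\<pi> x)"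
      using C[OF \<pi>X, of x] mult_right_mono[OF abs_ge_self[of C] nn[of x]] by (simp add: i_def)
    then have "NF (i x) powr p \<le> (\<bar>C\<bar> * N (\<pi> x)) powr p"
      using s_BanachD(4)[OF F iF] p by (intro powr_mono2) auto
    then show "NF (i x) powr p \<le> \<bar>C\<bar> powr p * \<nu> x powr (p / q)" using nn by (simp add: powr_mult \<nu>p)
    have lX: "lin_ext f a \<in> X" using lin_ext_in_subspace[OF subX fX] .
    have dF2: "i x - lin_ext D a \<in> F" using iF lin_ext_D subF by (simp add: subspace_diff)
    have "\<nu> (x - lin_ext f a) = N (P (i x - lin_ext D a)) powr q"
      using iF lin_ext_D[of a] PS[OF \<pi>X, of x]
      by (simp add: \<nu>_def linear_diff[OF \<pi>(1)] \<pi>(3)[OF lX] Pdiff Psum i_def)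
    then show "\<nu> (x - lin_ext f a) \<le> \<bar>C'\<bar> powr q * NF (i x - lin_ext D a) powr q"
      using Pb[OF dF2] by simp
  qed (use p q in \<open>auto simp: field_simps\<close>)
  show False
  proof (rule lift_impossible)
    fix c :: "nat \<Rightarrow> 'x" assume c: "\<forall>e>0. \<exists>n0. \<forall>m\<ge>n0. \<forall>n\<ge>n0. \<nu> (c m - c n) < e"
    have "\<exists>n0. \<forall>m\<ge>n0. \<forall>n\<ge>n0. N (\<pi> (c m) - \<pi> (c n)) < e" if e: "e > 0" for e
    proof -
      have "e powr q > 0" using e by simp
      with c obtain n0 where n0: "\<And>m n. m \<ge> n0 \<Longrightarrow> n \<ge> n0 \<Longrightarrow> \<nu> (c m - c n) < e powr q" by blast
      have "N (\<pi> (c m) - \<pi> (c n)) < e" if "m \<ge> n0" "n \<ge> n0" for m n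
      proof (rule ccontr)
        assume "\<not> ?thesis"
        then have "e powr q \<le> N (\<pi> (c m) - \<pi> (c n)) powr q" using e q by (intro powr_mono2) auto
        then show False using n0[OF that] by (simp add: \<nu>_def linear_diff[OF \<pi>(1)])
      qed
      then show ?thesis by blast
    qed
    then obtain z where z: "z \<in> X" "(\<lambda>n. N (\<pi> (c n) - z)) \<longlonglongrightarrow> 0"
      using complete_onD[OF X, of "\<lambda>n. \<pi> (c n)"] \<pi>X by blast
    have dz: "\<pi> (c n - z) = \<pi> (c n) - z" for n using z by (simp add: linear_diff[OF \<pi>(1)] \<pi>(3))
    have "(\<lambda>n. N (\<pi> (c n) - z) powr q) \<longlonglongrightarrow> 0"
      using z q nn[of "c _ - z"] by (intro tendsto_zero_powrI[where b = q]) (auto simp: dz)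
    then have "converges_to c z" unfolding converges_to_def by (simp add: \<nu>_def dz)
    then show "\<exists>z. converges_to c z" by blast
  next
    fix B :: "'x set" assume "finite B"
    then have "\<not> X \<subseteq> span (\<pi> ` B)" using inf unfolding infinite_dimensional_def by blast
    then obtain x where x: "x \<in> X" "x \<notin> span (\<pi> ` B)" by blast
    have "\<nu> (x - e) \<noteq> 0" if e: "e \<in> span B" for e
    proof
      assume "\<nu> (x - e) = 0"
      then have "N (\<pi> (x - e)) = 0" by (simp add: \<nu>_def)
      then have "\<pi> (x - e) = 0" using s_BanachD(5)[OF X \<pi>X] by blast
      then have "x = \<pi> e" using x by (simp add: linear_diff[OF \<pi>(1)] \<pi>(3))
      then show False using x e linear_span_image[OF \<pi>(1), of B] by blast
    qed
    then show "\<exists>x. \<forall>e\<in>span B. \<nu> (x - e) \<noteq> 0" by blast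
  qed
qed

section \<open>The nonlinear splitting and the conclusion\<close>

lemma lipschitz_isomorphic_kernel:
  fixes \<delta> :: "'x::real_vector \<Rightarrow> 'f::real_vector"
  assumes X: "s_Banach q X N" and p: "0 < p" "p \<le> q"
    and free: "lipschitz_free p X (qdist N) 0 F NF \<delta>"
  shows "lipschitz_isomorphic F (qdist NF) (X \<times> barycenter_kernel X N F NF \<delta>) (qdist (sum_norm p N NF))"
proof -
  have F: "s_Banach p F NF" and \<delta>F: "\<delta> ` X \<subseteq> F"
    and iso: "\<And>x y. x \<in> X \<Longrightarrow> y \<in> X \<Longrightarrow> NF (\<delta> x - \<delta> y) = N (x - y)"
    using free by (auto simp: lipschitz_free_def qdist_def)
  note subX = s_BanachD(3)[OF X] and subF = s_BanachD(3)[OF F]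
  define b where "b = barycenter X N F NF \<delta>"
  define Z where "Z = barycenter_kernel X N F NF \<delta>"
  have Z: "Z = {v \<in> F. b v = 0}" by (simp add: Z_def barycenter_kernel_def b_def)
  have lin: "linearizes X F NF \<delta> X N (\<lambda>x. x) b"
    unfolding b_def by (rule barycenter_linearizes[OF X p free])
  then have b: "bounded_linear_between F NF X N b" and b\<delta>: "\<And>x. x \<in> X \<Longrightarrow> b (\<delta> x) = x"
    by (auto simp: linearizes_def)
  note bX = bounded_linear_betweenD(1)[OF b] and badd = bounded_linear_betweenD(2)[OF b]
  note bdiff = bounded_linear_between_diff[OF b subF]
  have d: "\<delta> x \<in> F" if "x \<in> X" for x using \<delta>F that by auto
  define \<phi> where "\<phi> = (\<lambda>v. (b v, v - \<delta> (b v)))"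
  have \<phi>_in: "\<phi> v \<in> X \<times> Z" if "v \<in> F" for v
    using that bX[OF that] d subF by (auto simp: \<phi>_def Z bdiff b\<delta> subspace_diff)
  have \<psi>\<phi>: "snd (\<phi> v) + \<delta> (fst (\<phi> v)) = v" for v by (simp add: \<phi>_def)
  have \<psi>_in: "z + \<delta> x \<in> F" "\<phi> (z + \<delta> x) = (x, z)" if "x \<in> X" "z \<in> Z" for x z
    using that d[OF that(1)] subF by (auto simp: \<phi>_def Z badd b\<delta> subspace_add)
  have inj: "inj_on \<phi> F" by (rule inj_on_inverseI[of _ "\<lambda>u. snd u + \<delta> (fst u)"]) (rule \<psi>\<phi>)
  have "\<phi> ` F = X \<times> Z"
  proof
    show "X \<times> Z \<subseteq> \<phi> ` F"
    proof
      fix u assume "u \<in> X \<times> Z"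
      then obtain x z where u: "u = (x, z)" "x \<in> X" "z \<in> Z" by blast
      then show "u \<in> \<phi> ` F" using \<psi>_in[OF u(2,3)] by (metis imageI)
    qed
  qed (use \<phi>_in in blast)
  then have bij: "bij_betw \<phi> F (X \<times> Z)" using inj by (simp add: bij_betw_def)
  have inv: "the_inv_into F \<phi> u = snd u + \<delta> (fst u)" if "u \<in> X \<times> Z" for u
    using \<psi>_in[of "fst u" "snd u"] that by (intro the_inv_into_f_eq[OF inj]) auto
  obtain C where C: "\<And>v. v \<in> F \<Longrightarrow> N (b v) \<le> C * NF v" using b unfolding bounded_linear_between_def by blast
  \<comment> \<open>One summand with \<open>C\<close> comes from the first coordinate
    \<open>b v\<close>, the other from \<open>\<delta> (b v)\<close> in the second; \<delta> is
    isometric.\<close>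
  define L where "L = (1 + 2 * \<bar>C\<bar> powr p) powr (1 / p)"
  have "lipschitz_with L F (qdist NF) (qdist (sum_norm p N NF)) \<phi>"
    unfolding lipschitz_with_def qdist_def
  proof (intro conjI ballI)
    fix v w assume vw: "v \<in> F" "w \<in> F"
    have vwF: "v - w \<in> F" "\<delta> (b v) \<in> F" "\<delta> (b w) \<in> F" "\<delta> (b w) - \<delta> (b v) \<in> F"
      using vw bX d subF by (auto intro!: subspace_diff)
    have n: "0 \<le> NF (v - w)" "0 \<le> N (b v - b w)"
      using s_BanachD(4)[OF F vwF(1)] s_BanachD(4)[OF X subspace_diff[OF subX bX[OF vw(1)] bX[OF vw(2)]]] by auto
    have "N (b v - b w) \<le> \<bar>C\<bar> * NF (v - w)"
      using C[OF vwF(1)] mult_right_mono[OF abs_ge_self[of C] n(1)] vw by (simp add: bdiff)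
    then have "N (b v - b w) powr p \<le> (\<bar>C\<bar> * NF (v - w)) powr p" using n p by (intro powr_mono2) auto
    then have 1: "N (b v - b w) powr p \<le> \<bar>C\<bar> powr p * NF (v - w) powr p" using n by (simp add: powr_mult)
    have eq: "(v - \<delta> (b v)) - (w - \<delta> (b w)) = (v - w) + (\<delta> (b w) - \<delta> (b v))" by simp
    have "NF ((v - \<delta> (b v)) - (w - \<delta> (b w))) powr p \<le> NF (v - w) powr p + N (b v - b w) powr p"
      unfolding eq
      using s_BanachD(7)[OF F vwF(1,4)] iso[OF bX[OF vw(2)] bX[OF vw(1)]]
        norm_minus_commute_on[OF X bX[OF vw(1)] bX[OF vw(2)]] by simp
    then have "N (b v - b w) powr p + NF ((v - \<delta> (b v)) - (w - \<delta> (b w))) powr p \<le> (1 + 2 * \<bar>C\<bar> powr p) * NF (v - w) powr p"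
      using 1 by (simp add: algebra_simps)
    then have "sum_norm p N NF (\<phi> v - \<phi> w) \<le> ((1 + 2 * \<bar>C\<bar> powr p) * NF (v - w) powr p) powr (1 / p)"
      unfolding sum_norm_def \<phi>_def using p by (auto intro!: powr_mono2)
    also have "\<dots> = L * NF (v - w)" using n p by (simp add: L_def powr_mult powr_powr)
    finally show "sum_norm p N NF (\<phi> v - \<phi> w) \<le> L * NF (v - w)" .
  qed (simp add: L_def)
  moreover have "lipschitz_with 1 (X \<times> Z) (qdist (sum_norm p N NF)) (qdist NF) (the_inv_into F \<phi>)"
    unfolding lipschitz_with_def qdist_def
  proof (intro conjI ballI)
    fix u u' assume u: "u \<in> X \<times> Z" "u' \<in> X \<times> Z"
    obtain x z x' z' where e: "u = (x, z)" "u' = (x', z')" by (metis surj_pair)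
    have x: "x \<in> X" "x' \<in> X" "z \<in> F" "z' \<in> F" using u by (auto simp: e Z)
    have dF: "z - z' \<in> F" "\<delta> x - \<delta> x' \<in> F" using x d subF by (auto intro!: subspace_diff)
    have eq: "(z + \<delta> x) - (z' + \<delta> x') = (z - z') + (\<delta> x - \<delta> x')" by simp
    have sF: "(z + \<delta> x) - (z' + \<delta> x') \<in> F" unfolding eq using dF subF by (rule subspace_add[rotated 1])
    have "NF ((z + \<delta> x) - (z' + \<delta> x')) powr p \<le> N (x - x') powr p + NF (z - z') powr p"
      unfolding eq using s_BanachD(7)[OF F dF] iso[OF x(1,2)] by simp
    then have "(NF ((z + \<delta> x) - (z' + \<delta> x')) powr p) powr (1 / p) \<le> sum_norm p N NF (u - u')"
      unfolding sum_norm_def e using p by (auto intro!: powr_mono2)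
    then show "NF (the_inv_into F \<phi> u - the_inv_into F \<phi> u') \<le> 1 * sum_norm p N NF (u - u')"
      using p s_BanachD(4)[OF F sF] unfolding inv[OF u(1)] inv[OF u(2)] by (simp add: e powr_powr)
  qed simp
  ultimately show ?thesis unfolding lipschitz_isomorphic_def Z_def[symmetric] using bij by blast
qed

theorem corollary7p11:
  fixes X :: "'x::real_vector set" and N :: "'x \<Rightarrow> real"
    and F :: "'f::real_vector set" and NF :: "'f \<Rightarrow> real" and \<delta> :: "'x \<Rightarrow> 'f"
    and p q :: real
  assumes "0 < p" and "p < q" and "q \<le> 1"
    and "s_Banach q X N" and "infinite_dimensional X"
    and "lipschitz_free p X (qdist N) 0 F NF \<delta>"
  shows "lipschitz_isomorphic F (qdist NF)
           (X \<times> barycenter_kernel X N F NF \<delta>) (qdist (sum_norm p N NF)) \<and>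
         \<not> linearly_isomorphic F NF
           (X \<times> barycenter_kernel X N F NF \<delta>) (sum_norm p N NF)"
proof
  note p = assms(1,2) and X = assms(4) and free = assms(6)
  let ?Z = "barycenter_kernel X N F NF \<delta>" and ?n = "sum_norm p N NF"
  show "lipschitz_isomorphic F (qdist NF) (X \<times> ?Z) (qdist ?n)"
    using lipschitz_isomorphic_kernel[OF X p(1) less_imp_le[OF p(2)] free] .
  show "\<not> linearly_isomorphic F NF (X \<times> ?Z) ?n"
  proof
    assume "linearly_isomorphic F NF (X \<times> ?Z) ?n"
    then obtain T where bij: "bij_betw T F (X \<times> ?Z)"
      and T: "bounded_linear_between F NF (X \<times> ?Z) ?n T"
      and T': "bounded_linear_between (X \<times> ?Z) ?n F NF (the_inv_into F T)"
      unfolding linearly_isomorphic_def by blast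
    have F: "s_Banach p F NF" using free by (simp add: lipschitz_free_def)
    have Zs: "s_Banach p ?Z NF" by (rule barycenter_kernel_s_Banach[OF X p(1) less_imp_le[OF p(2)] free])
    have Z0: "0 \<in> ?Z" using s_BanachD(3)[OF Zs] by (rule subspace_0)
    have NF0: "NF 0 = 0" using s_BanachD(5)[OF Zs Z0] by simp
    have n0: "?n (x, 0) = N x" if "x \<in> X" for x
      using p s_BanachD(4)[OF X that] by (simp add: sum_norm_def NF0 powr_powr)
    have fst_le: "N (fst u) \<le> ?n u" if "u \<in> X \<times> ?Z" for u
    proof -
      have "N (fst u) = (N (fst u) powr p) powr (1 / p)"
        using that p s_BanachD(4)[OF X, of "fst u"] by (auto simp: powr_powr)
      also have "\<dots> \<le> ?n u"
        using p by (auto simp: sum_norm_def case_prod_beta intro!: powr_mono2)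
      finally show ?thesis .
    qed
    \<comment> \<open>The inclusion of the summand \<open>X\<close> followed by the inverse
      isomorphism. The first coordinate of \<open>T\<close> is its left inverse.\<close>
    have S: "bounded_linear_between X N F NF (\<lambda>x. the_inv_into F T (x, 0))"
      unfolding bounded_linear_between_def
    proof (intro conjI ballI allI)
      have T'F: "the_inv_into F T u \<in> F" if "u \<in> X \<times> ?Z" for u
        using T' that unfolding bounded_linear_between_def by blast
      show "(\<lambda>x. the_inv_into F T (x, 0)) ` X \<subseteq> F" using Z0 by (auto intro!: T'F)
      fix x assume x: "x \<in> X"
      have x0: "(x, 0) \<in> X \<times> ?Z" using x Z0 by simp
      show "the_inv_into F T (a *\<^sub>R x, 0) = a *\<^sub>R the_inv_into F T (x, 0)" for a
        using T' x0 unfolding bounded_linear_between_def by (metis scaleR_Pair scaleR_zero_right)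
      fix y assume "y \<in> X"
      then have "(y, 0) \<in> X \<times> ?Z" using Z0 by simp
      then show "the_inv_into F T (x + y, 0) = the_inv_into F T (x, 0) + the_inv_into F T (y, 0)"
        using T' x0 unfolding bounded_linear_between_def by (metis add_Pair add.right_neutral)
    next
      obtain C where "\<And>u. u \<in> X \<times> ?Z \<Longrightarrow> NF (the_inv_into F T u) \<le> C * ?n u"
        using T' unfolding bounded_linear_between_def by blast
      then show "\<exists>C. \<forall>x\<in>X. NF (the_inv_into F T (x, 0)) \<le> C * N x"
        using Z0 n0 by (metis mem_Sigma_iff)
    qed
    have P: "bounded_linear_between F NF X N (\<lambda>v. fst (T v))"
      unfolding bounded_linear_between_def
    proof (intro conjI ballI allI)
      have TF: "T v \<in> X \<times> ?Z" if "v \<in> F" for v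
        using T that unfolding bounded_linear_between_def by blast
      show "(\<lambda>v. fst (T v)) ` F \<subseteq> X" using TF by (force simp: mem_Times_iff)
      show "fst (T (v + w)) = fst (T v) + fst (T w)" if "v \<in> F" "w \<in> F" for v w
        using T that unfolding bounded_linear_between_def by simp
      show "fst (T (a *\<^sub>R v)) = a *\<^sub>R fst (T v)" if "v \<in> F" for v a
        using T that unfolding bounded_linear_between_def by simp
      obtain C where "\<And>v. v \<in> F \<Longrightarrow> ?n (T v) \<le> C * NF v"
        using T unfolding bounded_linear_between_def by blast
      then show "\<exists>C. \<forall>v\<in>F. N (fst (T v)) \<le> C * NF v"
        using fst_le[OF TF] order_trans by blast
    qed
    have PS: "fst (T (the_inv_into F T (x, 0))) = x" if "x \<in> X" for x
      using f_the_inv_into_f_bij_betw[OF bij, of "(x, 0)"] that Z0 by simp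
    show False by (rule not_complemented[OF X p assms(5) free S P PS])
  qed
qed

end
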